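(* Let $d_x,d_y\in\mathbb{N}$ and let $\nu=\sum_{j=1}^{\ell}\nu_j\delta_{y_j}$ be a finitely discrete probability measure on $\mathbb{R}^{d_y}$, where $\{y_1,\dots,y_\ell\}\subset\mathbb{R}^{d_y}$ with $\max_{1\le j\le\ell}\|y_j\|\le 1$, $\nu_j>0$ for all $j$, and $\sum_{j=1}^\ell\nu_j=1$. For given $q\in(2,\infty)$ and $M\ge1$, there exists a constant $C>0$ depending only on $d_x,d_y,q,M,\ell$ and $\min_{1\le j\le\ell}\nu_j$ such that for all integers $n,m\ge2$, $$ \sup_{\mu\in\mathcal{P}_{2q}(\mathbb{R}^{d_x}):\ \mathfrak{m}_{2q}(\mu)\le M}\mathbb{E}\big[|D(\hat\mu_n,\hat\nu_m)-D(\mu,\nu)|\big]\le C\Big((n\wedge m)^{-1/2}+n^{\frac{2-q}{q}}\Big). $$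
   Context: Notation: $a\wedge b=\min\{a,b\}$; $\|\cdot\|$ is the Euclidean norm. $\mathcal{P}_p(\mathbb{R}^d)$ is the set of Borel probability measures $\mu$ on $\mathbb{R}^d$ with $\mathfrak{m}_p(\mu):=\int\|x\|^p\,d\mu(x)<\infty$. For probability measures $\mu$ on $\mathbb{R}^{d_x}$ and $\nu$ on $\mathbb{R}^{d_y}$ with finite fourth moments, $$ D(\mu,\nu):=\mathsf{GW}_{2,2}^2(\mu,\nu)=\inf_{\pi\in\Pi(\mu,\nu)}\int\int\big|\|x-x'\|^2-\|y-y'\|^2\big|^2\,d\pi(x,y)\,d\pi(x',y'), $$ where $\Pi(\mu,\nu)$ is the set of couplings of $\mu$ and $\nu$ (joint distributions with marginals $\mu,\nu$). $X_1,\dots,X_n$ are i.i.d. from $\mu$ and $Y_1,\dots,Y_m$ are i.i.d. from $\nu$, the two samples being independent of each other; $\hat\mu_n=\frac1n\sum_{i=1}^n\delta_{X_i}$ and $\hat\nu_m=\frac1m\sum_{j=1}^m\delta_{Y_j}$. *)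

theory Defs
  imports "HOL-Probability.Probability"
begin

definition moment :: "real \<Rightarrow> 'a::euclidean_space measure \<Rightarrow> ennreal" where
  "moment p \<mu> = (\<integral>\<^sup>+ x. ennreal (norm x powr p) \<partial>\<mu>)"

definition prob_moment :: "real \<Rightarrow> 'a::euclidean_space measure set" where
  "prob_moment p = {\<mu>. sets \<mu> = sets borel \<and> prob_space \<mu> \<and> moment p \<mu> < \<infinity>}"

definition couplings ::
    "'a::euclidean_space measure \<Rightarrow> 'b::euclidean_space measure \<Rightarrow> ('a \<times> 'b) measure set" where
  "couplings \<mu> \<nu> = {\<pi>. sets \<pi> = sets borel \<and> prob_space \<pi> \<and>
     distr \<pi> borel fst = \<mu> \<and> distr \<pi> borel snd = \<nu>}"

definition GW_cost :: "('a::euclidean_space \<times> 'b::euclidean_space) measure \<Rightarrow> ennreal" where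
  "GW_cost \<pi> = (\<integral>\<^sup>+ (x, y). (\<integral>\<^sup>+ (x', y').
     ennreal (\<bar>(norm (x - x'))\<^sup>2 - (norm (y - y'))\<^sup>2\<bar>\<^sup>2) \<partial>\<pi>) \<partial>\<pi>)"

text \<open>The squared (2,2)-Gromov-Wasserstein distance. The infimum is taken in \<open>[0, \<infinity>]\<close>; it is
  finite whenever both marginals have finite fourth moments, so \<open>enn2real\<close> loses nothing there.\<close>

definition GW_sq :: "'a::euclidean_space measure \<Rightarrow> 'b::euclidean_space measure \<Rightarrow> real" where
  "GW_sq \<mu> \<nu> = enn2real (INF \<pi> \<in> couplings \<mu> \<nu>. GW_cost \<pi>)"

text \<open>The measure \<open>\<Sum>j = 1..k. w j * \<delta> (z j)\<close>.\<close>

definition discrete_measure ::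
    "nat \<Rightarrow> (nat \<Rightarrow> real) \<Rightarrow> (nat \<Rightarrow> 'a::euclidean_space) \<Rightarrow> 'a measure" where
  "discrete_measure k w z = measure_of UNIV (sets borel)
     (\<lambda>A. \<Sum>j = 1..k. ennreal (w j) * emeasure (return borel (z j)) A)"

definition empirical :: "nat \<Rightarrow> (nat \<Rightarrow> 'a::euclidean_space) \<Rightarrow> 'a measure" where
  "empirical n x = discrete_measure n (\<lambda>_. 1 / real n) x"

lemma sets_discrete_measure [simp]: "sets (discrete_measure k w z) = sets borel"
  unfolding discrete_measure_def
  by (metis sets.sets_measure_of_eq space_borel)

lemma space_discrete_measure [simp]: "space (discrete_measure k w z) = UNIV"
  unfolding discrete_measure_def by (simp add: space_measure_of_conv)

text \<open>\<open>measure_of\<close> yields the zero measure on set functions that are not countably additive;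
  the next lemma shows that this does not happen here.\<close>

lemma emeasure_discrete_measure:
  fixes z :: "nat \<Rightarrow> 'a::euclidean_space"
  assumes "A \<in> sets borel"
  shows "emeasure (discrete_measure k w z) A = (\<Sum>j = 1..k. ennreal (w j) * indicator A (z j))"
proof -
  let ?f = "\<lambda>A. \<Sum>j = 1..k. ennreal (w j) * emeasure (return borel (z j)) A"
  have "emeasure (discrete_measure k w z) A = ?f A"
  proof (rule emeasure_measure_of[OF discrete_measure_def])
    show "countably_additive (sets (discrete_measure k w z)) ?f"
    proof (rule countably_additiveI)
      fix B :: "nat \<Rightarrow> 'a set"
      assume B: "range B \<subseteq> sets (discrete_measure k w z)" "disjoint_family B"
      have "(\<Sum>i. ?f (B i)) = (\<Sum>j = 1..k. \<Sum>i. ennreal (w j) * emeasure (return borel (z j)) (B i))"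
        by (rule suminf_sum) simp
      also have "\<dots> = ?f (\<Union>i. B i)"
        using B by (intro sum.cong refl) (simp del: emeasure_return add: suminf_emeasure)
      finally show "(\<Sum>i. ?f (B i)) = ?f (\<Union>i. B i)" .
    qed
  qed (use assms in \<open>auto simp: positive_def\<close>)
  then show ?thesis
    using assms by simp
qed

lemma prob_space_discrete_measure:
  assumes "\<And>j. j \<in> {1..k} \<Longrightarrow> 0 \<le> w j" "(\<Sum>j = 1..k. w j) = 1"
  shows "prob_space (discrete_measure k w z)"
proof
  have "emeasure (discrete_measure k w z) UNIV = (\<Sum>j = 1..k. ennreal (w j))"
    by (simp add: emeasure_discrete_measure)
  also have "\<dots> = 1"
    using assms by (subst sum_ennreal) auto
  finally show "emeasure (discrete_measure k w z) (space (discrete_measure k w z)) = 1"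
    by simp
qed

text \<open>\<open>expected_error n m \<mu> \<nu>\<close> is the mean absolute error of the plug-in estimator, for independent
  i.i.d. samples of sizes \<open>n\<close> and \<open>m\<close>, realised as the coordinates of the product
  probability space. The integrand is nonnegative, so the mean is taken in \<open>[0, \<infinity>]\<close>.\<close>

definition expected_error ::
    "nat \<Rightarrow> nat \<Rightarrow> 'a::euclidean_space measure \<Rightarrow> 'b::euclidean_space measure \<Rightarrow> ennreal" where
  "expected_error n m \<mu> \<nu> =
     (\<integral>\<^sup>+ (x, y). ennreal \<bar>GW_sq (empirical n x) (empirical m y) - GW_sq \<mu> \<nu>\<bar>
        \<partial>(PiM {1..n} (\<lambda>_. \<mu>) \<Otimes>\<^sub>M PiM {1..m} (\<lambda>_. \<nu>)))"

end

theory Submission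
  imports Defs
begin

text \<open>Expanding the square, \<open>D(\<mu>,\<nu>)\<close> is the sum of the fourth-power energies of \<open>\<mu>\<close> and \<open>\<nu>\<close> minus twice
  the supremum over couplings of the alignment \<open>\<integral>\<integral> |x - x'|\<^sup>2 |y - y'|\<^sup>2\<close>. The energy of the
  empirical measure is a V-statistic whose kernel has a moment of order \<open>q/2\<close>, which gives the rate
  \<open>n\<^bsup>(2-q)/q\<^esup>\<close> by truncation.

  For fixed marginals the alignment is a convex quadratic function of the coupling. Linearising it at a
  coupling of one pair of marginals and dualising the resulting semidiscrete transport problem for the
  other pair compares the two suprema. The comparison only involves the differences of the weights of \<open>\<nu>\<close>
  and of the integrals of functions \<open>max\<^sub>v \<langle>\<theta>\<^sub>v, (|x|\<^sup>2, x, 1)\<rangle>\<close> with bounded \<open>\<theta>\<close>; the dual variables are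
  bounded because the weights of \<open>\<nu>\<close> are bounded below. The empirical process of these functions is
  \<open>O(n\<^bsup>-1/2\<^esup>)\<close> without a logarithm: symmetrisation and a contraction argument remove the maximum, one
  sample at a time, and Cauchy-Schwarz handles the remaining linear class.\<close>

section \<open>Deviations of sums of independent variables\<close>

text \<open>The error is bounded by a deterministic inequality in which the sample enters only
  through a supremum over a fixed class of test functions, an energy and the weights of the atoms.
  The linearisation and its potentials depend on the sample, so the class is fixed only if their
  coefficients stay within a radius \<open>R\<close> determined by the moments and the smallest
  weight of the population. Samples for which this fails are paid for by the very deviations being
  estimated; no separate probability bound is made.

  Convexity works in one direction only, so each inequality is linearised at a coupling of the pair
  whose alignment is to be dominated and dualised for the other pair.

  The vector \<open>(|x|^2, x, 1)\<close> is square integrable once the fourth moment is finite, so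
  the part depending on the coupling loses nothing for \<open>q > 2\<close>; only the energy of
  \<open>\<mu>\<close> feels \<open>q\<close>. Expectations are extended nonnegative integrals,
  which spares prior integrability of suprema at the price of \<open>ennreal\<close> truncating
  negative values.\<close>

lemma (in prob_space) nn_integral_sqrt_le:
  assumes [measurable]: "X \<in> borel_measurable M" and nonneg: "\<And>x. 0 \<le> X x"
    and le: "(\<integral>\<^sup>+x. ennreal (X x) \<partial>M) \<le> ennreal c" and c: "0 < c"
  shows "(\<integral>\<^sup>+x. ennreal (sqrt (X x)) \<partial>M) \<le> ennreal (sqrt c)"
proof -
  \<comment> \<open>The tangent of the square root at \<open>c\<close>. Integrating it gives
    Jensen's inequality directly in the extended integral.\<close>
  have pw: "sqrt (X x) \<le> 1 / (2 * sqrt c) * X x + sqrt c / 2" for x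
  proof -
    have "0 \<le> (sqrt (X x) - sqrt c)\<^sup>2 / (2 * sqrt c)"
      using c by simp
    also have "\<dots> = 1 / (2 * sqrt c) * X x + sqrt c / 2 - sqrt (X x)"
      using c nonneg[of x] by (simp add: power2_diff field_simps)
    finally show ?thesis by simp
  qed
  have "(\<integral>\<^sup>+x. ennreal (sqrt (X x)) \<partial>M)
      \<le> (\<integral>\<^sup>+x. ennreal (1 / (2 * sqrt c)) * ennreal (X x) + ennreal (sqrt c / 2) \<partial>M)"
    using c nonneg pw
    by (intro nn_integral_mono) (simp add: ennreal_mult[symmetric] ennreal_plus[symmetric] ennreal_leI del: ennreal_plus)
  also have "\<dots> = ennreal (1 / (2 * sqrt c)) * (\<integral>\<^sup>+x. ennreal (X x) \<partial>M) + ennreal (sqrt c / 2)"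
    by (subst nn_integral_add) (simp_all add: nn_integral_cmult emeasure_space_1)
  also have "\<dots> \<le> ennreal (1 / (2 * sqrt c)) * ennreal c + ennreal (sqrt c / 2)"
    using le by (intro add_mono mult_left_mono) auto
  also have "\<dots> = ennreal (sqrt c)"
    using c by (simp add: ennreal_mult[symmetric] ennreal_plus[symmetric] field_simps del: ennreal_plus)
  finally show ?thesis .
qed

text \<open>The offset \<open>c\<close> absorbs the coordinate that is split off, and Jensen's
  inequality for the root adds one \<open>s\<close> under it. This replaces expanding the square of
  the sum and cancelling covariances on the product space.\<close>

lemma nn_integral_abs_sum_centered_le:
  fixes g :: "'a \<Rightarrow> real" and B c s :: real
  assumes "prob_space \<mu>" and [measurable]: "g \<in> borel_measurable \<mu>"
    and bdd: "\<And>x. \<bar>g x\<bar> \<le> B" and s: "(\<integral>x. (g x)\<^sup>2 \<partial>\<mu>) \<le> s" "0 < s" and fin: "finite I"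
  shows "(\<integral>\<^sup>+x. ennreal \<bar>c + (\<Sum>i\<in>I. g (x i) - (\<integral>x. g x \<partial>\<mu>))\<bar> \<partial>PiM I (\<lambda>_. \<mu>))
    \<le> ennreal (sqrt (c\<^sup>2 + card I * s))"
  using fin
proof (induction I arbitrary: c)
  case empty
  then show ?case by (simp add: PiM_empty nn_integral_count_space_finite)
next
  case (insert i I)
  interpret prob_space \<mu> by fact
  interpret P: product_sigma_finite "\<lambda>_. \<mu>" by standard
  define m where "m = (\<integral>x. g x \<partial>\<mu>)"
  have [simp]: "integrable \<mu> g"
    using bdd by (intro integrable_const_bound[where B=B]) auto
  have sq: "(g x)\<^sup>2 \<le> B\<^sup>2" for x
    using power_mono[OF bdd[of x], of 2] by simp
  have [simp]: "integrable \<mu> (\<lambda>x. (g x)\<^sup>2)"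
    using sq by (intro integrable_const_bound[where B="B\<^sup>2"]) auto
  have "(\<integral>\<^sup>+x. ennreal \<bar>c + (\<Sum>i\<in>insert i I. g (x i) - m)\<bar> \<partial>PiM (insert i I) (\<lambda>_. \<mu>))
     = (\<integral>\<^sup>+y. \<integral>\<^sup>+x. ennreal \<bar>c + (\<Sum>j\<in>insert i I. g ((x(i := y)) j) - m)\<bar> \<partial>PiM I (\<lambda>_. \<mu>) \<partial>\<mu>)"
    using insert by (intro P.product_nn_integral_insert_rev) auto
  also have "\<dots> = (\<integral>\<^sup>+y. \<integral>\<^sup>+x. ennreal \<bar>(c + (g y - m)) + (\<Sum>j\<in>I. g (x j) - m)\<bar> \<partial>PiM I (\<lambda>_. \<mu>) \<partial>\<mu>)"
  proof -
    have "(\<Sum>j\<in>I. g ((x(i := y)) j) - m) = (\<Sum>j\<in>I. g (x j) - m)" for x y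
      using insert.hyps by (intro sum.cong) auto
    with insert.hyps show ?thesis by (simp add: add.assoc)
  qed
  also have "\<dots> \<le> (\<integral>\<^sup>+y. ennreal (sqrt ((c + (g y - m))\<^sup>2 + card I * s)) \<partial>\<mu>)"
    using insert.IH unfolding m_def by (intro nn_integral_mono) auto
  also have "\<dots> \<le> ennreal (sqrt (c\<^sup>2 + card (insert i I) * s))"
  proof (rule nn_integral_sqrt_le)
    have eq: "(c + (g y - m))\<^sup>2 + card I * s = (c - m)\<^sup>2 + card I * s + 2 * (c - m) * g y + (g y)\<^sup>2" for y
      by (simp add: power2_eq_square algebra_simps)
    have int: "integrable \<mu> (\<lambda>y. (c + (g y - m))\<^sup>2 + card I * s)"
      unfolding eq by (intro Bochner_Integration.integrable_add integrable_mult_right) auto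
    have "(\<integral>y. (c + (g y - m))\<^sup>2 + card I * s \<partial>\<mu>) = (c - m)\<^sup>2 + card I * s + 2 * (c - m) * m + (\<integral>y. (g y)\<^sup>2 \<partial>\<mu>)"
      unfolding eq by (simp add: m_def prob_space)
    \<comment> \<open>Adding \<open>m\<^sup>2\<close> gives away the difference between second
      moment and variance and lets the offsets recombine to \<open>c\<^sup>2\<close>.\<close>
    also have "\<dots> \<le> (c - m)\<^sup>2 + card I * s + 2 * (c - m) * m + s + m\<^sup>2" using s by (simp add: add_increasing2)
    also have "\<dots> = c\<^sup>2 + card (insert i I) * s"
      using insert.hyps by (simp add: power2_eq_square algebra_simps)
    finally show "(\<integral>\<^sup>+y. ennreal ((c + (g y - m))\<^sup>2 + card I * s) \<partial>\<mu>) \<le> ennreal (c\<^sup>2 + card (insert i I) * s)"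
      using s int by (subst nn_integral_eq_integral) (auto intro!: ennreal_leI simp del: ennreal_plus)
  next
    show "0 < c\<^sup>2 + card (insert i I) * s"
      using s insert.hyps by (intro add_nonneg_pos mult_pos_pos) auto
  qed (use s in auto)
  finally show ?case unfolding m_def .
qed


text \<open>A bound of von Bahr-Esseen type by truncation at \<tau>, the \<open>p\<close>-th root of
  \<open>N\<close>: the bounded part has second moment of order \<open>\<tau> powr (2 - p)\<close>,
  the tail has mean of order \<open>\<tau> powr (1 - p)\<close>, and with
  \<open>N = \<tau> powr p\<close> summands both contribute order \<tau>. A bound \<open>N\<close>
  in place of the cardinality also covers the rows of a V-statistic, which have \<open>n - 1\<close>
  entries.\<close>

lemma nn_integral_abs_sum_deviation_le:
  fixes f :: "'a \<Rightarrow> real" and p K N :: real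
  assumes "prob_space \<mu>" and [measurable]: "f \<in> borel_measurable \<mu>" and f0: "\<And>x. 0 \<le> f x"
    and p: "1 < p" "p \<le> 2" and K: "(\<integral>\<^sup>+x. ennreal (f x powr p) \<partial>\<mu>) \<le> ennreal K" "0 \<le> K"
    and fin: "finite I" and N: "card I \<le> N" "1 \<le> N"
  shows "(\<integral>\<^sup>+x. ennreal \<bar>\<Sum>i\<in>I. f (x i) - (\<integral>x. f x \<partial>\<mu>)\<bar> \<partial>PiM I (\<lambda>_. \<mu>))
    \<le> ennreal ((3 * K + 1) * N powr (1 / p))"
proof -
  interpret prob_space \<mu> by fact
  interpret P: product_sigma_finite "\<lambda>_. \<mu>" by standard
  interpret PI: prob_space "PiM I (\<lambda>_. \<mu>)" by (rule prob_space_PiM) (rule assms)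
  define \<tau> where "\<tau> = N powr (1 / p)"
  have \<tau>: "0 < \<tau>" "1 \<le> \<tau>" using N p by (auto simp: \<tau>_def ge_one_powr_ge_zero)
  have N_eq: "N = \<tau> powr p" using N p by (simp add: \<tau>_def powr_powr)
  define g where "g x = (if f x \<le> \<tau> then f x else 0)" for x
  define h where "h x = (if f x \<le> \<tau> then 0 else f x)" for x
  have [measurable]: "g \<in> borel_measurable \<mu>" "h \<in> borel_measurable \<mu>"
    unfolding g_def h_def by measurable
  have f_eq: "f x = g x + h x" for x by (simp add: g_def h_def)
  have g_le: "(g x)\<^sup>2 \<le> f x powr p * \<tau> powr (2 - p)" for x
  proof (cases "0 < f x \<and> f x \<le> \<tau>")
    case True
    then have "(g x)\<^sup>2 = f x powr p * f x powr (2 - p)"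
      by (simp add: g_def powr_add[symmetric])
    also have "\<dots> \<le> f x powr p * \<tau> powr (2 - p)"
      using True p by (intro mult_left_mono powr_mono2) auto
    finally show ?thesis .
  next
    case False
    then show ?thesis using f0[of x] by (auto simp: g_def)
  qed
  have h_le: "h x \<le> f x powr p * \<tau> powr (1 - p)" for x
  proof (cases "f x \<le> \<tau>")
    case False
    then have "h x = f x powr p * f x powr (1 - p)"
      using \<tau> by (simp add: h_def powr_add[symmetric])
    also have "\<dots> \<le> f x powr p * \<tau> powr (1 - p)"
      using False p \<tau> by (intro mult_left_mono powr_mono2') auto
    finally show ?thesis .
  qed (auto simp: h_def)
  have h0: "0 \<le> h x" for x using f0 by (simp add: h_def)
  have int_fp: "integrable \<mu> (\<lambda>x. f x powr p)"
    using K by (intro integrableI_bounded) (auto intro: le_less_trans)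
  have fp_le: "(\<integral>x. f x powr p \<partial>\<mu>) \<le> K"
    using K int_fp by (subst (asm) nn_integral_eq_integral) auto
  have int_h: "integrable \<mu> h"
    by (rule Bochner_Integration.integrable_bound[OF integrable_mult_left[OF int_fp, of "\<tau> powr (1 - p)"]])
       (use h0 h_le in auto)
  have g_bd: "\<bar>g x\<bar> \<le> \<tau>" for x using f0[of x] \<tau> by (auto simp: g_def)
  have int_g: "integrable \<mu> g"
    using g_bd by (intro integrable_const_bound[where B=\<tau>]) auto
  have h_int_le: "(\<integral>x. h x \<partial>\<mu>) \<le> K * \<tau> powr (1 - p)"
  proof -
    have "(\<integral>x. h x \<partial>\<mu>) \<le> (\<integral>x. f x powr p * \<tau> powr (1 - p) \<partial>\<mu>)"
      using int_h int_fp h_le by (intro integral_mono) auto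
    also have "\<dots> \<le> K * \<tau> powr (1 - p)"
      using fp_le by (auto intro!: mult_right_mono)
    finally show ?thesis .
  qed
  have h_int0: "0 \<le> (\<integral>x. h x \<partial>\<mu>)" using h0 by simp
  \<comment> \<open>The \<open>+ 1\<close> keeps the bound positive when \<open>K = 0\<close>, as
    the estimate for centred sums requires.\<close>
  have g_sq: "(\<integral>x. (g x)\<^sup>2 \<partial>\<mu>) \<le> (K + 1) * \<tau> powr (2 - p)"
  proof -
    have "(\<integral>x. (g x)\<^sup>2 \<partial>\<mu>) \<le> (\<integral>x. f x powr p * \<tau> powr (2 - p) \<partial>\<mu>)"
    proof (rule integral_mono)
      show "integrable \<mu> (\<lambda>x. (g x)\<^sup>2)"
        by (rule Bochner_Integration.integrable_bound[OF integrable_mult_left[OF int_fp, of "\<tau> powr (2 - p)"]])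
           (use g_le in auto)
    qed (use int_fp g_le in auto)
    also have "\<dots> = (\<integral>x. f x powr p \<partial>\<mu>) * \<tau> powr (2 - p)" by simp
    also have "\<dots> \<le> (K + 1) * \<tau> powr (2 - p)"
      using fp_le by (intro mult_right_mono) auto
    finally show ?thesis .
  qed
  have G: "(\<integral>\<^sup>+x. ennreal \<bar>\<Sum>i\<in>I. g (x i) - (\<integral>x. g x \<partial>\<mu>)\<bar> \<partial>PiM I (\<lambda>_. \<mu>)) \<le> ennreal ((K + 1) * \<tau>)"
  proof -
    have "(\<integral>\<^sup>+x. ennreal \<bar>\<Sum>i\<in>I. g (x i) - (\<integral>x. g x \<partial>\<mu>)\<bar> \<partial>PiM I (\<lambda>_. \<mu>))
        \<le> ennreal (sqrt (card I * ((K + 1) * \<tau> powr (2 - p))))"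
      using nn_integral_abs_sum_centered_le[OF \<open>prob_space \<mu>\<close> _ g_bd g_sq _ fin, of 0] \<tau> K by simp
    also have "\<dots> \<le> ennreal ((K + 1) * \<tau>)"
    proof (intro ennreal_leI real_le_lsqrt)
      have "card I * ((K + 1) * \<tau> powr (2 - p)) \<le> N * ((K + 1) * \<tau> powr (2 - p))"
        using N K by (intro mult_right_mono) auto
      also have "\<dots> = (K + 1) * \<tau>\<^sup>2"
        unfolding N_eq using \<tau> by (simp add: powr_add[symmetric] mult.left_commute)
      also have "\<dots> \<le> (K + 1)\<^sup>2 * \<tau>\<^sup>2"
        using K by (intro mult_right_mono) (auto simp: power2_eq_square algebra_simps)
      finally show "card I * ((K + 1) * \<tau> powr (2 - p)) \<le> ((K + 1) * \<tau>)\<^sup>2"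
        by (simp add: power_mult_distrib)
    qed (use K \<tau> in auto)
    finally show ?thesis .
  qed
  have h_comp: "(\<integral>\<^sup>+x. ennreal (h (x i)) \<partial>PiM I (\<lambda>_. \<mu>)) = ennreal (\<integral>x. h x \<partial>\<mu>)" if "i \<in> I" for i
  proof -
    have "(\<integral>\<^sup>+x. ennreal (h (x i)) \<partial>PiM I (\<lambda>_. \<mu>)) = (\<integral>\<^sup>+y. ennreal (h y) \<partial>distr (PiM I (\<lambda>_. \<mu>)) \<mu> (\<lambda>x. x i))"
      using that by (subst nn_integral_distr) auto
    also have "distr (PiM I (\<lambda>_. \<mu>)) \<mu> (\<lambda>x. x i) = \<mu>"
      using that by (intro distr_PiM_component) (auto intro: assms fin)
    also have "(\<integral>\<^sup>+y. ennreal (h y) \<partial>\<mu>) = ennreal (\<integral>x. h x \<partial>\<mu>)"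
      using int_h h0 by (subst nn_integral_eq_integral) auto
    finally show ?thesis .
  qed
  \<comment> \<open>No cancellation is used in the tail: its values and its mean are added, hence
    the factor 2.\<close>
  have tail: "real (card I) * (2 * (\<integral>x. h x \<partial>\<mu>)) \<le> 2 * K * \<tau>"
  proof -
    have "real (card I) * (2 * (\<integral>x. h x \<partial>\<mu>)) \<le> N * (2 * (K * \<tau> powr (1 - p)))"
      using N h_int_le h_int0 by (intro mult_mono) auto
    also have "\<dots> = 2 * K * \<tau>"
      unfolding N_eq using \<tau> by (simp add: powr_add[symmetric] mult.left_commute)
    finally show ?thesis .
  qed
  have "(\<integral>\<^sup>+x. ennreal \<bar>\<Sum>i\<in>I. f (x i) - (\<integral>x. f x \<partial>\<mu>)\<bar> \<partial>PiM I (\<lambda>_. \<mu>))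
      \<le> (\<integral>\<^sup>+x. ennreal \<bar>\<Sum>i\<in>I. g (x i) - (\<integral>x. g x \<partial>\<mu>)\<bar> + (\<Sum>i\<in>I. ennreal (h (x i)) + ennreal (\<integral>x. h x \<partial>\<mu>)) \<partial>PiM I (\<lambda>_. \<mu>))"
  proof (rule nn_integral_mono)
    fix x
    have "(\<Sum>i\<in>I. f (x i) - (\<integral>x. f x \<partial>\<mu>))
        = (\<Sum>i\<in>I. g (x i) - (\<integral>x. g x \<partial>\<mu>)) + (\<Sum>i\<in>I. h (x i) - (\<integral>x. h x \<partial>\<mu>))"
      using int_g int_h by (simp add: f_eq sum.distrib[symmetric] algebra_simps)
    moreover have "\<bar>\<Sum>i\<in>I. h (x i) - (\<integral>x. h x \<partial>\<mu>)\<bar> \<le> (\<Sum>i\<in>I. h (x i) + (\<integral>x. h x \<partial>\<mu>))"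
    proof -
      have "\<bar>h (x i) - (\<integral>x. h x \<partial>\<mu>)\<bar> \<le> h (x i) + (\<integral>x. h x \<partial>\<mu>)" for i
        using h0[of "x i"] h_int0 by linarith
      then show ?thesis by (intro order_trans[OF sum_abs] sum_mono)
    qed
    ultimately have "\<bar>\<Sum>i\<in>I. f (x i) - (\<integral>x. f x \<partial>\<mu>)\<bar>
        \<le> \<bar>\<Sum>i\<in>I. g (x i) - (\<integral>x. g x \<partial>\<mu>)\<bar> + (\<Sum>i\<in>I. h (x i) + (\<integral>x. h x \<partial>\<mu>))"
      by linarith
    then show "ennreal \<bar>\<Sum>i\<in>I. f (x i) - (\<integral>x. f x \<partial>\<mu>)\<bar> \<le> ennreal \<bar>\<Sum>i\<in>I. g (x i) - (\<integral>x. g x \<partial>\<mu>)\<bar>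
        + (\<Sum>i\<in>I. ennreal (h (x i)) + ennreal (\<integral>x. h x \<partial>\<mu>))"
      using h0 h_int0 by (simp add: ennreal_plus[symmetric] sum_nonneg sum_ennreal ennreal_leI del: ennreal_plus)
  qed
  also have "\<dots> = (\<integral>\<^sup>+x. ennreal \<bar>\<Sum>i\<in>I. g (x i) - (\<integral>x. g x \<partial>\<mu>)\<bar> \<partial>PiM I (\<lambda>_. \<mu>))
      + (\<Sum>i\<in>I. (\<integral>\<^sup>+x. ennreal (h (x i)) \<partial>PiM I (\<lambda>_. \<mu>)) + ennreal (\<integral>x. h x \<partial>\<mu>))"
    by (subst nn_integral_add) (simp_all add: nn_integral_sum nn_integral_add PI.emeasure_space_1)
  also have "(\<Sum>i\<in>I. (\<integral>\<^sup>+x. ennreal (h (x i)) \<partial>PiM I (\<lambda>_. \<mu>)) + ennreal (\<integral>x. h x \<partial>\<mu>))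
      = ennreal (real (card I) * (2 * (\<integral>x. h x \<partial>\<mu>)))"
    using h_int0 by (simp add: h_comp ennreal_plus[symmetric] ennreal_mult ennreal_of_nat_eq_real_of_nat
        mult_2[symmetric] del: ennreal_plus)
  also have "(\<integral>\<^sup>+x. ennreal \<bar>\<Sum>i\<in>I. g (x i) - (\<integral>x. g x \<partial>\<mu>)\<bar> \<partial>PiM I (\<lambda>_. \<mu>))
      + ennreal (real (card I) * (2 * (\<integral>x. h x \<partial>\<mu>))) \<le> ennreal ((K + 1) * \<tau>) + ennreal (2 * K * \<tau>)"
    using G tail by (intro add_mono ennreal_leI) auto
  also have "\<dots> = ennreal ((3 * K + 1) * N powr (1 / p))"
    using K \<tau> by (simp add: ennreal_plus[symmetric] \<tau>_def[symmetric] algebra_simps del: ennreal_plus)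
  finally show ?thesis .
qed

section \<open>V-statistics of order two\<close>

lemma add_powr_le_4:
  fixes x y p :: real
  assumes "0 \<le> x" "0 \<le> y" "0 < p" "p \<le> 2"
  shows "(x + y) powr p \<le> 4 * (x powr p + y powr p)"
proof -
  have "(x + y) powr p \<le> (2 * max x y) powr p"
    using assms by (intro powr_mono2) auto
  also have "\<dots> = 2 powr p * max x y powr p"
    using assms by (simp add: powr_mult)
  also have "\<dots> \<le> 2 powr 2 * (x powr p + y powr p)"
    using assms by (intro mult_mono powr_mono) (auto simp: max_def)
  finally show ?thesis by simp
qed

text \<open>A Hoeffding-type decomposition without martingales. Each of the \<open>n\<close> rows
  deviates from its conditional mean by order \<open>real n powr (1 / p)\<close>, and so does the
  sum of the conditional means; after dividing by \<open>n\<close> squared, respectively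
  \<open>n\<close>, both have the claimed order. The diagonal has to vanish because the rows are
  treated off the diagonal.\<close>

lemma V_statistic_deviation:
  fixes k :: "'a \<Rightarrow> 'a \<Rightarrow> real" and b :: "'a \<Rightarrow> real" and p K :: real
  assumes \<mu>: "prob_space \<mu>" and k_meas[measurable]: "(\<lambda>(x, y). k x y) \<in> borel_measurable (\<mu> \<Otimes>\<^sub>M \<mu>)"
    and [measurable]: "b \<in> borel_measurable \<mu>"
    and k0: "\<And>x y. 0 \<le> k x y" and kd: "\<And>x. k x x = 0"
    and kb: "\<And>x y. k x y \<le> b x + b y" and b0: "\<And>x. 0 \<le> b x"
    and p: "1 < p" "p \<le> 2" and K: "(\<integral>\<^sup>+x. ennreal (b x powr p) \<partial>\<mu>) \<le> ennreal K" "0 \<le> K"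
    and fin: "finite I" "card I = n" "1 \<le> n"
  shows "(\<integral>\<^sup>+x. ennreal \<bar>(\<Sum>i\<in>I. \<Sum>j\<in>I. k (x i) (x j)) / (real n)\<^sup>2 - (\<integral>x. \<integral>y. k x y \<partial>\<mu> \<partial>\<mu>)\<bar> \<partial>PiM I (\<lambda>_. \<mu>))
    \<le> ennreal (51 * (K + 1)\<^sup>2 * real n powr (1 / p - 1))"
proof -
  interpret prob_space \<mu> by fact
  interpret P: product_sigma_finite "\<lambda>_. \<mu>" by standard
  interpret PI: prob_space "PiM I (\<lambda>_. \<mu>)" by (rule prob_space_PiM) (rule assms)
  define g where "g x = (\<integral>y. k x y \<partial>\<mu>)" for x
  define \<kappa> where "\<kappa> = (\<integral>x. g x \<partial>\<mu>)"
  define B where "B = (\<integral>x. b x \<partial>\<mu>)"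
  define N where "N = real n powr (1 / p)"
  have n0: "0 < real n" "1 \<le> real n" using fin by auto
  have [measurable]: "g \<in> borel_measurable \<mu>" unfolding g_def by measurable
  have [measurable]: "k x \<in> borel_measurable \<mu>" if "x \<in> space \<mu>" for x
    using measurable_Pair2[OF k_meas that] by simp
  have int_bp: "integrable \<mu> (\<lambda>x. b x powr p)"
    using K by (intro integrableI_bounded) (auto intro: le_less_trans)
  have bp_le: "(\<integral>x. b x powr p \<partial>\<mu>) \<le> K"
    using K int_bp by (subst (asm) nn_integral_eq_integral) auto
  have b_le: "b x \<le> 1 + b x powr p" for x
  proof (cases "b x \<le> 1")
    case False
    then have "b x powr 1 \<le> b x powr p" using p by (intro powr_mono) auto
    with False show ?thesis by simp
  qed (simp add: add_increasing2)
  have int_b: "integrable \<mu> b"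
    by (rule Bochner_Integration.integrable_bound[of _ "\<lambda>x. 1 + b x powr p"])
       (use int_bp b_le b0 in auto)
  have B: "0 \<le> B" "B \<le> 1 + K"
  proof -
    show "0 \<le> B" unfolding B_def using b0 by simp
    have "B \<le> (\<integral>x. 1 + b x powr p \<partial>\<mu>)"
      unfolding B_def using int_b int_bp b_le by (intro integral_mono) auto
    then show "B \<le> 1 + K" using int_bp bp_le by (simp add: prob_space)
  qed
  have g0: "0 \<le> g x" for x unfolding g_def using k0 by simp
  have g_le: "g x \<le> b x + B" if "x \<in> space \<mu>" for x
  proof -
    have "integrable \<mu> (k x)"
      by (rule Bochner_Integration.integrable_bound[of _ "\<lambda>y. b x + b y"])
         (use int_b kb k0 b0 that in auto)
    then have "g x \<le> (\<integral>y. b x + b y \<partial>\<mu>)"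
      unfolding g_def using int_b kb by (intro integral_mono) auto
    also have "\<dots> = b x + B" using int_b by (simp add: B_def prob_space)
    finally show ?thesis .
  qed
  have int_g: "integrable \<mu> g"
    by (rule Bochner_Integration.integrable_bound[of _ "\<lambda>x. b x + B"])
       (use int_b g_le g0 b0 B in auto)
  have \<kappa>: "0 \<le> \<kappa>" "\<kappa> \<le> 2 * (1 + K)"
  proof -
    show "0 \<le> \<kappa>" unfolding \<kappa>_def using g0 by simp
    have "\<kappa> \<le> (\<integral>x. b x + B \<partial>\<mu>)"
      unfolding \<kappa>_def using int_b int_g g_le by (intro integral_mono) auto
    also have "\<dots> = 2 * B" using int_b by (simp add: B_def prob_space)
    finally show "\<kappa> \<le> 2 * (1 + K)" using B by simp
  qed

  \<comment> \<open>Given \<open>x i\<close>, the remaining entries of the row are independent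
    copies with mean \<open>g (x i)\<close>, so the bound for sums applies conditionally.\<close>
  have row: "(\<integral>\<^sup>+x. ennreal \<bar>\<Sum>j\<in>I - {i}. k (x i) (x j) - g (x i)\<bar> \<partial>PiM I (\<lambda>_. \<mu>)) \<le> ennreal ((24 * K + 1) * N)"
    if i: "i \<in> I" for i
  proof -
    have I_eq: "insert i (I - {i}) = I" using i by auto
    have fin': "finite (I - {i})" "i \<notin> I - {i}" using fin by auto
    have kp: "(\<integral>\<^sup>+z. ennreal (k y z powr p) \<partial>\<mu>) \<le> ennreal (4 * (b y powr p + K))" if "y \<in> space \<mu>" for y
    proof -
      have "(\<integral>\<^sup>+z. ennreal (k y z powr p) \<partial>\<mu>) \<le> (\<integral>\<^sup>+z. ennreal 4 * (ennreal (b y powr p) + ennreal (b z powr p)) \<partial>\<mu>)"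
      proof (rule nn_integral_mono)
        fix z
        have "k y z powr p \<le> (b y + b z) powr p"
          using k0 kb p by (intro powr_mono2) auto
        also have "\<dots> \<le> 4 * (b y powr p + b z powr p)"
          using b0 p by (intro add_powr_le_4) auto
        finally have "ennreal (k y z powr p) \<le> ennreal (4 * (b y powr p + b z powr p))"
          by (rule ennreal_leI)
        then show "ennreal (k y z powr p) \<le> ennreal 4 * (ennreal (b y powr p) + ennreal (b z powr p))"
          by (simp only: ennreal_plus ennreal_mult powr_ge_zero add_nonneg_nonneg zero_le_numeral)
      qed
      also have "\<dots> = ennreal 4 * (ennreal (b y powr p) + (\<integral>\<^sup>+z. ennreal (b z powr p) \<partial>\<mu>))"
        by (subst nn_integral_cmult) (simp_all add: nn_integral_add emeasure_space_1)
      also have "\<dots> \<le> ennreal 4 * (ennreal (b y powr p) + ennreal K)"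
        using K by (intro mult_left_mono add_mono) auto
      also have "\<dots> = ennreal (4 * (b y powr p + K))"
        using K by (simp only: ennreal_plus ennreal_mult powr_ge_zero add_nonneg_nonneg zero_le_numeral)
      finally show ?thesis .
    qed
    have "(\<integral>\<^sup>+x. ennreal \<bar>\<Sum>j\<in>I - {i}. k (x i) (x j) - g (x i)\<bar> \<partial>PiM I (\<lambda>_. \<mu>))
      = (\<integral>\<^sup>+x. ennreal \<bar>\<Sum>j\<in>I - {i}. k (x i) (x j) - g (x i)\<bar> \<partial>PiM (insert i (I - {i})) (\<lambda>_. \<mu>))"
      by (simp only: I_eq)
    also have "\<dots> = (\<integral>\<^sup>+y. \<integral>\<^sup>+x. ennreal \<bar>\<Sum>j\<in>I - {i}. k ((x(i := y)) i) ((x(i := y)) j) - g ((x(i := y)) i)\<bar>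
        \<partial>PiM (I - {i}) (\<lambda>_. \<mu>) \<partial>\<mu>)"
      using fin' by (intro P.product_nn_integral_insert_rev) (auto simp: split_beta')
    also have "\<dots> = (\<integral>\<^sup>+y. \<integral>\<^sup>+x. ennreal \<bar>\<Sum>j\<in>I - {i}. k y (x j) - g y\<bar> \<partial>PiM (I - {i}) (\<lambda>_. \<mu>) \<partial>\<mu>)"
    proof -
      have "(\<Sum>j\<in>I - {i}. k ((x(i := y)) i) ((x(i := y)) j) - g ((x(i := y)) i)) = (\<Sum>j\<in>I - {i}. k y (x j) - g y)" for x y
        by (intro sum.cong) auto
      then show ?thesis by simp
    qed
    \<comment> \<open>The deviation bound is linear in the \<open>p\<close>-th moment, here of
      \<open>k y\<close>; hence it can be integrated over \<open>y\<close> knowing only that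
      \<open>b powr p\<close> is integrable.\<close>
    also have "\<dots> \<le> (\<integral>\<^sup>+y. ennreal ((3 * (4 * (b y powr p + K)) + 1) * N) \<partial>\<mu>)"
    proof (rule nn_integral_mono)
      fix y assume y: "y \<in> space \<mu>"
      have "real (card (I - {i})) \<le> real n" using fin i by simp
      then show "(\<integral>\<^sup>+x. ennreal \<bar>\<Sum>j\<in>I - {i}. k y (x j) - g y\<bar> \<partial>PiM (I - {i}) (\<lambda>_. \<mu>))
          \<le> ennreal ((3 * (4 * (b y powr p + K)) + 1) * N)"
        unfolding g_def N_def
        by (intro nn_integral_abs_sum_deviation_le[OF \<mu>]) (use y k0 p kp K fin n0 in auto)
    qed
    also have "\<dots> = ennreal (\<integral>y. (3 * (4 * (b y powr p + K)) + 1) * N \<partial>\<mu>)"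
      using int_bp K by (intro nn_integral_eq_integral) (auto simp: N_def intro!: Bochner_Integration.integrable_add)
    also have "(\<integral>y. (3 * (4 * (b y powr p + K)) + 1) * N \<partial>\<mu>) = (3 * (4 * ((\<integral>y. b y powr p \<partial>\<mu>) + K)) + 1) * N"
      using int_bp by (simp add: prob_space)
    also have "ennreal \<dots> \<le> ennreal ((24 * K + 1) * N)"
      using bp_le by (intro ennreal_leI mult_right_mono) (auto simp: N_def)
    finally show ?thesis .
  qed

  have lin: "(\<integral>\<^sup>+x. ennreal \<bar>\<Sum>i\<in>I. g (x i) - \<kappa>\<bar> \<partial>PiM I (\<lambda>_. \<mu>)) \<le> ennreal ((3 * (8 * (K + 1)\<^sup>2) + 1) * N)"
    unfolding \<kappa>_def N_def
  proof (rule nn_integral_abs_sum_deviation_le[OF \<mu>])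
    have "(\<integral>\<^sup>+x. ennreal (g x powr p) \<partial>\<mu>) \<le> (\<integral>\<^sup>+x. ennreal (4 * (b x powr p + (K + 1)\<^sup>2)) \<partial>\<mu>)"
    proof (intro nn_integral_mono ennreal_leI)
      fix x assume x: "x \<in> space \<mu>"
      have "g x powr p \<le> (b x + B) powr p"
        using g0 g_le[OF x] p by (intro powr_mono2) auto
      also have "\<dots> \<le> 4 * (b x powr p + B powr p)"
        using b0 p B by (intro add_powr_le_4) auto
      also have "B powr p \<le> (K + 1) powr p" using B p by (intro powr_mono2) auto
      also have "(K + 1) powr p \<le> (K + 1) powr 2" using K p by (intro powr_mono) auto
      also have "(K + 1) powr 2 = (K + 1)\<^sup>2" using K by simp
      finally show "g x powr p \<le> 4 * (b x powr p + (K + 1)\<^sup>2)" by simp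
    qed
    also have "\<dots> = ennreal (\<integral>x. 4 * (b x powr p + (K + 1)\<^sup>2) \<partial>\<mu>)"
      using int_bp by (intro nn_integral_eq_integral) auto
    also have "(\<integral>x. 4 * (b x powr p + (K + 1)\<^sup>2) \<partial>\<mu>) = 4 * ((\<integral>x. b x powr p \<partial>\<mu>) + (K + 1)\<^sup>2)"
      using int_bp by (simp add: prob_space)
    also have "\<dots> \<le> 8 * (K + 1)\<^sup>2"
      using bp_le K self_le_power[of "K + 1" 2] by auto
    finally show "(\<integral>\<^sup>+x. ennreal (g x powr p) \<partial>\<mu>) \<le> ennreal (8 * (K + 1)\<^sup>2)"
      by (auto simp: ennreal_leI)
  qed (use g0 p fin n0 in auto)

  \<comment> \<open>A row has only \<open>n - 1\<close> off-diagonal entries; the missing one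
    produces the bias \<open>\<kappa> / n\<close>.\<close>
  have decomp: "(\<Sum>i\<in>I. \<Sum>j\<in>I. k (x i) (x j)) / (real n)\<^sup>2 - \<kappa>
     = (\<Sum>i\<in>I. \<Sum>j\<in>I - {i}. k (x i) (x j) - g (x i)) / (real n)\<^sup>2
       + (real n - 1) / (real n)\<^sup>2 * (\<Sum>i\<in>I. g (x i) - \<kappa>) - \<kappa> / real n" for x
  proof -
    have "(\<Sum>i\<in>I. \<Sum>j\<in>I. k (x i) (x j)) = (\<Sum>i\<in>I. \<Sum>j\<in>I - {i}. k (x i) (x j))"
    proof (rule sum.cong[OF refl])
      fix i assume "i \<in> I"
      then show "(\<Sum>j\<in>I. k (x i) (x j)) = (\<Sum>j\<in>I - {i}. k (x i) (x j))"
        using fin by (subst sum.remove[of I i]) (auto simp: kd)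
    qed
    also have "\<dots> = (\<Sum>i\<in>I. (\<Sum>j\<in>I - {i}. k (x i) (x j) - g (x i)) + (real n - 1) * g (x i))"
      using fin by (intro sum.cong refl) (auto simp: sum_subtractf of_nat_diff)
    also have "\<dots> = (\<Sum>i\<in>I. \<Sum>j\<in>I - {i}. k (x i) (x j) - g (x i)) + (real n - 1) * (\<Sum>i\<in>I. g (x i))"
      by (simp only: sum.distrib sum_distrib_left)
    finally have 1: "(\<Sum>i\<in>I. \<Sum>j\<in>I. k (x i) (x j)) = \<dots>" .
    have 2: "(\<Sum>i\<in>I. g (x i) - \<kappa>) = (\<Sum>i\<in>I. g (x i)) - real n * \<kappa>"
      using fin by (simp add: sum_subtractf)
    show ?thesis unfolding 1 2 using n0 by (simp add: field_simps power2_eq_square)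
  qed
  define a where "a = 1 / (real n)\<^sup>2"
  define c where "c = 1 / real n"
  have ac: "0 \<le> a" "0 \<le> c" "a * real n = c" using n0 by (auto simp: a_def c_def power2_eq_square)
  have "(\<integral>\<^sup>+x. ennreal \<bar>(\<Sum>i\<in>I. \<Sum>j\<in>I. k (x i) (x j)) / (real n)\<^sup>2 - \<kappa>\<bar> \<partial>PiM I (\<lambda>_. \<mu>))
     \<le> (\<integral>\<^sup>+x. ennreal a * (\<Sum>i\<in>I. ennreal \<bar>\<Sum>j\<in>I - {i}. k (x i) (x j) - g (x i)\<bar>)
        + (ennreal c * ennreal \<bar>\<Sum>i\<in>I. g (x i) - \<kappa>\<bar> + ennreal (c * \<kappa>)) \<partial>PiM I (\<lambda>_. \<mu>))"
  proof (rule nn_integral_mono)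
    fix x
    have "\<bar>(\<Sum>i\<in>I. \<Sum>j\<in>I. k (x i) (x j)) / (real n)\<^sup>2 - \<kappa>\<bar>
      \<le> \<bar>(\<Sum>i\<in>I. \<Sum>j\<in>I - {i}. k (x i) (x j) - g (x i)) / (real n)\<^sup>2\<bar>
        + \<bar>(real n - 1) / (real n)\<^sup>2 * (\<Sum>i\<in>I. g (x i) - \<kappa>)\<bar> + \<bar>\<kappa> / real n\<bar>"
      unfolding decomp by (rule order_trans[OF abs_triangle_ineq4 add_mono[OF abs_triangle_ineq order_refl]])
    also have "\<bar>(\<Sum>i\<in>I. \<Sum>j\<in>I - {i}. k (x i) (x j) - g (x i)) / (real n)\<^sup>2\<bar>
        \<le> a * (\<Sum>i\<in>I. \<bar>\<Sum>j\<in>I - {i}. k (x i) (x j) - g (x i)\<bar>)"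
      unfolding a_def by (simp add: divide_right_mono)
    also have "\<bar>(real n - 1) / (real n)\<^sup>2 * (\<Sum>i\<in>I. g (x i) - \<kappa>)\<bar> \<le> c * \<bar>\<Sum>i\<in>I. g (x i) - \<kappa>\<bar>"
      unfolding abs_mult c_def using n0
      by (intro mult_right_mono) (auto simp: field_simps power2_eq_square)
    also have "\<bar>\<kappa> / real n\<bar> = c * \<kappa>" using \<kappa> n0 by (simp add: c_def)
    finally have "ennreal \<bar>(\<Sum>i\<in>I. \<Sum>j\<in>I. k (x i) (x j)) / (real n)\<^sup>2 - \<kappa>\<bar>
      \<le> ennreal (a * (\<Sum>i\<in>I. \<bar>\<Sum>j\<in>I - {i}. k (x i) (x j) - g (x i)\<bar>)
        + (c * \<bar>\<Sum>i\<in>I. g (x i) - \<kappa>\<bar> + c * \<kappa>))"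
      by (intro ennreal_leI) simp
    also have "\<dots> = ennreal a * (\<Sum>i\<in>I. ennreal \<bar>\<Sum>j\<in>I - {i}. k (x i) (x j) - g (x i)\<bar>)
        + (ennreal c * ennreal \<bar>\<Sum>i\<in>I. g (x i) - \<kappa>\<bar> + ennreal (c * \<kappa>))"
      using ac \<kappa> by (simp add: ennreal_plus ennreal_mult sum_ennreal sum_nonneg)
    finally show "ennreal \<bar>(\<Sum>i\<in>I. \<Sum>j\<in>I. k (x i) (x j)) / (real n)\<^sup>2 - \<kappa>\<bar> \<le> \<dots>" .
  qed
  also have "\<dots> = ennreal a * (\<Sum>i\<in>I. \<integral>\<^sup>+x. ennreal \<bar>\<Sum>j\<in>I - {i}. k (x i) (x j) - g (x i)\<bar> \<partial>PiM I (\<lambda>_. \<mu>))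
        + (ennreal c * (\<integral>\<^sup>+x. ennreal \<bar>\<Sum>i\<in>I. g (x i) - \<kappa>\<bar> \<partial>PiM I (\<lambda>_. \<mu>)) + ennreal (c * \<kappa>))"
    by (simp add: nn_integral_add nn_integral_cmult nn_integral_sum PI.emeasure_space_1 split_beta'
        del: sum_ennreal)
  also have "\<dots> \<le> ennreal a * (\<Sum>i\<in>I. ennreal ((24 * K + 1) * N))
      + (ennreal c * ennreal ((3 * (8 * (K + 1)\<^sup>2) + 1) * N) + ennreal (c * (2 * (1 + K))))"
    using row lin \<kappa> ac by (intro add_mono mult_left_mono sum_mono ennreal_leI) auto
  also have "\<dots> = ennreal (c * N * (24 * K + 1 + (3 * (8 * (K + 1)\<^sup>2) + 1)) + c * (2 * (1 + K)))"
  proof -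
    have N0: "0 \<le> N" by (simp add: N_def)
    have "ennreal a * (\<Sum>i\<in>I. ennreal ((24 * K + 1) * N)) = ennreal (a * (real n * ((24 * K + 1) * N)))"
      using ac K N0 fin by (simp add: ennreal_mult[symmetric] ennreal_of_nat_eq_real_of_nat)
    also have "a * (real n * ((24 * K + 1) * N)) = c * ((24 * K + 1) * N)"
      using ac(3) by (simp add: mult.assoc[symmetric])
    finally show ?thesis using ac K N0
      by (simp add: ennreal_mult[symmetric] ennreal_plus[symmetric] algebra_simps del: ennreal_plus)
  qed
  also have "\<dots> \<le> ennreal (51 * (K + 1)\<^sup>2 * real n powr (1 / p - 1))"
  proof (rule ennreal_leI)
    have cN: "c * N = real n powr (1 / p - 1)"
      using n0 by (simp add: c_def N_def powr_diff)
    have "c \<le> c * N" using ac n0 p by (simp add: N_def mult_left_le ge_one_powr_ge_zero mult_le_cancel_left1)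
    then have "c * (2 * (1 + K)) \<le> c * N * (2 * (1 + K))" using K by (intro mult_right_mono) auto
    then have "c * N * (24 * K + 1 + (3 * (8 * (K + 1)\<^sup>2) + 1)) + c * (2 * (1 + K))
      \<le> c * N * (24 * K + 1 + (3 * (8 * (K + 1)\<^sup>2) + 1) + 2 * (1 + K))"
      by (simp add: algebra_simps)
    \<comment> \<open>The terms of degree at most one in \<open>K\<close> sum to
      \<open>26 * K + 4\<close>, which the square absorbs.\<close>
    also have "\<dots> \<le> c * N * (51 * (K + 1)\<^sup>2)"
      using ac K self_le_power[of "K + 1" 2] by (intro mult_left_mono) (auto simp: N_def)
    finally show "c * N * (24 * K + 1 + (3 * (8 * (K + 1)\<^sup>2) + 1)) + c * (2 * (1 + K))
      \<le> 51 * (K + 1)\<^sup>2 * real n powr (1 / p - 1)"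
      by (simp only: cN[symmetric] mult.commute[of "51 * (K + 1)\<^sup>2"])
  qed
  finally show ?thesis unfolding \<kappa>_def g_def .
qed

section \<open>Empirical processes of maxima of linear functionals\<close>

lemma sum_Pow_split:
  assumes "finite Y" "k \<in> Y"
  shows "(\<Sum>S\<in>Pow Y. G S) = (\<Sum>S\<in>Pow (Y - {k}). G S + G (insert k S))"
proof -
  have Y: "Y = insert k (Y - {k})" using assms by auto
  have "(\<Sum>S\<in>Pow Y. G S) = (\<Sum>S\<in>Pow (Y - {k}) \<union> insert k ` Pow (Y - {k}). G S)"
    by (subst Y, subst Pow_insert) simp
  also have "\<dots> = (\<Sum>S\<in>Pow (Y - {k}). G S) + (\<Sum>S\<in>insert k ` Pow (Y - {k}). G S)"
    using assms by (intro sum.union_disjoint) auto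
  also have "(\<Sum>S\<in>insert k ` Pow (Y - {k}). G S) = (\<Sum>S\<in>Pow (Y - {k}). G (insert k S))"
    by (subst sum.reindex) (auto simp: inj_on_def)
  finally show ?thesis by (simp add: sum.distrib)
qed

text \<open>A pattern of Rademacher signs is encoded by the set where the sign is positive. Averages
  over signs become finite sums over \<open>Pow Y\<close>, without an auxiliary probability space,
  and complementing the set flips all signs.\<close>

definition sgn_in :: "'b set \<Rightarrow> 'b \<Rightarrow> real" where
  "sgn_in S v = (if v \<in> S then 1 else - 1)"

lemma card_Pow_remove:
  assumes "finite Y" "k \<in> Y"
  shows "2 ^ card Y = (2::real) * 2 ^ card (Y - {k})"
  using assms by (metis card.remove finite_Diff power_Suc)

lemma sum_Pow_sgn_in:
  fixes F :: "real \<Rightarrow> real"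
  assumes "finite Y" "k \<in> Y"
  shows "(\<Sum>S\<in>Pow Y. F (sgn_in S k)) = 2 ^ card Y * ((F 1 + F (- 1)) / 2)"
proof -
  have "(\<Sum>S\<in>Pow Y. F (sgn_in S k)) = (\<Sum>S\<in>Pow (Y - {k}). F (- 1) + F 1)"
    unfolding sum_Pow_split[OF assms] by (intro sum.cong refl) (auto simp: sgn_in_def)
  also have "\<dots> = 2 ^ card (Y - {k}) * (F 1 + F (- 1))"
    using assms by (simp add: card_Pow)
  finally show ?thesis using card_Pow_remove[OF assms] by simp
qed

text \<open>Among the patterns that differ only at \<open>k\<close>, the triangle inequality leaves
  twice the modulus of \<open>A k\<close>. As \<open>k\<close> is arbitrary, an average of linear
  expressions dominates the maximum of the moduli.\<close>

lemma abs_le_sum_Pow_sgn_in: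
  fixes A :: "'b \<Rightarrow> real"
  assumes "finite Y" "k \<in> Y"
  shows "2 ^ card Y * \<bar>A k\<bar> \<le> (\<Sum>S\<in>Pow Y. \<bar>\<Sum>v\<in>Y. sgn_in S v * A v\<bar>)"
proof -
  have "2 ^ card Y * \<bar>A k\<bar> = (\<Sum>S\<in>Pow (Y - {k}). 2 * \<bar>A k\<bar>)"
    using assms card_Pow_remove[OF assms] by (simp add: card_Pow)
  also have "\<dots> \<le> (\<Sum>S\<in>Pow (Y - {k}). \<bar>\<Sum>v\<in>Y. sgn_in S v * A v\<bar> + \<bar>\<Sum>v\<in>Y. sgn_in (insert k S) v * A v\<bar>)"
  proof (rule sum_mono)
    fix S assume S: "S \<in> Pow (Y - {k})"
    have "(\<Sum>v\<in>Y. sgn_in S v * A v) = - A k + (\<Sum>v\<in>Y - {k}. sgn_in S v * A v)"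
      using assms S by (subst sum.remove[of Y k]) (auto simp: sgn_in_def)
    moreover have "(\<Sum>v\<in>Y. sgn_in (insert k S) v * A v) = A k + (\<Sum>v\<in>Y - {k}. sgn_in S v * A v)"
      using assms S by (subst sum.remove[of Y k]) (auto simp: sgn_in_def intro!: sum.cong)
    ultimately show "2 * \<bar>A k\<bar> \<le> \<bar>\<Sum>v\<in>Y. sgn_in S v * A v\<bar> + \<bar>\<Sum>v\<in>Y. sgn_in (insert k S) v * A v\<bar>"
      by linarith
  qed
  also have "\<dots> = (\<Sum>S\<in>Pow Y. \<bar>\<Sum>v\<in>Y. sgn_in S v * A v\<bar>)"
    by (rule sum_Pow_split[OF assms, symmetric])
  finally show ?thesis .
qed

text \<open>Truncation at 0 is subadditive, so only an inequality survives for terms of arbitrary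
  sign.\<close>

lemma ennreal_sum_le: "ennreal (\<Sum>i\<in>A. f i) \<le> (\<Sum>i\<in>A. ennreal (f i))"
proof -
  have "ennreal (\<Sum>i\<in>A. f i) \<le> ennreal (\<Sum>i\<in>A. max 0 (f i))"
    by (intro ennreal_leI sum_mono) auto
  also have "\<dots> = (\<Sum>i\<in>A. ennreal (max 0 (f i)))" by (subst sum_ennreal) auto
  also have "\<dots> = (\<Sum>i\<in>A. ennreal (f i))"
    by (intro sum.cong refl) (simp add: max_def ennreal_neg)
  finally show ?thesis .
qed

lemma ennreal_add_le: "ennreal (x + y) \<le> ennreal x + ennreal y"
  using ennreal_sum_le[of "\<lambda>b. if b then x else y" UNIV] by (simp add: UNIV_bool add.commute)

text \<open>With \<open>A\<^sub>v = a\<^sub>v(s) - a\<^sub>v(t)\<close>, the difference of the two maxima is at most \<open>max\<^sub>v |A\<^sub>v|\<close>, which is dominated by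
  the average of \<open>|\<Sum>\<^sub>v \<plusminus>A\<^sub>v|\<close> over all signs. The point \<open>o'\<close> keeps the suprema nonnegative, so that the
  truncation of \<open>ennreal\<close> at 0 is harmless.\<close>

lemma SUP_ennreal_contraction:
  fixes a :: "'b \<Rightarrow> 't \<Rightarrow> real" and u :: "'t \<Rightarrow> real"
  assumes Y: "finite Y" "Y \<noteq> {}" and o: "o' \<in> T" "u o' = 0" "\<And>v. v \<in> Y \<Longrightarrow> a v o' = 0"
  shows "ennreal (2 ^ card Y) * ((SUP t\<in>T. ennreal (u t + (MAX v\<in>Y. a v t))) + (SUP t\<in>T. ennreal (u t - (MAX v\<in>Y. a v t))))
    \<le> 2 * (\<Sum>S\<in>Pow Y. SUP t\<in>T. ennreal (u t + (\<Sum>v\<in>Y. sgn_in S v * a v t)))"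
proof -
  let ?m = "\<lambda>t. MAX v\<in>Y. a v t"
  let ?G = "\<lambda>S. SUP t\<in>T. ennreal (u t + (\<Sum>v\<in>Y. sgn_in S v * a v t))"
  let ?N = "ennreal (2 ^ card Y)"
  have m_o: "?m o' = 0" using Y o(3) by simp
  \<comment> \<open>The point \<open>t\<close> enters with all signs reversed, that is, through the
    complementary pattern; summing over all patterns makes this harmless.\<close>
  have compl: "(\<Sum>S\<in>Pow Y. ?G (Y - S)) = (\<Sum>S\<in>Pow Y. ?G S)"
    by (rule sum.reindex_bij_witness[of _ "\<lambda>S. Y - S" "\<lambda>S. Y - S"]) auto
  have main: "?N * ennreal ((u s + ?m s) + (u t - ?m t)) \<le> 2 * (\<Sum>S\<in>Pow Y. ?G S)" if st: "s \<in> T" "t \<in> T" for s t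
  proof -
    have "?m s \<in> (\<lambda>v. a v s) ` Y" using Y by (intro Max_in) auto
    then obtain k where k: "k \<in> Y" "?m s = a k s" by auto
    have "a k t \<le> ?m t" using Y k by (intro Max_ge) auto
    then have "?m s - ?m t \<le> \<bar>a k s - a k t\<bar>" using k by linarith
    then have "(u s + ?m s) + (u t - ?m t) \<le> (u s + u t) + \<bar>a k s - a k t\<bar>" by linarith
    then have "2 ^ card Y * ((u s + ?m s) + (u t - ?m t)) \<le> 2 ^ card Y * (u s + u t) + 2 ^ card Y * \<bar>a k s - a k t\<bar>"
      by (simp add: distrib_left[symmetric])
    also have "\<dots> \<le> 2 ^ card Y * (u s + u t) + (\<Sum>S\<in>Pow Y. \<bar>\<Sum>v\<in>Y. sgn_in S v * (a v s - a v t)\<bar>)"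
      using abs_le_sum_Pow_sgn_in[OF Y(1) k(1), of "\<lambda>v. a v s - a v t"] by simp
    also have "\<dots> = (\<Sum>S\<in>Pow Y. (u s + u t) + \<bar>\<Sum>v\<in>Y. sgn_in S v * (a v s - a v t)\<bar>)"
      using Y by (simp add: sum.distrib card_Pow)
    finally have "ennreal (2 ^ card Y * ((u s + ?m s) + (u t - ?m t)))
        \<le> ennreal (\<Sum>S\<in>Pow Y. (u s + u t) + \<bar>\<Sum>v\<in>Y. sgn_in S v * (a v s - a v t)\<bar>)"
      by (rule ennreal_leI)
    also have "\<dots> \<le> (\<Sum>S\<in>Pow Y. ennreal ((u s + u t) + \<bar>\<Sum>v\<in>Y. sgn_in S v * (a v s - a v t)\<bar>))"
      by (rule ennreal_sum_le)
    also have "\<dots> \<le> (\<Sum>S\<in>Pow Y. ?G S + ?G (Y - S))"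
    proof (rule sum_mono)
      fix S
      let ?D = "\<lambda>r. \<Sum>v\<in>Y. sgn_in S v * a v r"
      have neg: "(\<Sum>v\<in>Y. sgn_in (Y - S) v * a v r) = - ?D r" for r
        unfolding sum_negf[symmetric] by (intro sum.cong) (auto simp: sgn_in_def)
      have up: "ennreal (u r + ?D r) \<le> ?G S" "ennreal (u r - ?D r) \<le> ?G (Y - S)" if "r \<in> T" for r
        using that by (auto simp: neg intro!: SUP_upper2[of r])
      have D: "(\<Sum>v\<in>Y. sgn_in S v * (a v s - a v t)) = ?D s - ?D t"
        by (simp add: right_diff_distrib sum_subtractf)
      show "ennreal ((u s + u t) + \<bar>\<Sum>v\<in>Y. sgn_in S v * (a v s - a v t)\<bar>) \<le> ?G S + ?G (Y - S)"
      \<comment> \<open>The modulus is resolved by exchanging \<open>s\<close> and \<open>t\<close>,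
        under which \<open>u s + u t\<close> is symmetric.\<close>
      proof (cases "0 \<le> ?D s - ?D t")
        case True
        then have "ennreal ((u s + u t) + \<bar>?D s - ?D t\<bar>) = ennreal ((u s + ?D s) + (u t - ?D t))"
          by (simp add: algebra_simps)
        also have "\<dots> \<le> ennreal (u s + ?D s) + ennreal (u t - ?D t)" by (rule ennreal_add_le)
        also have "\<dots> \<le> ?G S + ?G (Y - S)" using up st by (intro add_mono) auto
        finally show ?thesis unfolding D .
      next
        case False
        then have "ennreal ((u s + u t) + \<bar>?D s - ?D t\<bar>) = ennreal ((u t + ?D t) + (u s - ?D s))"
          by (simp add: algebra_simps)
        also have "\<dots> \<le> ennreal (u t + ?D t) + ennreal (u s - ?D s)" by (rule ennreal_add_le)
        also have "\<dots> \<le> ?G S + ?G (Y - S)" using up st by (intro add_mono) auto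
        finally show ?thesis unfolding D .
      qed
    qed
    also have "\<dots> = 2 * (\<Sum>S\<in>Pow Y. ?G S)" using compl by (simp add: sum.distrib mult_2)
    finally show ?thesis by (simp add: ennreal_mult')
  qed
  have pair: "?N * (ennreal (u s + ?m s) + ennreal (u t - ?m t)) \<le> 2 * (\<Sum>S\<in>Pow Y. ?G S)" if st: "s \<in> T" "t \<in> T" for s t
  proof -
    obtain s' where s': "s' \<in> T" "ennreal (u s + ?m s) \<le> ennreal (u s' + ?m s')" "0 \<le> u s' + ?m s'"
    proof (cases "0 \<le> u s + ?m s")
      case False
      then show ?thesis using o m_o by (intro that[of o']) (auto simp: ennreal_neg)
    qed (use st that in auto)
    obtain t' where t': "t' \<in> T" "ennreal (u t - ?m t) \<le> ennreal (u t' - ?m t')" "0 \<le> u t' - ?m t'"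
    proof (cases "0 \<le> u t - ?m t")
      case False
      then show ?thesis using o m_o by (intro that[of o']) (auto simp: ennreal_neg)
    qed (use st that in auto)
    have "?N * (ennreal (u s + ?m s) + ennreal (u t - ?m t)) \<le> ?N * (ennreal (u s' + ?m s') + ennreal (u t' - ?m t'))"
      using s' t' by (intro mult_left_mono add_mono) auto
    also have "\<dots> = ?N * ennreal ((u s' + ?m s') + (u t' - ?m t'))"
      using s' t' by (subst ennreal_plus) auto
    also have "\<dots> \<le> 2 * (\<Sum>S\<in>Pow Y. ?G S)" by (rule main) (use s' t' in auto)
    finally show ?thesis .
  qed
  have T: "T \<noteq> {}" using o by auto
  have "(SUP t\<in>T. ennreal (u t + ?m t)) + (SUP t\<in>T. ennreal (u t - ?m t))
    = (SUP s\<in>T. ennreal (u s + ?m s) + (SUP t\<in>T. ennreal (u t - ?m t)))"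
    by (rule ennreal_SUP_add_left[OF T, symmetric])
  also have "\<dots> = (SUP s\<in>T. SUP t\<in>T. ennreal (u s + ?m s) + ennreal (u t - ?m t))"
    by (simp only: ennreal_SUP_add_right[OF T])
  finally have "?N * ((SUP t\<in>T. ennreal (u t + ?m t)) + (SUP t\<in>T. ennreal (u t - ?m t)))
    = (SUP s\<in>T. SUP t\<in>T. ?N * (ennreal (u s + ?m s) + ennreal (u t - ?m t)))"
    by (simp only: SUP_mult_left_ennreal)
  also have "\<dots> \<le> 2 * (\<Sum>S\<in>Pow Y. ?G S)"
    using pair by (intro SUP_least) auto
  finally show ?thesis .
qed

section \<open>Symmetrisation and the induction over the sample\<close>

lemma ennreal_integral_le_nn_integral:
  fixes f :: "'a \<Rightarrow> real"
  shows "ennreal (\<integral>x. f x \<partial>M) \<le> (\<integral>\<^sup>+x. ennreal (f x) \<partial>M)"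
proof (cases "integrable M f")
  case True
  have "(\<integral>x. f x \<partial>M) \<le> (\<integral>x. max 0 (f x) \<partial>M)"
    using True by (intro integral_mono) auto
  then have "ennreal (\<integral>x. f x \<partial>M) \<le> ennreal (\<integral>x. max 0 (f x) \<partial>M)" by (rule ennreal_leI)
  also have "\<dots> = (\<integral>\<^sup>+x. ennreal (max 0 (f x)) \<partial>M)"
    using True by (subst nn_integral_eq_integral) auto
  also have "\<dots> = (\<integral>\<^sup>+x. ennreal (f x) \<partial>M)"
    by (intro nn_integral_cong) (auto simp: max_def ennreal_neg)
  finally show ?thesis .
qed (simp add: not_integrable_integral_eq)

text \<open>Symmetrisation of a single coordinate with a ghost copy \<open>y\<close>: the mean of
  \<open>f t\<close> is its integral over \<open>y\<close>, which moves outside the supremum.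
  Splitting the resulting supremum in two leaves a sum over both signs, the form that the
  contraction inequality consumes, so no random sign is introduced here.\<close>

lemma nn_integral_SUP_symmetrization:
  fixes f :: "'t \<Rightarrow> 'a \<Rightarrow> real" and u :: "'t \<Rightarrow> real" and s :: real
  assumes "prob_space \<mu>" and [simp]: "countable T" and int: "\<And>t. t \<in> T \<Longrightarrow> integrable \<mu> (f t)"
    and s: "s = 1 \<or> s = - 1"
  shows "(\<integral>\<^sup>+x. (SUP t\<in>T. ennreal (u t + s * (f t x - (\<integral>x. f t x \<partial>\<mu>)))) \<partial>\<mu>)
    \<le> (\<integral>\<^sup>+x. ennreal (1 / 2) * ((SUP t\<in>T. ennreal (u t + 2 * f t x)) + (SUP t\<in>T. ennreal (u t - 2 * f t x))) \<partial>\<mu>)"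
proof -
  interpret prob_space \<mu> by fact
  have [measurable]: "f t \<in> borel_measurable \<mu>" if "t \<in> T" for t using int[OF that] by auto
  define A where "A x = (SUP t\<in>T. ennreal (u t + s * (2 * f t x)))" for x
  define B where "B x = (SUP t\<in>T. ennreal (u t - s * (2 * f t x)))" for x
  have [measurable]: "A \<in> borel_measurable \<mu>" "B \<in> borel_measurable \<mu>"
    unfolding A_def B_def by (auto intro!: borel_measurable_SUP)
  have half: "ennreal (u t + s * (f t x - f t y)) \<le> ennreal (1 / 2) * (A x + B y)" if "t \<in> T" for t x y
  proof -
    \<comment> \<open>The offset \<open>u t\<close> is shared equally between the two points, which
      doubles the coefficient of \<open>f\<close>.\<close>
    have "u t + s * (f t x - f t y) = 1 / 2 * (u t + s * (2 * f t x)) + 1 / 2 * (u t - s * (2 * f t y))"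
      by (simp add: algebra_simps)
    then have "ennreal (u t + s * (f t x - f t y))
        \<le> ennreal (1 / 2 * (u t + s * (2 * f t x))) + ennreal (1 / 2 * (u t - s * (2 * f t y)))"
      using ennreal_add_le by metis
    also have "\<dots> = ennreal (1 / 2) * (ennreal (u t + s * (2 * f t x)) + ennreal (u t - s * (2 * f t y)))"
      by (subst (1 2) ennreal_mult') (simp_all only: distrib_left[of "ennreal (1 / 2)"] zero_le_divide_1_iff zero_le_numeral)
    also have "\<dots> \<le> ennreal (1 / 2) * (A x + B y)"
      unfolding A_def B_def using that by (intro mult_left_mono add_mono SUP_upper) auto
    finally show ?thesis .
  qed
  have "(\<integral>\<^sup>+x. (SUP t\<in>T. ennreal (u t + s * (f t x - (\<integral>x. f t x \<partial>\<mu>)))) \<partial>\<mu>)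
      \<le> (\<integral>\<^sup>+x. (\<integral>\<^sup>+y. ennreal (1 / 2) * (A x + B y) \<partial>\<mu>) \<partial>\<mu>)"
  proof (intro nn_integral_mono SUP_least)
    fix x t assume t: "t \<in> T"
    have "u t + s * (f t x - (\<integral>x. f t x \<partial>\<mu>)) = (\<integral>y. u t + s * (f t x - f t y) \<partial>\<mu>)"
      using int[OF t] by (simp add: prob_space)
    then have "ennreal (u t + s * (f t x - (\<integral>x. f t x \<partial>\<mu>))) \<le> (\<integral>\<^sup>+y. ennreal (u t + s * (f t x - f t y)) \<partial>\<mu>)"
      using ennreal_integral_le_nn_integral[of \<mu> "\<lambda>y. u t + s * (f t x - f t y)"] by simp
    also have "\<dots> \<le> (\<integral>\<^sup>+y. ennreal (1 / 2) * (A x + B y) \<partial>\<mu>)"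
      using half[OF t] by (intro nn_integral_mono) auto
    finally show "ennreal (u t + s * (f t x - (\<integral>x. f t x \<partial>\<mu>))) \<le> (\<integral>\<^sup>+y. ennreal (1 / 2) * (A x + B y) \<partial>\<mu>)" .
  qed
  also have "\<dots> = (\<integral>\<^sup>+x. ennreal (1 / 2) * (A x + B x) \<partial>\<mu>)"
    by (simp add: nn_integral_cmult nn_integral_add emeasure_space_1)
  also have "\<dots> = (\<integral>\<^sup>+x. ennreal (1 / 2) * ((SUP t\<in>T. ennreal (u t + 2 * f t x)) + (SUP t\<in>T. ennreal (u t - 2 * f t x))) \<partial>\<mu>)"
    using s by (auto simp: A_def B_def add.commute intro!: nn_integral_cong)
  finally show ?thesis .
qed

text \<open>Concavity of the root together with the parallelogram law: the average over the sign
  removes the cross term of \<open>w\<close> and \<open>p\<close>.\<close>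

lemma avg_sqrt_le:
  fixes w p :: "'e::real_inner" and c :: real
  assumes "0 \<le> c"
  shows "(sqrt ((norm (w + p))\<^sup>2 + c) + sqrt ((norm (w - p))\<^sup>2 + c)) / 2 \<le> sqrt ((norm w)\<^sup>2 + c + (norm p)\<^sup>2)"
proof -
  define a b where "a = (norm (w + p))\<^sup>2 + c" and "b = (norm (w - p))\<^sup>2 + c"
  have ab: "0 \<le> a" "0 \<le> b" using assms by (auto simp: a_def b_def)
  have sum: "(a + b) / 2 = (norm w)\<^sup>2 + c + (norm p)\<^sup>2"
    by (simp add: a_def b_def power2_norm_eq_inner inner_add inner_diff inner_commute)
  have "((sqrt a + sqrt b) / 2)\<^sup>2 \<le> (a + b) / 2"
    using ab sum_squares_ge_zero[of "sqrt a - sqrt b" 0]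
    by (simp add: power2_eq_square algebra_simps)
  then have "(sqrt a + sqrt b) / 2 \<le> sqrt ((a + b) / 2)"
    by (rule real_le_rsqrt)
  then show ?thesis unfolding sum by (simp add: a_def b_def)
qed

text \<open>The offsets \<open>w\<close> accumulate the randomised linear terms that replace the maxima of the samples already
  treated; this makes the statement inductive in the sample.\<close>

lemma empirical_process_bound:
  fixes \<phi> :: "'a \<Rightarrow> 'e::euclidean_space" and T :: "('b \<Rightarrow> 'e) set" and R V s :: real
  assumes \<mu>: "prob_space \<mu>" and [measurable]: "\<phi> \<in> borel_measurable \<mu>"
    and V: "(\<integral>\<^sup>+x. ennreal ((norm (\<phi> x))\<^sup>2) \<partial>\<mu>) \<le> ennreal V" "0 < V"
    and Y: "finite Y" "Y \<noteq> {}" and T[simp]: "countable T"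
    and R: "\<And>t v. t \<in> T \<Longrightarrow> v \<in> Y \<Longrightarrow> norm (t v) \<le> R" "0 \<le> R"
    and o: "o' \<in> T" "\<And>v. v \<in> Y \<Longrightarrow> o' v = 0" and s: "s = 1 \<or> s = - 1" and fin: "finite I"
  shows "(\<integral>\<^sup>+x. (SUP t\<in>T. ennreal ((\<Sum>v\<in>Y. t v \<bullet> w v)
            + s * (\<Sum>i\<in>I. (MAX v\<in>Y. t v \<bullet> \<phi> (x i)) - (\<integral>y. (MAX v\<in>Y. t v \<bullet> \<phi> y) \<partial>\<mu>)))) \<partial>PiM I (\<lambda>_. \<mu>))
    \<le> ennreal (R * (\<Sum>v\<in>Y. sqrt ((norm (w v))\<^sup>2 + 4 * card I * V)))"
  using fin
proof (induction I arbitrary: w)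
  case empty
  have "(\<Sum>v\<in>Y. t v \<bullet> w v) \<le> R * (\<Sum>v\<in>Y. norm (w v))" if "t \<in> T" for t
    unfolding sum_distrib_left
    by (intro sum_mono order_trans[OF norm_cauchy_schwarz] mult_right_mono R(1)) (use that in auto)
  then show ?case
    by (auto simp: PiM_empty nn_integral_count_space_finite intro!: SUP_least ennreal_leI)
next
  case (insert i I)
  interpret prob_space \<mu> by fact
  interpret P: product_sigma_finite "\<lambda>_. \<mu>" by standard
  interpret PI: prob_space "PiM I (\<lambda>_. \<mu>)" by (rule prob_space_PiM) (rule \<mu>)
  interpret pair_sigma_finite "PiM I (\<lambda>_. \<mu>)" \<mu> by standard
  define F where "F t x = (MAX v\<in>Y. t v \<bullet> \<phi> x)" for t x
  define m where "m t = (\<integral>y. F t y \<partial>\<mu>)" for t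
  define U where "U w t = (\<Sum>v\<in>Y. t v \<bullet> w v)" for w and t :: "'b \<Rightarrow> 'e"
  define S where "S t x = s * (\<Sum>j\<in>I. F t (x j) - m t)" for t and x :: "'c \<Rightarrow> 'a"
  define N :: real where "N = 2 ^ card Y"
  have N: "0 < N" by (simp add: N_def)
  have F_meas[measurable]: "F t \<in> borel_measurable \<mu>" for t
    unfolding F_def using Y by (intro borel_measurable_Max) auto
  have S_meas[measurable]: "S t \<in> borel_measurable (PiM I (\<lambda>_. \<mu>))" for t
    unfolding S_def by measurable
  have int_sq: "integrable \<mu> (\<lambda>x. (norm (\<phi> x))\<^sup>2)"
    using V by (intro integrableI_bounded) (auto intro: le_less_trans)
  have sq_le: "(\<integral>x. (norm (\<phi> x))\<^sup>2 \<partial>\<mu>) \<le> V"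
    using V int_sq by (subst (asm) nn_integral_eq_integral) auto
  have [measurable]: "(\<lambda>x. norm (\<phi> x)) \<in> borel_measurable \<mu>" by simp
  have int_n: "integrable \<mu> (\<lambda>x. norm (\<phi> x))"
    by (rule square_integrable_imp_integrable[OF _ int_sq]) simp
  have F_abs: "\<bar>F t x\<bar> \<le> R * norm (\<phi> x)" if "t \<in> T" for t x
  proof -
    have "F t x \<in> (\<lambda>v. t v \<bullet> \<phi> x) ` Y" unfolding F_def using Y by (intro Max_in) auto
    then obtain v where "v \<in> Y" "F t x = t v \<bullet> \<phi> x" by auto
    then show ?thesis
      using Cauchy_Schwarz_ineq2[of "t v" "\<phi> x"] R(1)[OF that] mult_right_mono[of "norm (t v)" R "norm (\<phi> x)"]
      by fastforce
  qed
  have int_F: "integrable \<mu> (F t)" if "t \<in> T" for t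
    by (rule Bochner_Integration.integrable_bound[OF integrable_mult_right[OF int_n, of R]])
       (use F_abs[OF that] R in auto)
  have zero: "F o' x = 0" "m o' = 0" for x
    using o Y by (auto simp: F_def m_def)
  have S0: "S o' x = 0" for x by (simp add: S_def zero)
  have U0: "U w o' = 0" for w using o by (simp add: U_def)
  \<comment> \<open>The offset after treating one sample: the factor 2 stems from the
    symmetrisation, the sign from the contraction.\<close>
  let ?w = "\<lambda>A x v. w v + (2 * sgn_in A v) *\<^sub>R \<phi> x"
  have "(\<integral>\<^sup>+x. (SUP t\<in>T. ennreal (U w t + s * (\<Sum>j\<in>insert i I. F t (x j) - m t))) \<partial>PiM (insert i I) (\<lambda>_. \<mu>))
    = (\<integral>\<^sup>+x. \<integral>\<^sup>+y. (SUP t\<in>T. ennreal (U w t + s * (\<Sum>j\<in>insert i I. F t ((x(i := y)) j) - m t))) \<partial>\<mu> \<partial>PiM I (\<lambda>_. \<mu>))"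
    using insert.hyps by (intro P.product_nn_integral_insert) (auto intro!: borel_measurable_SUP)
  also have "\<dots> = (\<integral>\<^sup>+x. \<integral>\<^sup>+y. (SUP t\<in>T. ennreal ((U w t + S t x) + s * (F t y - m t))) \<partial>\<mu> \<partial>PiM I (\<lambda>_. \<mu>))"
  proof -
    have "s * (\<Sum>j\<in>insert i I. F t ((x(i := y)) j) - m t) = S t x + s * (F t y - m t)" for t x y
    proof -
      have "(\<Sum>j\<in>I. F t ((x(i := y)) j) - m t) = (\<Sum>j\<in>I. F t (x j) - m t)"
        using insert.hyps by (intro sum.cong) auto
      with insert.hyps show ?thesis by (simp add: S_def algebra_simps)
    qed
    then show ?thesis by (simp add: add.assoc)
  qed
  also have "\<dots> \<le> (\<integral>\<^sup>+x. \<integral>\<^sup>+y. ennreal (1 / 2) * ((SUP t\<in>T. ennreal ((U w t + S t x) + 2 * F t y))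
       + (SUP t\<in>T. ennreal ((U w t + S t x) - 2 * F t y))) \<partial>\<mu> \<partial>PiM I (\<lambda>_. \<mu>))"
    unfolding m_def using int_F s by (intro nn_integral_mono nn_integral_SUP_symmetrization[OF \<mu>]) auto
  also have "\<dots> \<le> (\<integral>\<^sup>+x. \<integral>\<^sup>+y. (\<Sum>A\<in>Pow Y. ennreal (1 / N) * (SUP t\<in>T. ennreal (U (?w A y) t + S t x))) \<partial>\<mu> \<partial>PiM I (\<lambda>_. \<mu>))"
  proof (intro nn_integral_mono)
    fix x y
    let ?X = "(SUP t\<in>T. ennreal ((U w t + S t x) + 2 * F t y)) + (SUP t\<in>T. ennreal ((U w t + S t x) - 2 * F t y))"
    have F2: "2 * F t y = (MAX v\<in>Y. 2 * (t v \<bullet> \<phi> y))" for t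
      unfolding F_def using Y mono_Max_commute[of "\<lambda>x. 2 * x :: real" "(\<lambda>v. t v \<bullet> \<phi> y) ` Y"]
      by (simp add: mono_def image_image)
    have U_eq: "U (?w A y) t + S t x = (U w t + S t x) + (\<Sum>v\<in>Y. sgn_in A v * (2 * (t v \<bullet> \<phi> y)))" for A t
      by (simp add: U_def inner_add_right sum.distrib algebra_simps)
    have "ennreal N * ?X \<le> 2 * (\<Sum>A\<in>Pow Y. SUP t\<in>T. ennreal (U (?w A y) t + S t x))"
      unfolding F2 U_eq N_def
      by (rule SUP_ennreal_contraction[OF Y o(1)]) (use o U0 S0 in auto)
    then have "ennreal (1 / N) * ennreal (1 / 2) * (ennreal N * ?X)
        \<le> ennreal (1 / N) * ennreal (1 / 2) * (2 * (\<Sum>A\<in>Pow Y. SUP t\<in>T. ennreal (U (?w A y) t + S t x)))"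
      by (intro mult_left_mono) auto
    moreover have "ennreal (1 / N) * ennreal (1 / 2) * (ennreal N * z) = ennreal (1 / 2) * z" for z
    proof -
      have "ennreal (1 / N) * ennreal N = 1" using N by (simp add: ennreal_mult[symmetric])
      then show ?thesis by (metis (no_types, lifting) mult.assoc mult.commute mult_1)
    qed
    moreover have "ennreal (1 / N) * ennreal (1 / 2) * (2 * z) = ennreal (1 / N) * z" for z
    proof -
      have "ennreal (1 / 2) * ennreal 2 = 1" by (subst ennreal_mult[symmetric]) auto
      then show ?thesis by (metis (no_types, lifting) mult.assoc mult.commute mult_1 ennreal_numeral)
    qed
    ultimately show "ennreal (1 / 2) * ?X \<le> (\<Sum>A\<in>Pow Y. ennreal (1 / N) * (SUP t\<in>T. ennreal (U (?w A y) t + S t x)))"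
      by (simp add: sum_distrib_left)
  qed
  \<comment> \<open>The new offset depends on \<open>y\<close>, so the induction hypothesis, which
    integrates over the other samples, has to be applied for \<open>y\<close> fixed.\<close>
  also have "\<dots> = (\<integral>\<^sup>+y. \<integral>\<^sup>+x. (\<Sum>A\<in>Pow Y. ennreal (1 / N) * (SUP t\<in>T. ennreal (U (?w A y) t + S t x))) \<partial>PiM I (\<lambda>_. \<mu>) \<partial>\<mu>)"
    unfolding U_def by (intro Fubini'[symmetric]) (auto intro!: borel_measurable_SUP simp: split_beta')
  also have "\<dots> = (\<integral>\<^sup>+y. (\<Sum>A\<in>Pow Y. ennreal (1 / N) * (\<integral>\<^sup>+x. (SUP t\<in>T. ennreal (U (?w A y) t + S t x)) \<partial>PiM I (\<lambda>_. \<mu>))) \<partial>\<mu>)"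
    by (subst nn_integral_sum) (auto intro!: borel_measurable_SUP simp: nn_integral_cmult)
  also have "\<dots> \<le> (\<integral>\<^sup>+y. (\<Sum>A\<in>Pow Y. ennreal (1 / N) * ennreal (R * (\<Sum>v\<in>Y. sqrt ((norm (?w A y v))\<^sup>2 + 4 * card I * V)))) \<partial>\<mu>)"
    using insert.IH unfolding U_def S_def F_def m_def
    by (intro nn_integral_mono sum_mono mult_left_mono) auto
  also have "\<dots> \<le> (\<integral>\<^sup>+y. (\<Sum>v\<in>Y. ennreal R * ennreal (sqrt ((norm (w v))\<^sup>2 + 4 * card I * V + 4 * (norm (\<phi> y))\<^sup>2))) \<partial>\<mu>)"
  proof (rule nn_integral_mono)
    fix y
    define H where "H v e = sqrt ((norm (w v + (2 * e) *\<^sub>R \<phi> y))\<^sup>2 + 4 * card I * V)" for v e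
    have H0: "0 \<le> H v e" for v e using V by (simp add: H_def)
    have "(\<Sum>A\<in>Pow Y. ennreal (1 / N) * ennreal (R * (\<Sum>v\<in>Y. sqrt ((norm (?w A y v))\<^sup>2 + 4 * card I * V))))
      = ennreal (\<Sum>A\<in>Pow Y. 1 / N * (R * (\<Sum>v\<in>Y. H v (sgn_in A v))))"
      using N R H0 unfolding H_def[symmetric]
      by (subst sum_ennreal[symmetric]) (auto simp: ennreal_mult[symmetric] sum_nonneg)
    also have "(\<Sum>A\<in>Pow Y. 1 / N * (R * (\<Sum>v\<in>Y. H v (sgn_in A v))))
        = R / N * (\<Sum>v\<in>Y. \<Sum>A\<in>Pow Y. H v (sgn_in A v))"
      by (subst sum.swap) (simp add: sum_distrib_left)
    \<comment> \<open>The summand of \<open>v\<close> sees only the sign at \<open>v\<close>, so the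
      average over patterns collapses to two values.\<close>
    also have "(\<Sum>v\<in>Y. \<Sum>A\<in>Pow Y. H v (sgn_in A v)) = N * (\<Sum>v\<in>Y. (H v 1 + H v (- 1)) / 2)"
      unfolding sum_distrib_left N_def using Y by (intro sum.cong refl sum_Pow_sgn_in) auto
    also have "R / N * (N * (\<Sum>v\<in>Y. (H v 1 + H v (- 1)) / 2)) = R * (\<Sum>v\<in>Y. (H v 1 + H v (- 1)) / 2)"
      using N by simp
    also have "\<dots> \<le> R * (\<Sum>v\<in>Y. sqrt ((norm (w v))\<^sup>2 + 4 * card I * V + 4 * (norm (\<phi> y))\<^sup>2))"
    proof (intro mult_left_mono sum_mono R(2))
      fix v
      show "(H v 1 + H v (- 1)) / 2 \<le> sqrt ((norm (w v))\<^sup>2 + 4 * card I * V + 4 * (norm (\<phi> y))\<^sup>2)"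
        using avg_sqrt_le[of "4 * card I * V" "w v" "2 *\<^sub>R \<phi> y"] V by (simp add: H_def power_mult_distrib)
    qed
    also have "ennreal \<dots> = (\<Sum>v\<in>Y. ennreal R * ennreal (sqrt ((norm (w v))\<^sup>2 + 4 * card I * V + 4 * (norm (\<phi> y))\<^sup>2)))"
      using R V by (simp add: sum_distrib_left[symmetric] ennreal_mult sum_nonneg)
    finally show "(\<Sum>A\<in>Pow Y. ennreal (1 / N) * ennreal (R * (\<Sum>v\<in>Y. sqrt ((norm (?w A y v))\<^sup>2 + 4 * card I * V)))) \<le> \<dots>"
      by (simp add: ennreal_leI)
  qed
  also have "\<dots> = (\<Sum>v\<in>Y. ennreal R * (\<integral>\<^sup>+y. ennreal (sqrt ((norm (w v))\<^sup>2 + 4 * card I * V + 4 * (norm (\<phi> y))\<^sup>2)) \<partial>\<mu>))"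
    by (simp add: nn_integral_sum nn_integral_cmult)
  also have "\<dots> \<le> (\<Sum>v\<in>Y. ennreal R * ennreal (sqrt ((norm (w v))\<^sup>2 + 4 * card (insert i I) * V)))"
  proof (intro sum_mono mult_left_mono nn_integral_sqrt_le)
    fix v
    have "(\<integral>\<^sup>+y. ennreal ((norm (w v))\<^sup>2 + 4 * card I * V + 4 * (norm (\<phi> y))\<^sup>2) \<partial>\<mu>)
      = ennreal (\<integral>y. (norm (w v))\<^sup>2 + 4 * card I * V + 4 * (norm (\<phi> y))\<^sup>2 \<partial>\<mu>)"
      using int_sq V by (intro nn_integral_eq_integral) auto
    also have "\<dots> = ennreal ((norm (w v))\<^sup>2 + 4 * card I * V + 4 * (\<integral>y. (norm (\<phi> y))\<^sup>2 \<partial>\<mu>))"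
      using int_sq by (simp add: prob_space)
    also have "\<dots> \<le> ennreal ((norm (w v))\<^sup>2 + 4 * card (insert i I) * V)"
      using sq_le insert.hyps by (intro ennreal_leI) (simp add: algebra_simps)
    finally show "(\<integral>\<^sup>+y. ennreal ((norm (w v))\<^sup>2 + 4 * card I * V + 4 * (norm (\<phi> y))\<^sup>2) \<partial>\<mu>)
      \<le> ennreal ((norm (w v))\<^sup>2 + 4 * card (insert i I) * V)" .
    show "0 < (norm (w v))\<^sup>2 + 4 * card (insert i I) * V"
      using V insert.hyps by (intro add_nonneg_pos mult_pos_pos) auto
  qed (use V in auto)
  also have "\<dots> = ennreal (R * (\<Sum>v\<in>Y. sqrt ((norm (w v))\<^sup>2 + 4 * card (insert i I) * V)))"
    using R V by (simp add: sum_distrib_left[symmetric] ennreal_mult sum_nonneg del: card_insert_disjoint)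
  finally show ?case unfolding U_def m_def F_def .
qed

section \<open>Semidiscrete transport duality\<close>

text \<open>The points with \<open>0 < g p\<close> bound the multiplier from below, those with
  \<open>g p < 0\<close> from above. Were a lower bound above an upper one, mixing the two points to
  reach \<open>g = 0\<close> would contradict \<open>le\<close>. Convexity is stated through the
  values of \<open>f\<close> and \<open>g\<close>, so \<open>P\<close> carries no linear
  structure.\<close>

lemma lagrange_multiplier_exists:
  fixes f g :: "'a \<Rightarrow> real"
  assumes mix: "\<And>p p' t. p \<in> P \<Longrightarrow> p' \<in> P \<Longrightarrow> 0 \<le> t \<Longrightarrow> t \<le> 1 \<Longrightarrow>
      \<exists>r\<in>P. f r = (1 - t) * f p + t * f p' \<and> g r = (1 - t) * g p + t * g p'"
    and neg: "\<exists>p\<in>P. g p < 0" and pos: "\<exists>p\<in>P. 0 < g p"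
    and le: "\<And>p. p \<in> P \<Longrightarrow> g p = 0 \<Longrightarrow> f p \<le> s"
  shows "\<exists>z. \<forall>p\<in>P. f p - z * g p \<le> s"
proof -
  have slopes: "(f p - s) / g p \<le> (s - f p') / (- g p')" if p: "p \<in> P" "0 < g p" and p': "p' \<in> P" "g p' < 0" for p p'
  proof -
    \<comment> \<open>The weight at which the mixture of \<open>p\<close> and \<open>p'\<close>
      satisfies the constraint.\<close>
    define t where "t = g p / (g p - g p')"
    have t: "0 \<le> t" "t \<le> 1" using that by (auto simp: t_def)
    obtain r where r: "r \<in> P" "f r = (1 - t) * f p + t * f p'" "g r = (1 - t) * g p + t * g p'"
      using mix[OF p(1) p'(1) t] by blast
    have d: "1 - t = - g p' / (g p - g p')" using that by (simp add: t_def field_simps)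
    have "g r = 0" unfolding r(3) d unfolding t_def by (simp add: field_simps)
    with le r have "(1 - t) * f p + t * f p' \<le> s" by metis
    then have "(- g p' * f p + g p * f p') / (g p - g p') \<le> s"
      unfolding d unfolding t_def by (simp add: add_divide_distrib diff_divide_distrib)
    then have "- g p' * f p + g p * f p' \<le> s * (g p - g p')"
      using that by (simp add: divide_le_eq)
    then show ?thesis using that by (simp add: field_simps)
  qed
  define Z where "Z = {(f p - s) / g p | p. p \<in> P \<and> 0 < g p}"
  obtain q where q: "q \<in> P" "g q < 0" using neg by blast
  have bdd: "bdd_above Z"
    by (rule bdd_aboveI[where M="(s - f q) / (- g q)"]) (use slopes q in \<open>auto simp: Z_def\<close>)
  have ne: "Z \<noteq> {}" using pos by (auto simp: Z_def)
  have "f p - Sup Z * g p \<le> s" if p: "p \<in> P" for p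
  proof (cases "g p" "0::real" rule: linorder_cases)
    case less
    have "Sup Z \<le> (s - f p) / (- g p)"
      by (rule cSup_least[OF ne]) (use slopes p less in \<open>auto simp: Z_def\<close>)
    then show ?thesis using less by (simp add: field_simps)
  next
    case equal
    then show ?thesis using le p by simp
  next
    case greater
    have "(f p - s) / g p \<le> Sup Z"
      by (rule cSup_upper[OF _ bdd]) (use p greater in \<open>auto simp: Z_def\<close>)
    then show ?thesis using greater by (simp add: field_simps)
  qed
  then show ?thesis by blast
qed


text \<open>Dualising one constraint at a time needs only separation on the real line.\<close>

lemma lagrange_multipliers_exist:
  fixes f :: "'a \<Rightarrow> real" and g :: "'b \<Rightarrow> 'a \<Rightarrow> real"
  assumes "finite J"
    and "\<And>p p' t. p \<in> P \<Longrightarrow> p' \<in> P \<Longrightarrow> 0 \<le> t \<Longrightarrow> t \<le> 1 \<Longrightarrow>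
      \<exists>r\<in>P. f r = (1 - t) * f p + t * f p' \<and> (\<forall>v\<in>J. g v r = (1 - t) * g v p + t * g v p')"
    and "\<And>v. v \<in> J \<Longrightarrow> \<exists>p\<in>P. g v p < 0 \<and> (\<forall>u\<in>J - {v}. g u p = 0)"
    and "\<And>v. v \<in> J \<Longrightarrow> \<exists>p\<in>P. 0 < g v p \<and> (\<forall>u\<in>J - {v}. g u p = 0)"
    and "\<And>p. p \<in> P \<Longrightarrow> (\<forall>v\<in>J. g v p = 0) \<Longrightarrow> f p \<le> s"
  shows "\<exists>z. \<forall>p\<in>P. f p - (\<Sum>v\<in>J. z v * g v p) \<le> s"
  using assms
proof (induction J arbitrary: f)
  case empty
  then show ?case by simp
next
  case (insert k J)
  note mix = insert.prems(1) and neg = insert.prems(2) and pos = insert.prems(3) and le = insert.prems(4)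
  \<comment> \<open>Constraint \<open>k\<close> is dualised among the points satisfying the others.
    With its multiplier \<open>a\<close>, the remaining constraints alone force
    \<open>f - a * g k\<close> below \<open>s\<close>, which is the situation of the induction
    hypothesis.\<close>
  define Q where "Q = {p\<in>P. \<forall>v\<in>J. g v p = 0}"
  have "\<exists>z. \<forall>p\<in>Q. f p - z * g k p \<le> s"
  proof (rule lagrange_multiplier_exists)
    fix p p' and t :: real assume *: "p \<in> Q" "p' \<in> Q" "0 \<le> t" "t \<le> 1"
    with mix[of p p' t] obtain r where r: "r \<in> P" "f r = (1 - t) * f p + t * f p'"
      "\<forall>v\<in>insert k J. g v r = (1 - t) * g v p + t * g v p'"
      unfolding Q_def by blast
    with * have "r \<in> Q" by (auto simp: Q_def)
    with r show "\<exists>r\<in>Q. f r = (1 - t) * f p + t * f p' \<and> g k r = (1 - t) * g k p + t * g k p'"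
      by auto
  next
    show "\<exists>p\<in>Q. g k p < 0" using neg[of k] insert.hyps by (auto simp: Q_def)
    show "\<exists>p\<in>Q. 0 < g k p" using pos[of k] insert.hyps by (auto simp: Q_def)
  qed (use le in \<open>auto simp: Q_def\<close>)
  then obtain a where a: "\<And>p. p \<in> Q \<Longrightarrow> f p - a * g k p \<le> s" by blast
  have "\<exists>z. \<forall>p\<in>P. (f p - a * g k p) - (\<Sum>v\<in>J. z v * g v p) \<le> s"
  proof (rule insert.IH)
    fix p p' and t :: real assume *: "p \<in> P" "p' \<in> P" "0 \<le> t" "t \<le> 1"
    with mix[of p p' t] obtain r where r: "r \<in> P" "f r = (1 - t) * f p + t * f p'"
      "\<forall>v\<in>insert k J. g v r = (1 - t) * g v p + t * g v p'"
      by blast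
    have E: "f r - a * g k r = (1 - t) * (f p - a * g k p) + t * (f p' - a * g k p')"
      unfolding r(2) r(3)[THEN bspec, OF insertI1] by (simp add: algebra_simps)
    show "\<exists>r\<in>P. f r - a * g k r = (1 - t) * (f p - a * g k p) + t * (f p' - a * g k p') \<and>
        (\<forall>v\<in>J. g v r = (1 - t) * g v p + t * g v p')"
      by (intro bexI[OF _ r(1)] conjI E) (use r(3) in blast)
  next
    fix v assume v: "v \<in> J"
    show "\<exists>p\<in>P. g v p < 0 \<and> (\<forall>u\<in>J - {v}. g u p = 0)" using neg[of v] v by blast
    show "\<exists>p\<in>P. 0 < g v p \<and> (\<forall>u\<in>J - {v}. g u p = 0)" using pos[of v] v by blast
  qed (use a in \<open>auto simp: Q_def\<close>)
  then obtain z where z: "\<forall>p\<in>P. (f p - a * g k p) - (\<Sum>v\<in>J. z v * g v p) \<le> s" by blast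
  have "(\<Sum>v\<in>insert k J. (z(k := a)) v * g v p) = a * g k p + (\<Sum>v\<in>J. z v * g v p)" for p
  proof -
    have "(\<Sum>v\<in>J. (z(k := a)) v * g v p) = (\<Sum>v\<in>J. z v * g v p)"
      using insert.hyps by (intro sum.cong) auto
    then show ?thesis using insert.hyps by simp
  qed
  with z show ?case by (intro exI[of _ "z(k := a)"]) (simp add: diff_diff_eq)
qed

text \<open>Couplings of \<mu> with a measure on \<open>Y\<close> in disintegrated form:
  \<open>p v x\<close> is the conditional weight of the atom \<open>v\<close> at \<open>x\<close>.
  Normalisation holds at every \<open>x\<close>, not just almost everywhere, so sums over
  \<open>Y\<close> can be rewritten pointwise.\<close>

definition simplex_selections :: "'a measure \<Rightarrow> 'b set \<Rightarrow> ('b \<Rightarrow> 'a \<Rightarrow> real) set" where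
  "simplex_selections \<mu> Y = {p. (\<forall>v\<in>Y. p v \<in> borel_measurable \<mu>) \<and> (\<forall>v\<in>Y. \<forall>x. 0 \<le> p v x) \<and>
     (\<forall>x. (\<Sum>v\<in>Y. p v x) = 1)}"

lemma simplex_selections_le_1:
  assumes "p \<in> simplex_selections \<mu> Y" "finite Y" "v \<in> Y"
  shows "p v x \<le> 1"
  using member_le_sum[of v Y "\<lambda>v. p v x"] assms by (auto simp: simplex_selections_def)

lemma integrable_simplex_selection:
  assumes "prob_space \<mu>" "p \<in> simplex_selections \<mu> Y" "finite Y" "v \<in> Y"
  shows "integrable \<mu> (p v)"
proof -
  interpret prob_space \<mu> by fact
  show ?thesis
    using assms simplex_selections_le_1[OF assms(2-4)]
    by (intro integrable_const_bound[where B=1]) (auto simp: simplex_selections_def)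
qed

lemma integrable_mult_simplex_selection:
  fixes f :: "'a \<Rightarrow> real"
  assumes "p \<in> simplex_selections \<mu> Y" "finite Y" "v \<in> Y" "integrable \<mu> f"
  shows "integrable \<mu> (\<lambda>x. p v x * f x)"
proof -
  have [measurable]: "p v \<in> borel_measurable \<mu>" "f \<in> borel_measurable \<mu>"
    using assms by (auto simp: simplex_selections_def)
  have "norm (p v x * f x) \<le> norm (f x)" for x
    using assms simplex_selections_le_1[OF assms(1-3), of x]
    by (auto simp: abs_mult simplex_selections_def intro: mult_left_le_one_le)
  then show ?thesis
    by (intro Bochner_Integration.integrable_bound[OF assms(4)]) auto
qed

lemma simplex_selections_mix:
  assumes "p \<in> simplex_selections \<mu> Y" "p' \<in> simplex_selections \<mu> Y" "0 \<le> t" "t \<le> 1"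
  shows "(\<lambda>v x. (1 - t) * p v x + t * p' v x) \<in> simplex_selections \<mu> Y"
  using assms
  by (auto simp: simplex_selections_def sum.distrib sum_distrib_left[symmetric]
      intro!: borel_measurable_add borel_measurable_times)

text \<open>Kantorovich duality against a discrete marginal. Only finitely many equations tie a
  selection to the weights, so finitely many multipliers suffice; once they are subtracted, the best
  selection concentrates at each \<open>x\<close> on the largest \<open>h v x - z v\<close>.\<close>

lemma semidiscrete_duality:
  fixes h :: "'b \<Rightarrow> 'a \<Rightarrow> real"
  assumes "prob_space \<mu>" and Y: "finite Y" "Y \<noteq> {}"
    and \<nu>: "\<And>v. v \<in> Y \<Longrightarrow> 0 < \<nu> v" "(\<Sum>v\<in>Y. \<nu> v) = 1"
    and h: "\<And>v. v \<in> Y \<Longrightarrow> integrable \<mu> (h v)"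
    and le: "\<And>p. p \<in> simplex_selections \<mu> Y \<Longrightarrow> (\<forall>v\<in>Y. (\<integral>x. p v x \<partial>\<mu>) = \<nu> v) \<Longrightarrow>
      (\<Sum>v\<in>Y. \<integral>x. p v x * h v x \<partial>\<mu>) \<le> s"
  shows "\<exists>z. (\<integral>x. (MAX v\<in>Y. h v x - z v) \<partial>\<mu>) + (\<Sum>v\<in>Y. \<nu> v * z v) \<le> s"
proof -
  interpret prob_space \<mu> by fact
  let ?P = "simplex_selections \<mu> Y"
  obtain v0 where v0: "v0 \<in> Y" using Y by blast
  \<comment> \<open>The constraint of \<open>v0\<close> follows from the others, as selections sum
    to 1. Keeping it would leave no selection that violates one constraint and meets the
    rest.\<close>
  define J where "J = Y - {v0}"
  have fJ: "finite J" using Y by (simp add: J_def)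
  have Y_sum: "sum F Y = F v0 + sum F J" for F :: "'b \<Rightarrow> real"
    unfolding J_def using v0 Y by (intro sum.remove) auto
  have const: "(\<lambda>v x. c v) \<in> ?P" if "\<And>v. v \<in> Y \<Longrightarrow> 0 \<le> c v" "sum c Y = 1" for c
    using that by (auto simp: simplex_selections_def)
  have "\<exists>z. \<forall>p\<in>?P. (\<Sum>v\<in>Y. \<integral>x. p v x * h v x \<partial>\<mu>) - (\<Sum>v\<in>J. z v * ((\<integral>x. p v x \<partial>\<mu>) - \<nu> v)) \<le> s"
  proof (rule lagrange_multipliers_exist)
    show "finite J" by fact
  next
    fix p p' and t :: real assume *: "p \<in> ?P" "p' \<in> ?P" "0 \<le> t" "t \<le> 1"
    let ?r = "\<lambda>v x. (1 - t) * p v x + t * p' v x"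
    have r: "?r \<in> ?P" using simplex_selections_mix[OF *] .
    have 1: "(\<integral>x. ?r v x * h v x \<partial>\<mu>) = (1 - t) * (\<integral>x. p v x * h v x \<partial>\<mu>) + t * (\<integral>x. p' v x * h v x \<partial>\<mu>)"
      if "v \<in> Y" for v
      using integrable_mult_simplex_selection[OF *(1) Y(1) that h[OF that]]
        integrable_mult_simplex_selection[OF *(2) Y(1) that h[OF that]]
      by (simp add: algebra_simps)
    have 2: "(\<integral>x. ?r v x \<partial>\<mu>) = (1 - t) * (\<integral>x. p v x \<partial>\<mu>) + t * (\<integral>x. p' v x \<partial>\<mu>)" if "v \<in> Y" for v
      using integrable_simplex_selection[OF assms(1) *(1) Y(1) that]
        integrable_simplex_selection[OF assms(1) *(2) Y(1) that]
      by simp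
    show "\<exists>r\<in>?P. (\<Sum>v\<in>Y. \<integral>x. r v x * h v x \<partial>\<mu>) = (1 - t) * (\<Sum>v\<in>Y. \<integral>x. p v x * h v x \<partial>\<mu>)
          + t * (\<Sum>v\<in>Y. \<integral>x. p' v x * h v x \<partial>\<mu>) \<and>
        (\<forall>v\<in>J. (\<integral>x. r v x \<partial>\<mu>) - \<nu> v = (1 - t) * ((\<integral>x. p v x \<partial>\<mu>) - \<nu> v) + t * ((\<integral>x. p' v x \<partial>\<mu>) - \<nu> v))"
    proof (rule bexI[OF _ r], intro conjI ballI)
      have "(\<Sum>v\<in>Y. \<integral>x. ?r v x * h v x \<partial>\<mu>)
          = (\<Sum>v\<in>Y. (1 - t) * (\<integral>x. p v x * h v x \<partial>\<mu>) + t * (\<integral>x. p' v x * h v x \<partial>\<mu>))"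
        by (intro sum.cong refl 1)
      then show "(\<Sum>v\<in>Y. \<integral>x. ?r v x * h v x \<partial>\<mu>) = (1 - t) * (\<Sum>v\<in>Y. \<integral>x. p v x * h v x \<partial>\<mu>)
          + t * (\<Sum>v\<in>Y. \<integral>x. p' v x * h v x \<partial>\<mu>)"
        by (simp only: sum.distrib sum_distrib_left)
      fix v assume "v \<in> J"
      then have "v \<in> Y" by (simp add: J_def)
      show "(\<integral>x. ?r v x \<partial>\<mu>) - \<nu> v = (1 - t) * ((\<integral>x. p v x \<partial>\<mu>) - \<nu> v) + t * ((\<integral>x. p' v x \<partial>\<mu>) - \<nu> v)"
        unfolding 2[OF \<open>v \<in> Y\<close>] by (simp add: algebra_simps)
    qed
  next
    fix v assume v: "v \<in> J"
    have sums: "sum (\<nu>(v := a, v0 := b)) Y = 1" if "a + b = \<nu> v + \<nu> v0" for a b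
    proof -
      have "sum (\<nu>(v := a, v0 := b)) J = a + sum \<nu> (J - {v})"
        using v fJ by (subst sum.remove[of J v]) (auto simp: J_def intro!: sum.cong)
      moreover have "sum \<nu> J = \<nu> v + sum \<nu> (J - {v})"
        using v fJ by (subst sum.remove[of J v]) auto
      ultimately show ?thesis using \<nu>(2) that v by (simp add: Y_sum J_def)
    qed
    have vY: "v \<in> Y" "v \<noteq> v0" using v by (auto simp: J_def)
    note pos = \<nu>(1)[OF vY(1)] \<nu>(1)[OF v0]
    \<comment> \<open>Constant selections shifting all mass of \<open>v\<close> to
      \<open>v0\<close>, or the reverse, violate the constraint of \<open>v\<close> alone; positive
      weights make the violation strict.\<close>
    have "(\<lambda>u x. (\<nu>(v := 0, v0 := \<nu> v + \<nu> v0)) u) \<in> ?P"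
      using \<nu>(1) pos sums[of 0 "\<nu> v + \<nu> v0"] by (intro const) (auto simp: less_imp_le)
    then show "\<exists>p\<in>?P. (\<integral>x. p v x \<partial>\<mu>) - \<nu> v < 0 \<and> (\<forall>u\<in>J - {v}. (\<integral>x. p u x \<partial>\<mu>) - \<nu> u = 0)"
      using vY pos by (intro bexI) (auto simp: prob_space J_def)
    have "(\<lambda>u x. (\<nu>(v := \<nu> v + \<nu> v0, v0 := 0)) u) \<in> ?P"
      using \<nu>(1) pos sums[of "\<nu> v + \<nu> v0" 0] by (intro const) (auto simp: less_imp_le)
    then show "\<exists>p\<in>?P. 0 < (\<integral>x. p v x \<partial>\<mu>) - \<nu> v \<and> (\<forall>u\<in>J - {v}. (\<integral>x. p u x \<partial>\<mu>) - \<nu> u = 0)"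
      using vY pos by (intro bexI) (auto simp: prob_space J_def)
  next
    fix p assume p: "p \<in> ?P" and eq: "\<forall>v\<in>J. (\<integral>x. p v x \<partial>\<mu>) - \<nu> v = 0"
    have "(\<Sum>v\<in>Y. \<integral>x. p v x \<partial>\<mu>) = (\<integral>x. (\<Sum>v\<in>Y. p v x) \<partial>\<mu>)"
      using integrable_simplex_selection[OF assms(1) p Y(1)] by simp
    also have "\<dots> = 1" using p by (simp add: simplex_selections_def prob_space)
    finally have "(\<integral>x. p v0 x \<partial>\<mu>) = \<nu> v0" using eq \<nu>(2) by (simp add: Y_sum)
    with eq have "\<forall>v\<in>Y. (\<integral>x. p v x \<partial>\<mu>) = \<nu> v" by (auto simp: J_def)
    with le p show "(\<Sum>v\<in>Y. \<integral>x. p v x * h v x \<partial>\<mu>) \<le> s" by blast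
  qed
  then obtain z' where z': "\<And>p. p \<in> ?P \<Longrightarrow>
    (\<Sum>v\<in>Y. \<integral>x. p v x * h v x \<partial>\<mu>) - (\<Sum>v\<in>J. z' v * ((\<integral>x. p v x \<partial>\<mu>) - \<nu> v)) \<le> s" by blast
  define z where "z = z'(v0 := 0)"
  have z: "(\<Sum>v\<in>Y. \<integral>x. p v x * h v x \<partial>\<mu>) - (\<Sum>v\<in>Y. z v * ((\<integral>x. p v x \<partial>\<mu>) - \<nu> v)) \<le> s" if "p \<in> ?P" for p
  proof -
    have "(\<Sum>v\<in>Y. z v * ((\<integral>x. p v x \<partial>\<mu>) - \<nu> v)) = (\<Sum>v\<in>J. z' v * ((\<integral>x. p v x \<partial>\<mu>) - \<nu> v))"
      unfolding Y_sum by (auto simp: z_def J_def intro!: sum.cong)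
    with z'[OF that] show ?thesis by simp
  qed
  define m where "m x = (MAX v\<in>Y. h v x - z v)" for x
  \<comment> \<open>An optimal selection: mass is spread evenly over the maximisers, which is
    measurable without ordering \<open>Y\<close>.\<close>
  define c where "c v x = (if h v x - z v = m x then 1 else 0 :: real)" for v x
  define p where "p v x = c v x / (\<Sum>u\<in>Y. c u x)" for v x
  have [measurable]: "h v \<in> borel_measurable \<mu>" if "v \<in> Y" for v
    using h[OF that] by auto
  have m_meas[measurable]: "m \<in> borel_measurable \<mu>"
    unfolding m_def using Y by (intro borel_measurable_Max) auto
  have c_meas[measurable]: "c v \<in> borel_measurable \<mu>" if "v \<in> Y" for v
    unfolding c_def using that by measurable
  have csum: "0 < (\<Sum>u\<in>Y. c u x)" for x
  proof -
    have "m x \<in> (\<lambda>v. h v x - z v) ` Y" unfolding m_def using Y by (intro Max_in) auto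
    then obtain u where "u \<in> Y" "h u x - z u = m x" by auto
    then show ?thesis using Y by (intro sum_pos2[of _ u]) (auto simp: c_def)
  qed
  have pP: "p \<in> ?P"
    unfolding simplex_selections_def
  proof (intro CollectI conjI ballI allI)
    show "p v \<in> borel_measurable \<mu>" if "v \<in> Y" for v
      unfolding p_def using that by measurable
    show "0 \<le> p v x" for v x
      unfolding p_def using csum[of x] by (auto simp: c_def)
    show "(\<Sum>v\<in>Y. p v x) = 1" for x
      unfolding p_def using csum[of x] by (simp add: sum_divide_distrib[symmetric])
  qed
  have pm: "(\<Sum>v\<in>Y. p v x * (h v x - z v)) = m x" for x
  proof -
    have "(\<Sum>v\<in>Y. p v x * (h v x - z v)) = (\<Sum>v\<in>Y. p v x * m x)"
      by (intro sum.cong) (auto simp: p_def c_def)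
    also have "\<dots> = m x" using pP by (simp add: sum_distrib_right[symmetric] simplex_selections_def)
    finally show ?thesis .
  qed
  have ip: "integrable \<mu> (p v)" "integrable \<mu> (\<lambda>x. p v x * h v x)" if "v \<in> Y" for v
    using integrable_simplex_selection[OF assms(1) pP Y(1) that]
      integrable_mult_simplex_selection[OF pP Y(1) that h[OF that]] by auto
  have "(\<integral>x. m x \<partial>\<mu>) = (\<integral>x. (\<Sum>v\<in>Y. p v x * h v x - z v * p v x) \<partial>\<mu>)"
    unfolding pm[symmetric] by (simp add: algebra_simps)
  also have "\<dots> = (\<Sum>v\<in>Y. (\<integral>x. p v x * h v x \<partial>\<mu>) - z v * (\<integral>x. p v x \<partial>\<mu>))"
    using ip by (subst Bochner_Integration.integral_sum) auto
  finally have "(\<integral>x. m x \<partial>\<mu>) + (\<Sum>v\<in>Y. \<nu> v * z v) \<le> s"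
    using z[OF pP] by (simp add: sum_subtractf sum.distrib algebra_simps)
  then show ?thesis unfolding m_def by blast
qed

lemma abs_Max_le:
  fixes f :: "'b \<Rightarrow> real"
  assumes "finite Y" "Y \<noteq> {}" "\<And>v. v \<in> Y \<Longrightarrow> \<bar>f v\<bar> \<le> b"
  shows "\<bar>MAX v\<in>Y. f v\<bar> \<le> b"
proof -
  have "Max (f ` Y) \<in> f ` Y" using assms by (intro Max_in) auto
  with assms(3) show ?thesis by auto
qed

text \<open>The bound on \<open>z\<close> depends on the measure only through \<eta> and
  \<open>H\<close>; this keeps the potentials of all samples within one class of test functions. The
  error \<open>e\<close> stands for a selection that is only nearly optimal.\<close>

lemma semidiscrete_duality_bounded:
  fixes h :: "'b \<Rightarrow> 'a \<Rightarrow> real"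
  assumes "prob_space \<mu>" and Y: "finite Y" "Y \<noteq> {}"
    and \<nu>: "\<And>v. v \<in> Y \<Longrightarrow> \<eta> \<le> \<nu> v" "0 < \<eta>" "(\<Sum>v\<in>Y. \<nu> v) = 1"
    and h[measurable]: "\<And>v. v \<in> Y \<Longrightarrow> h v \<in> borel_measurable \<mu>"
    and b: "\<And>v x. v \<in> Y \<Longrightarrow> \<bar>h v x\<bar> \<le> b x" "integrable \<mu> b" "(\<integral>x. b x \<partial>\<mu>) \<le> H"
    and e: "0 < e"
  shows "\<exists>p z. p \<in> simplex_selections \<mu> Y \<and> (\<forall>v\<in>Y. (\<integral>x. p v x \<partial>\<mu>) = \<nu> v) \<and>
    (\<forall>v\<in>Y. \<bar>z v\<bar> \<le> 2 * H / \<eta>) \<and>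
    (\<integral>x. (MAX v\<in>Y. h v x - z v) \<partial>\<mu>) + (\<Sum>v\<in>Y. \<nu> v * z v) \<le> (\<Sum>v\<in>Y. \<integral>x. p v x * h v x \<partial>\<mu>) + e"
proof -
  interpret prob_space \<mu> by fact
  have ih: "integrable \<mu> (h v)" if "v \<in> Y" for v
    by (rule Bochner_Integration.integrable_bound[OF b(2)]) (use b(1)[OF that] that in \<open>auto intro!: AE_I2 order_trans[OF _ abs_ge_self]\<close>)
  have \<nu>0: "0 < \<nu> v" if "v \<in> Y" for v using \<nu>(1)[OF that] \<nu>(2) by linarith
  define Q where "Q = {p \<in> simplex_selections \<mu> Y. \<forall>v\<in>Y. (\<integral>x. p v x \<partial>\<mu>) = \<nu> v}"
  define F where "F p = (\<Sum>v\<in>Y. \<integral>x. p v x * h v x \<partial>\<mu>)" for p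
  have F_le: "F p \<le> H" if "p \<in> Q" for p
  proof -
    have p: "p \<in> simplex_selections \<mu> Y" using that by (simp add: Q_def)
    have "F p = (\<integral>x. (\<Sum>v\<in>Y. p v x * h v x) \<partial>\<mu>)"
      unfolding F_def using integrable_mult_simplex_selection[OF p Y(1) _ ih] by simp
    also have "\<dots> \<le> (\<integral>x. b x \<partial>\<mu>)"
    proof (rule integral_mono)
      show "integrable \<mu> (\<lambda>x. \<Sum>v\<in>Y. p v x * h v x)"
        using integrable_mult_simplex_selection[OF p Y(1) _ ih] by simp
      fix x
      have "(\<Sum>v\<in>Y. p v x * h v x) \<le> (\<Sum>v\<in>Y. p v x * b x)"
        using b(1)[of _ x] p by (intro sum_mono mult_left_mono) (auto simp: simplex_selections_def abs_le_iff)
      also have "\<dots> = b x" using p by (simp add: sum_distrib_right[symmetric] simplex_selections_def)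
      finally show "(\<Sum>v\<in>Y. p v x * h v x) \<le> b x" .
    qed (use b in auto)
    finally show ?thesis using b(3) by linarith
  qed
  have "(\<lambda>v x. \<nu> v) \<in> Q"
    using \<nu>0 \<nu>(3) by (auto simp: Q_def simplex_selections_def prob_space less_imp_le)
  then have ne: "F ` Q \<noteq> {}" by blast
  have bdd: "bdd_above (F ` Q)" using F_le by (intro bdd_aboveI[where M=H]) auto
  define s where "s = Sup (F ` Q)"
  have "s \<le> H" unfolding s_def using F_le ne by (intro cSup_least) auto
  have "\<exists>z. (\<integral>x. (MAX v\<in>Y. h v x - z v) \<partial>\<mu>) + (\<Sum>v\<in>Y. \<nu> v * z v) \<le> s"
  proof (rule semidiscrete_duality[OF assms(1) Y \<nu>0 \<nu>(3) ih])
    fix p assume "p \<in> simplex_selections \<mu> Y" "\<forall>v\<in>Y. (\<integral>x. p v x \<partial>\<mu>) = \<nu> v"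
    then have "F p \<le> s" unfolding s_def using bdd by (intro cSup_upper) (auto simp: Q_def)
    then show "(\<Sum>v\<in>Y. \<integral>x. p v x * h v x \<partial>\<mu>) \<le> s" by (simp add: F_def)
  qed auto
  then obtain z0 where z0: "(\<integral>x. (MAX v\<in>Y. h v x - z0 v) \<partial>\<mu>) + (\<Sum>v\<in>Y. \<nu> v * z0 v) \<le> s" by blast
  \<comment> \<open>Shifting all multipliers by a constant preserves the dual value, since the
    weights sum to 1; this shift makes their weighted sum vanish.\<close>
  define c where "c = (\<Sum>v\<in>Y. \<nu> v * z0 v)"
  define z where "z v = z0 v - c" for v
  define m where "m x = (MAX v\<in>Y. h v x - z v)" for x
  have m_eq: "m x = (MAX v\<in>Y. h v x - z0 v) + c" for x
  proof -
    have "m x = Max ((\<lambda>y. y + c) ` (\<lambda>v. h v x - z0 v) ` Y)"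
      unfolding m_def z_def image_image by (simp add: algebra_simps)
    also have "\<dots> = (MAX v\<in>Y. h v x - z0 v) + c"
      using Y by (subst mono_Max_commute[symmetric]) (auto simp: mono_def)
    finally show ?thesis .
  qed
  have im: "integrable \<mu> (\<lambda>x. MAX v\<in>Y. h v x - u v)" for u
  proof (rule Bochner_Integration.integrable_bound[of _ "\<lambda>x. b x + (\<Sum>v\<in>Y. \<bar>u v\<bar>)"])
    show "AE x in \<mu>. norm (MAX v\<in>Y. h v x - u v) \<le> norm (b x + (\<Sum>v\<in>Y. \<bar>u v\<bar>))"
    proof (rule AE_I2)
      fix x
      have "\<bar>MAX v\<in>Y. h v x - u v\<bar> \<le> b x + (\<Sum>v\<in>Y. \<bar>u v\<bar>)"
      proof (rule abs_Max_le[OF Y])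
        fix v assume "v \<in> Y"
        then show "\<bar>h v x - u v\<bar> \<le> b x + (\<Sum>v\<in>Y. \<bar>u v\<bar>)"
          using b(1)[of v x] member_le_sum[of v Y "\<lambda>v. \<bar>u v\<bar>"] Y by auto
      qed
      then show "norm (MAX v\<in>Y. h v x - u v) \<le> norm (b x + (\<Sum>v\<in>Y. \<bar>u v\<bar>))" by simp
    qed
    show "(\<lambda>x. MAX v\<in>Y. h v x - u v) \<in> borel_measurable \<mu>"
      using Y by (intro borel_measurable_Max) auto
  qed (use b in auto)
  have zsum: "(\<Sum>v\<in>Y. \<nu> v * z v) = 0"
    using \<nu>(3) by (simp add: z_def right_diff_distrib sum_subtractf c_def[symmetric] sum_distrib_right[symmetric])
  have mint: "(\<integral>x. m x \<partial>\<mu>) \<le> s"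
    using z0 im[of z0] by (simp add: m_eq c_def[symmetric] prob_space)
  \<comment> \<open>After normalisation the integral of the maximum is at most \<open>s\<close>,
    hence at most \<open>H\<close>, while the integral of each \<open>h v\<close> is at least
    \<open>- H\<close>.\<close>
  have lower: "- (2 * H) \<le> z v" if v: "v \<in> Y" for v
  proof -
    have "(\<integral>x. h v x - z v \<partial>\<mu>) \<le> (\<integral>x. m x \<partial>\<mu>)"
    proof (rule integral_mono)
      fix x show "h v x - z v \<le> m x" unfolding m_def using v Y by (intro Max_ge) auto
    qed (use ih v im[of z] in \<open>auto simp: m_def\<close>)
    moreover have "- (\<integral>x. b x \<partial>\<mu>) \<le> (\<integral>x. h v x \<partial>\<mu>)"
    proof -
      have "(\<integral>x. - b x \<partial>\<mu>) \<le> (\<integral>x. h v x \<partial>\<mu>)"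
        using b(1)[OF v] b(2) ih[OF v] by (intro integral_mono) (auto simp: abs_le_iff minus_le_iff)
      then show ?thesis by simp
    qed
    ultimately show ?thesis using mint \<open>s \<le> H\<close> b(3) ih[OF v] by (simp add: prob_space)
  qed
  have H0: "0 \<le> H"
  proof -
    have "0 \<le> b x" for x using Y b(1)[of _ x] by (metis abs_ge_zero all_not_in_conv order_trans)
    then show ?thesis using b(3) Bochner_Integration.integral_nonneg[of \<mu> b] by (meson order_trans)
  qed
  have upper: "z v \<le> 2 * H / \<eta>" if v: "v \<in> Y" for v
  proof (cases "z v \<le> 0")
    case True
    then show ?thesis using H0 \<nu>(2) by (intro order_trans[OF True]) auto
  next
    case False
    \<comment> \<open>A positive \<open>z v\<close> must be balanced by the other potentials, which
      are at least \<open>- (2 * H)\<close>; dividing by the weight of \<open>v\<close> costs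
      \<eta>.\<close>
    have "\<nu> v * z v = (\<Sum>u\<in>Y - {v}. \<nu> u * (- z u))"
      using zsum sum.remove[OF Y(1) v, of "\<lambda>u. \<nu> u * z u"] by (simp add: sum_negf)
    also have "\<dots> \<le> (\<Sum>u\<in>Y - {v}. \<nu> u * (2 * H))"
    proof (intro sum_mono mult_left_mono)
      fix u assume "u \<in> Y - {v}"
      then show "- z u \<le> 2 * H" "0 \<le> \<nu> u" using lower[of u] \<nu>0[of u] by auto
    qed
    also have "\<dots> \<le> (\<Sum>u\<in>Y. \<nu> u * (2 * H))"
      using Y H0 \<nu>0 by (intro sum_mono2) (auto simp: less_imp_le)
    also have "\<dots> = 2 * H" using \<nu>(3) by (simp add: sum_distrib_right[symmetric])
    finally have "\<nu> v * z v \<le> 2 * H" .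
    moreover have "\<eta> * z v \<le> \<nu> v * z v" using False \<nu>(1)[OF v] by (intro mult_right_mono) auto
    ultimately show ?thesis using \<nu>(2) by (simp add: field_simps)
  qed
  have "\<eta> \<le> 1"
  proof -
    obtain v where v: "v \<in> Y" using Y by blast
    have "\<nu> v \<le> (\<Sum>v\<in>Y. \<nu> v)" using v Y \<nu>0 by (intro member_le_sum) (auto simp: less_imp_le)
    then show ?thesis using \<nu>(1)[OF v] \<nu>(3) by simp
  qed
  then have "2 * H \<le> 2 * H / \<eta>" using H0 \<nu>(2) by (simp add: field_simps mult_left_le)
  then have zb: "\<forall>v\<in>Y. \<bar>z v\<bar> \<le> 2 * H / \<eta>" using lower upper by (fastforce simp: abs_le_iff)
  obtain p where p: "p \<in> Q" "s - e < F p"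
    using less_cSup_iff[OF ne bdd, of "s - e"] e unfolding s_def[symmetric] by auto
  show ?thesis
    by (rule exI[of _ p], rule exI[of _ z]) (use p zb zsum mint in \<open>auto simp: Q_def F_def m_def\<close>)
qed

section \<open>The alignment of a coupling\<close>

definition fourth_power_energy :: "'a::euclidean_space measure \<Rightarrow> real" where
  "fourth_power_energy \<mu> = (\<integral>x. \<integral>x'. norm (x - x') ^ 4 \<partial>\<mu> \<partial>\<mu>)"

definition alignment :: "('a::euclidean_space \<times> 'b::euclidean_space) measure \<Rightarrow> real" where
  "alignment \<pi> = (\<integral>z. \<integral>z'. (norm (fst z - fst z'))\<^sup>2 * (norm (snd z - snd z'))\<^sup>2 \<partial>\<pi> \<partial>\<pi>)"

lemma norm_diff_sq_le: "(norm (x - y))\<^sup>2 \<le> 2 * (norm (x :: 'a::real_inner))\<^sup>2 + 2 * (norm y)\<^sup>2"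
proof -
  have "0 \<le> (norm (x + y))\<^sup>2" by simp
  then show ?thesis
    by (simp add: power2_norm_eq_inner inner_add inner_diff inner_commute)
qed

lemma norm_diff_pow4_le: "norm (x - y) ^ 4 \<le> 8 * norm (x :: 'a::real_inner) ^ 4 + 8 * norm y ^ 4"
proof -
  have "norm (x - y) ^ 4 = ((norm (x - y))\<^sup>2)\<^sup>2" by simp
  also have "\<dots> \<le> (2 * (norm x)\<^sup>2 + 2 * (norm y)\<^sup>2)\<^sup>2"
    by (intro power_mono norm_diff_sq_le) auto
  also have "\<dots> \<le> 8 * ((norm x)\<^sup>2)\<^sup>2 + 8 * ((norm y)\<^sup>2)\<^sup>2"
    using zero_le_power2[of "(norm x)\<^sup>2 - (norm y)\<^sup>2"] by (simp add: power2_eq_square algebra_simps)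
  finally show ?thesis by simp
qed

lemma norm_le_1_plus_sq: "norm x \<le> 1 + (norm x)\<^sup>2"
proof -
  have "0 \<le> (norm x - 1)\<^sup>2" by simp
  then have "2 * norm x \<le> 1 + (norm x)\<^sup>2" by (simp add: power2_eq_square algebra_simps)
  moreover have "0 \<le> norm x" by simp
  ultimately show ?thesis by linarith
qed

text \<open>With the second coordinate in the unit ball, every mixed moment in the expansion of the
  alignment is dominated by \<open>1 + (norm x)\<^sup>2\<close>; the fourth moment serves the energy
  and the pair integrals.\<close>

locale unit_ball_coupling = prob_space \<pi> for \<pi> :: "('a::euclidean_space \<times> 'b::euclidean_space) measure" +
  assumes sets_borel[measurable_cong]: "sets \<pi> = sets borel"
    and snd_le: "AE z in \<pi>. norm (snd z) \<le> 1"
    and int4: "integrable \<pi> (\<lambda>z. norm (fst z) ^ 4)"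
begin

lemma meas_cont: "continuous_on UNIV f \<Longrightarrow> f \<in> borel_measurable \<pi>"
  using borel_measurable_continuous_onI[of f] by (simp add: measurable_cong_sets[OF sets_borel refl])

lemma integrable_dominated:
  fixes f :: "'a \<times> 'b \<Rightarrow> 'c::{banach, second_countable_topology}"
  assumes "continuous_on UNIV f" and le: "\<And>x y. norm y \<le> 1 \<Longrightarrow> norm (f (x, y)) \<le> C * (1 + (norm x)\<^sup>2)"
  shows "integrable \<pi> f"
proof (rule Bochner_Integration.integrable_bound)
  show "integrable \<pi> (\<lambda>z. \<bar>C\<bar> * (2 + norm (fst z) ^ 4))"
    using int4 by (intro integrable_mult_right Bochner_Integration.integrable_add) auto
  show "f \<in> borel_measurable \<pi>" using assms by (intro meas_cont)
  show "AE z in \<pi>. norm (f z) \<le> norm (\<bar>C\<bar> * (2 + norm (fst z) ^ 4))"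
    using snd_le
  proof eventually_elim
    case (elim z)
    have sq: "(norm (fst z))\<^sup>2 \<le> 1 + norm (fst z) ^ 4"
      using norm_le_1_plus_sq[of "(norm (fst z))\<^sup>2"] by simp
    have "norm (f z) \<le> C * (1 + (norm (fst z))\<^sup>2)" using le[OF elim, of "fst z"] by simp
    also have "\<dots> \<le> \<bar>C\<bar> * (2 + norm (fst z) ^ 4)" using sq by (intro mult_mono) auto
    finally show ?case by simp
  qed
qed

lemma integrable_moments:
  shows ia: "integrable \<pi> (\<lambda>z. (norm (fst z))\<^sup>2)"
    and ib: "integrable \<pi> (\<lambda>z. (norm (snd z))\<^sup>2)"
    and ix: "integrable \<pi> fst"
    and iy: "integrable \<pi> snd"
    and iab: "integrable \<pi> (\<lambda>z. (norm (fst z))\<^sup>2 * (norm (snd z))\<^sup>2)"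
    and iay: "integrable \<pi> (\<lambda>z. (norm (fst z))\<^sup>2 *\<^sub>R snd z)"
    and ibx: "integrable \<pi> (\<lambda>z. (norm (snd z))\<^sup>2 *\<^sub>R fst z)"
    and ixy: "integrable \<pi> (\<lambda>z. (y \<bullet> snd z) *\<^sub>R fst z)"
proof -
  have sq: "norm y \<le> 1 \<Longrightarrow> (norm y)\<^sup>2 \<le> 1" for y :: 'b by (simp add: power_le_one)
  show "integrable \<pi> (\<lambda>z. (norm (fst z))\<^sup>2)"
    by (rule integrable_dominated[where C=1]) (auto intro!: continuous_intros)
  show "integrable \<pi> (\<lambda>z. (norm (snd z))\<^sup>2)"
    by (rule integrable_dominated[where C=1]) (auto intro!: continuous_intros dest!: sq intro: add_increasing2)
  show "integrable \<pi> fst"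
    by (rule integrable_dominated[where C=1]) (auto intro!: continuous_intros norm_le_1_plus_sq)
  show "integrable \<pi> snd"
    by (rule integrable_dominated[where C=1]) (auto intro!: continuous_intros intro: add_increasing2)
  show "integrable \<pi> (\<lambda>z. (norm (fst z))\<^sup>2 * (norm (snd z))\<^sup>2)"
  proof (rule integrable_dominated[where C=1])
    fix x :: 'a and y :: 'b assume "norm y \<le> 1"
    then show "norm ((norm (fst (x, y)))\<^sup>2 * (norm (snd (x, y)))\<^sup>2) \<le> 1 * (1 + (norm x)\<^sup>2)"
      using mult_left_le[OF sq, of y "(norm x)\<^sup>2"] by (auto simp: abs_mult)
  qed (auto intro!: continuous_intros)
  show "integrable \<pi> (\<lambda>z. (norm (fst z))\<^sup>2 *\<^sub>R snd z)"
  proof (rule integrable_dominated[where C=1])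
    fix x :: 'a and y :: 'b assume "norm y \<le> 1"
    then show "norm ((norm (fst (x, y)))\<^sup>2 *\<^sub>R snd (x, y)) \<le> 1 * (1 + (norm x)\<^sup>2)"
      using mult_left_le[of "norm y" "(norm x)\<^sup>2"] by auto
  qed (auto intro!: continuous_intros)
  show "integrable \<pi> (\<lambda>z. (norm (snd z))\<^sup>2 *\<^sub>R fst z)"
  proof (rule integrable_dominated[where C=1])
    fix x :: 'a and y :: 'b assume "norm y \<le> 1"
    then show "norm ((norm (snd (x, y)))\<^sup>2 *\<^sub>R fst (x, y)) \<le> 1 * (1 + (norm x)\<^sup>2)"
      using mult_left_le[OF sq, of y "norm x"] norm_le_1_plus_sq[of x] by (auto simp: mult.commute)
  qed (auto intro!: continuous_intros)
  show "integrable \<pi> (\<lambda>z. (y \<bullet> snd z) *\<^sub>R fst z)"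
  proof (rule integrable_dominated[where C="norm y"])
    fix x :: 'a and y' :: 'b assume "norm y' \<le> 1"
    then have "\<bar>y \<bullet> y'\<bar> \<le> norm y"
      using Cauchy_Schwarz_ineq2[of y y'] mult_left_le[of "norm y'" "norm y"] by auto
    then show "norm ((y \<bullet> snd (x, y')) *\<^sub>R fst (x, y')) \<le> norm y * (1 + (norm x)\<^sup>2)"
      using norm_le_1_plus_sq[of x] by (auto intro!: mult_mono)
  qed (auto intro!: continuous_intros)
qed

definition "Ea = (\<integral>z. (norm (fst z))\<^sup>2 \<partial>\<pi>)"
definition "Eb = (\<integral>z. (norm (snd z))\<^sup>2 \<partial>\<pi>)"
definition "mean_x = (\<integral>z. fst z \<partial>\<pi>)"
definition "mean_y = (\<integral>z. snd z \<partial>\<pi>)"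
definition "Eab = (\<integral>z. (norm (fst z))\<^sup>2 * (norm (snd z))\<^sup>2 \<partial>\<pi>)"
definition "Eay = (\<integral>z. (norm (fst z))\<^sup>2 *\<^sub>R snd z \<partial>\<pi>)"
definition "Ebx = (\<integral>z. (norm (snd z))\<^sup>2 *\<^sub>R fst z \<partial>\<pi>)"
text \<open>The cross moment matrix \<open>\<integral> x y\<^sup>T\<close> of \<pi> as a linear
  map.\<close>

definition "L y = (\<integral>z. (y \<bullet> snd z) *\<^sub>R fst z \<partial>\<pi>)"

text \<open>Linearity in coordinates; it reduces continuity of \<open>L\<close> and integrals
  against it to the finitely many vectors \<open>L k\<close>.\<close>

lemma L_eq: "L y = (\<Sum>k\<in>Basis. (y \<bullet> k) *\<^sub>R L k)"
proof -
  have "(y \<bullet> snd z) *\<^sub>R fst z = (\<Sum>k\<in>Basis. (y \<bullet> k) *\<^sub>R (k \<bullet> snd z) *\<^sub>R fst z)" for z :: "'a \<times> 'b"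
    by (subst (1) euclidean_representation[of y, symmetric])
       (simp add: inner_sum_left scaleR_sum_left)
  then have "L y = (\<integral>z. (\<Sum>k\<in>Basis. (y \<bullet> k) *\<^sub>R (k \<bullet> snd z) *\<^sub>R fst z) \<partial>\<pi>)"
    unfolding L_def by (intro Bochner_Integration.integral_cong refl)
  also have "\<dots> = (\<Sum>k\<in>Basis. \<integral>z. (y \<bullet> k) *\<^sub>R (k \<bullet> snd z) *\<^sub>R fst z \<partial>\<pi>)"
    by (intro Bochner_Integration.integral_sum integrable_scaleR_right ixy)
  finally show ?thesis
    by (simp only: L_def integral_scaleR_right)
qed

lemma continuous_on_L[continuous_intros]: "continuous_on A f \<Longrightarrow> continuous_on A (\<lambda>x. L (f x))"
  by (subst L_eq) (intro continuous_intros)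

lemma norm_L_le: "norm y \<le> 1 \<Longrightarrow> norm (L y) \<le> (\<integral>z. norm (fst z) \<partial>\<pi>)"
  unfolding L_def
proof (rule order_trans[OF integral_norm_bound], rule integral_mono_AE)
  assume y: "norm y \<le> 1"
  show "integrable \<pi> (\<lambda>z. norm ((y \<bullet> snd z) *\<^sub>R fst z))" "integrable \<pi> (\<lambda>z. norm (fst z))"
    by (intro integrable_norm ixy ix)+
  show "AE z in \<pi>. norm ((y \<bullet> snd z) *\<^sub>R fst z) \<le> norm (fst z)"
    using snd_le
  proof eventually_elim
    case (elim z)
    have "\<bar>y \<bullet> snd z\<bar> \<le> norm y * norm (snd z)" by (rule Cauchy_Schwarz_ineq2)
    also have "\<dots> \<le> 1" using y elim by (simp add: mult_le_one)
    finally show ?case by (simp add: mult_left_le_one_le)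
  qed
qed

lemma ixL: "integrable \<pi> (\<lambda>z. fst z \<bullet> L (snd z))"
proof (rule integrable_dominated[where C="\<integral>z. norm (fst z) \<partial>\<pi>"])
  fix x :: 'a and y :: 'b assume "norm y \<le> 1"
  then have "\<bar>x \<bullet> L y\<bar> \<le> norm x * (\<integral>z. norm (fst z) \<partial>\<pi>)"
    by (intro order_trans[OF Cauchy_Schwarz_ineq2] mult_left_mono norm_L_le) auto
  also have "\<dots> \<le> (1 + (norm x)\<^sup>2) * (\<integral>z. norm (fst z) \<partial>\<pi>)"
    by (intro mult_right_mono norm_le_1_plus_sq) auto
  finally show "norm (fst (x, y) \<bullet> L (snd (x, y))) \<le> (\<integral>z. norm (fst z) \<partial>\<pi>) * (1 + (norm x)\<^sup>2)"
    by (simp add: mult.commute)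
qed (intro continuous_intros)

text \<open>Multiply out both squared distances. \<open>Ea\<close>, \<open>Eb\<close>,
  \<open>mean_x\<close> and \<open>mean_y\<close> are determined by the marginals and
  \<open>Eab\<close>, \<open>Eay\<close>, \<open>Ebx\<close> are linear in \<pi>, so for fixed
  marginals only the last term, from the product of the two inner products, is quadratic.\<close>

lemma alignment_eq:
  "alignment \<pi> = 2 * Eab + 2 * Ea * Eb - 4 * (Eay \<bullet> mean_y) - 4 * (Ebx \<bullet> mean_x) + 4 * (\<integral>z. fst z \<bullet> L (snd z) \<partial>\<pi>)"
proof -
  note int = ia ib ix iy iab iay ibx ixy
  have inner: "(\<integral>z'. (norm (fst z - fst z'))\<^sup>2 * (norm (snd z - snd z'))\<^sup>2 \<partial>\<pi>)
    = (norm (fst z))\<^sup>2 * (norm (snd z))\<^sup>2 + (norm (fst z))\<^sup>2 * Eb - 2 * (((norm (fst z))\<^sup>2 *\<^sub>R snd z) \<bullet> mean_y)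
      + (norm (snd z))\<^sup>2 * Ea + Eab - 2 * (snd z \<bullet> Eay) - 2 * (((norm (snd z))\<^sup>2 *\<^sub>R fst z) \<bullet> mean_x)
      - 2 * (fst z \<bullet> Ebx) + 4 * (fst z \<bullet> L (snd z))" (is "_ = ?R z") for z :: "'a \<times> 'b"
  proof -
    obtain x y where z: "z = (x, y)" by (cases z)
    let ?a = "\<lambda>z. (norm (fst z))\<^sup>2" and ?b = "\<lambda>z. (norm (snd z))\<^sup>2"
    have eq: "(norm (x - fst z'))\<^sup>2 * (norm (y - snd z'))\<^sup>2
      = (norm x)\<^sup>2 * (norm y)\<^sup>2 + (norm x)\<^sup>2 * ?b z' - 2 * (norm x)\<^sup>2 * (y \<bullet> snd z') + (norm y)\<^sup>2 * ?a z'
        + ?a z' * ?b z' - 2 * (y \<bullet> (?a z' *\<^sub>R snd z')) - 2 * (norm y)\<^sup>2 * (x \<bullet> fst z')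
        - 2 * (x \<bullet> (?b z' *\<^sub>R fst z')) + 4 * (x \<bullet> ((y \<bullet> snd z') *\<^sub>R fst z'))" for z' :: "'a \<times> 'b"
    proof -
      have nx: "(norm (x - fst z'))\<^sup>2 = (norm x)\<^sup>2 + ?a z' - 2 * (x \<bullet> fst z')"
        by (simp add: power2_norm_eq_inner inner_diff inner_commute)
      have ny: "(norm (y - snd z'))\<^sup>2 = (norm y)\<^sup>2 + ?b z' - 2 * (y \<bullet> snd z')"
        by (simp add: power2_norm_eq_inner inner_diff inner_commute)
      show ?thesis unfolding nx ny by (simp add: algebra_simps)
    qed
    have "(\<integral>z'. (norm (x - fst z'))\<^sup>2 * (norm (y - snd z'))\<^sup>2 \<partial>\<pi>) = (norm x)\<^sup>2 * (norm y)\<^sup>2 + (norm x)\<^sup>2 * Eb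
        - 2 * (norm x)\<^sup>2 * (y \<bullet> mean_y) + (norm y)\<^sup>2 * Ea
        + Eab - 2 * (y \<bullet> Eay) - 2 * (norm y)\<^sup>2 * (x \<bullet> mean_x) - 2 * (x \<bullet> Ebx) + 4 * (x \<bullet> L y)"
      unfolding eq Ea_def Eb_def mean_x_def mean_y_def Eab_def Eay_def Ebx_def L_def
      using int by (simp add: prob_space del: inner_scaleR_right)
    then show ?thesis by (simp add: z)
  qed
  have "alignment \<pi> = (\<integral>z. ?R z \<partial>\<pi>)"
    unfolding alignment_def by (intro Bochner_Integration.integral_cong refl inner)
  also have "\<dots> = Eab + Ea * Eb - 2 * (Eay \<bullet> mean_y) + Eb * Ea + Eab - 2 * (mean_y \<bullet> Eay) - 2 * (Ebx \<bullet> mean_x)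
      - 2 * (mean_x \<bullet> Ebx) + 4 * (\<integral>z. fst z \<bullet> L (snd z) \<partial>\<pi>)"
    unfolding Ea_def Eb_def mean_x_def mean_y_def Eab_def Eay_def Ebx_def
    using int ixL by (simp add: prob_space del: inner_scaleR_left)
  finally show ?thesis by (simp add: inner_commute)
qed

lemma integrable_pair_dominated:
  fixes f :: "('a \<times> 'b) \<times> ('a \<times> 'b) \<Rightarrow> real"
  assumes cont: "continuous_on UNIV f"
    and le: "\<And>z z'. norm (snd z) \<le> 1 \<Longrightarrow> norm (snd z') \<le> 1 \<Longrightarrow>
      \<bar>f (z, z')\<bar> \<le> C * (1 + norm (fst z) ^ 4 + norm (fst z') ^ 4)"
  shows "integrable (\<pi> \<Otimes>\<^sub>M \<pi>) f"
proof -
  interpret P: pair_prob_space \<pi> \<pi> by standard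
  have meas: "g \<in> borel_measurable (\<pi> \<Otimes>\<^sub>M \<pi>)" if "continuous_on UNIV g" for g :: "('a \<times> 'b) \<times> ('a \<times> 'b) \<Rightarrow> real"
  proof -
    have *: "sets (\<pi> \<Otimes>\<^sub>M \<pi>) = sets (borel :: (('a \<times> 'b) \<times> ('a \<times> 'b)) measure)"
      using sets_pair_measure_cong[OF sets_borel sets_borel] by (simp only: borel_prod)
    then show ?thesis
      using borel_measurable_continuous_onI[OF that] by (simp only: measurable_cong_sets[OF * refl])
  qed
  show ?thesis
  proof (rule Bochner_Integration.integrable_bound)
    show "integrable (\<pi> \<Otimes>\<^sub>M \<pi>) (\<lambda>z. \<bar>C\<bar> * (1 + norm (fst (fst z)) ^ 4 + norm (fst (snd z)) ^ 4))"
    proof (rule P.Fubini_integrable)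
      show "(\<lambda>z. \<bar>C\<bar> * (1 + norm (fst (fst z)) ^ 4 + norm (fst (snd z)) ^ 4)) \<in> borel_measurable (\<pi> \<Otimes>\<^sub>M \<pi>)"
        by (intro meas continuous_intros)
    qed (use int4 in \<open>simp_all add: prob_space\<close>)
    show "f \<in> borel_measurable (\<pi> \<Otimes>\<^sub>M \<pi>)" by (rule meas[OF cont])
    have "AE z in \<pi> \<Otimes>\<^sub>M \<pi>. norm (snd (fst z)) \<le> 1 \<and> norm (snd (snd z)) \<le> 1"
    proof (rule P.AE_pair_measure)
      have "(\<lambda>z :: ('a \<times> 'b) \<times> ('a \<times> 'b). norm (snd (fst z))) \<in> borel_measurable (\<pi> \<Otimes>\<^sub>M \<pi>)"
        "(\<lambda>z :: ('a \<times> 'b) \<times> ('a \<times> 'b). norm (snd (snd z))) \<in> borel_measurable (\<pi> \<Otimes>\<^sub>M \<pi>)"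
        by (intro meas continuous_intros)+
      then show "{z \<in> space (\<pi> \<Otimes>\<^sub>M \<pi>). norm (snd (fst z)) \<le> 1 \<and> norm (snd (snd z)) \<le> 1} \<in> sets (\<pi> \<Otimes>\<^sub>M \<pi>)"
        by measurable
    qed (use snd_le in auto)
    then show "AE z in \<pi> \<Otimes>\<^sub>M \<pi>. norm (f z) \<le> norm (\<bar>C\<bar> * (1 + norm (fst (fst z)) ^ 4 + norm (fst (snd z)) ^ 4))"
    proof eventually_elim
      case (elim z)
      have "\<bar>f z\<bar> \<le> C * (1 + norm (fst (fst z)) ^ 4 + norm (fst (snd z)) ^ 4)"
        using le[of "fst z" "snd z"] elim by simp
      also have "\<dots> \<le> \<bar>C\<bar> * (1 + norm (fst (fst z)) ^ 4 + norm (fst (snd z)) ^ 4)"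
        by (intro mult_right_mono add_nonneg_nonneg) auto
      finally show ?case by simp
    qed
  qed
qed

text \<open>The square is expanded under \<open>\<pi> \<Otimes>\<^sub>M \<pi>\<close>, where each of
  the three terms is integrable by domination with fourth powers. The constant 16 comes from
  \<open>norm (y - y') \<le> 2\<close> and \<open>norm_diff_sq_le\<close>; this crude bound serves
  the samples that admit no finer comparison.\<close>

lemma GW_cost_eq:
  defines "c \<equiv> (\<integral>z. \<integral>z'. norm (fst z - fst z') ^ 4 \<partial>\<pi> \<partial>\<pi>)
      + (\<integral>z. \<integral>z'. norm (snd z - snd z') ^ 4 \<partial>\<pi> \<partial>\<pi>) - 2 * alignment \<pi>"
  shows "GW_cost \<pi> = ennreal c" and "0 \<le> c" and "0 \<le> alignment \<pi>" and "alignment \<pi> \<le> 16 * Ea"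
proof -
  interpret P: pair_prob_space \<pi> \<pi> by standard
  let ?x = "\<lambda>w :: ('a \<times> 'b) \<times> ('a \<times> 'b). norm (fst (fst w) - fst (snd w))"
  let ?y = "\<lambda>w :: ('a \<times> 'b) \<times> ('a \<times> 'b). norm (snd (fst w) - snd (snd w))"
  have y2: "norm (snd z - snd z') \<le> 2" if "norm (snd z) \<le> 1" "norm (snd z') \<le> 1" for z z' :: "'a \<times> 'b"
    using norm_triangle_ineq4[of "snd z" "snd z'"] that by linarith
  have i1: "integrable (\<pi> \<Otimes>\<^sub>M \<pi>) (\<lambda>w. ?x w ^ 4)"
  proof (rule integrable_pair_dominated[where C=8])
    fix z z' :: "'a \<times> 'b"
    show "\<bar>?x (z, z') ^ 4\<bar> \<le> 8 * (1 + norm (fst z) ^ 4 + norm (fst z') ^ 4)"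
      using norm_diff_pow4_le[of "fst z" "fst z'"] by simp
  qed (intro continuous_intros)
  have i2: "integrable (\<pi> \<Otimes>\<^sub>M \<pi>) (\<lambda>w. ?y w ^ 4)"
  proof (rule integrable_pair_dominated[where C=16])
    fix z z' :: "'a \<times> 'b" assume "norm (snd z) \<le> 1" "norm (snd z') \<le> 1"
    then have "?y (z, z') ^ 4 \<le> 2 ^ 4" using y2 by (intro power_mono) auto
    then show "\<bar>?y (z, z') ^ 4\<bar> \<le> 16 * (1 + norm (fst z) ^ 4 + norm (fst z') ^ 4)"
      by (simp add: add_increasing2)
  qed (intro continuous_intros)
  have xy_le: "(?x (z, z'))\<^sup>2 * (?y (z, z'))\<^sup>2 \<le> 8 * (norm (fst z))\<^sup>2 + 8 * (norm (fst z'))\<^sup>2"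
    if "norm (snd z) \<le> 1" "norm (snd z') \<le> 1" for z z' :: "'a \<times> 'b"
  proof -
    have "(?y (z, z'))\<^sup>2 \<le> 2\<^sup>2" using y2[OF that] by (intro power_mono) auto
    then have "(?x (z, z'))\<^sup>2 * (?y (z, z'))\<^sup>2 \<le> (2 * (norm (fst z))\<^sup>2 + 2 * (norm (fst z'))\<^sup>2) * 4"
      using norm_diff_sq_le[of "fst z" "fst z'"] by (intro mult_mono) auto
    then show ?thesis by simp
  qed
  have i3: "integrable (\<pi> \<Otimes>\<^sub>M \<pi>) (\<lambda>w. (?x w)\<^sup>2 * (?y w)\<^sup>2)"
  proof (rule integrable_pair_dominated[where C=16])
    fix z z' :: "'a \<times> 'b" assume le: "norm (snd z) \<le> 1" "norm (snd z') \<le> 1"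
    have "(?x (z, z'))\<^sup>2 * (?y (z, z'))\<^sup>2 \<le> 8 * (norm (fst z))\<^sup>2 + 8 * (norm (fst z'))\<^sup>2"
      by (rule xy_le[OF le])
    also have "\<dots> \<le> 8 * (1 + norm (fst z) ^ 4) + 8 * (1 + norm (fst z') ^ 4)"
      using norm_le_1_plus_sq[of "(norm (fst z))\<^sup>2"] norm_le_1_plus_sq[of "(norm (fst z'))\<^sup>2"]
      by (intro add_mono mult_left_mono) auto
    also have "\<dots> \<le> 16 * (1 + norm (fst z) ^ 4 + norm (fst z') ^ 4)" by simp
    finally show "\<bar>(?x (z, z'))\<^sup>2 * (?y (z, z'))\<^sup>2\<bar> \<le> 16 * (1 + norm (fst z) ^ 4 + norm (fst z') ^ 4)"
      by (simp add: abs_mult)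
  qed (intro continuous_intros)
  have al: "alignment \<pi> = (\<integral>w. (?x w)\<^sup>2 * (?y w)\<^sup>2 \<partial>(\<pi> \<Otimes>\<^sub>M \<pi>))"
    unfolding alignment_def using P.integral_fst'[OF i3] by simp
  have c_eq: "c = (\<integral>w. ?x w ^ 4 + ?y w ^ 4 - 2 * ((?x w)\<^sup>2 * (?y w)\<^sup>2) \<partial>(\<pi> \<Otimes>\<^sub>M \<pi>))"
    unfolding c_def al using i1 i2 i3 P.integral_fst'[OF i1] P.integral_fst'[OF i2] by simp
  have sq: "((?x w)\<^sup>2 - (?y w)\<^sup>2)\<^sup>2 = ?x w ^ 4 + ?y w ^ 4 - 2 * ((?x w)\<^sup>2 * (?y w)\<^sup>2)" for w
    by (simp add: power2_diff power_mult[symmetric])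
  have i4: "integrable (\<pi> \<Otimes>\<^sub>M \<pi>) (\<lambda>w. ((?x w)\<^sup>2 - (?y w)\<^sup>2)\<^sup>2)"
    unfolding sq using i1 i2 i3 by auto
  have "GW_cost \<pi> = (\<integral>\<^sup>+z. \<integral>\<^sup>+z'. ennreal (((?x (z, z'))\<^sup>2 - (?y (z, z'))\<^sup>2)\<^sup>2) \<partial>\<pi> \<partial>\<pi>)"
    unfolding GW_cost_def by (simp add: split_beta')
  also have "\<dots> = (\<integral>\<^sup>+w. ennreal (((?x w)\<^sup>2 - (?y w)\<^sup>2)\<^sup>2) \<partial>(\<pi> \<Otimes>\<^sub>M \<pi>))"
    using i4 by (intro nn_integral_fst) auto
  also have "\<dots> = ennreal c"
    unfolding c_eq sq[symmetric] using i4 by (intro nn_integral_eq_integral) auto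
  finally show "GW_cost \<pi> = ennreal c" .
  show "0 \<le> c" unfolding c_eq sq[symmetric] by simp
  show "0 \<le> alignment \<pi>" unfolding al by simp
  have "(\<integral>z'. (norm (fst z - fst z'))\<^sup>2 * (norm (snd z - snd z'))\<^sup>2 \<partial>\<pi>) \<le> 8 * (norm (fst z))\<^sup>2 + 8 * Ea"
    if z: "norm (snd z) \<le> 1" for z
  proof -
    have "(\<integral>z'. (norm (fst z - fst z'))\<^sup>2 * (norm (snd z - snd z'))\<^sup>2 \<partial>\<pi>)
        \<le> (\<integral>z'. 8 * (norm (fst z))\<^sup>2 + 8 * (norm (fst z'))\<^sup>2 \<partial>\<pi>)"
    proof (rule integral_mono_AE')
      show "AE z' in \<pi>. (norm (fst z - fst z'))\<^sup>2 * (norm (snd z - snd z'))\<^sup>2 \<le> 8 * (norm (fst z))\<^sup>2 + 8 * (norm (fst z'))\<^sup>2"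
        using snd_le by eventually_elim (use xy_le[OF z] in auto)
    qed (use ia in auto)
    also have "\<dots> = 8 * (norm (fst z))\<^sup>2 + 8 * Ea"
      using ia by (simp add: Ea_def prob_space)
    finally show ?thesis .
  qed
  then have "alignment \<pi> \<le> (\<integral>z. 8 * (norm (fst z))\<^sup>2 + 8 * Ea \<partial>\<pi>)"
    unfolding alignment_def using ia snd_le
    by (intro integral_mono_AE') (auto simp: Ea_def elim!: eventually_mono)
  also have "\<dots> = 16 * Ea" using ia by (simp add: Ea_def prob_space)
  finally show "alignment \<pi> \<le> 16 * Ea" .
qed

end

text \<open>Points of \<open>Y\<close> may have mass zero, so the discrete measure and its empirical
  versions share the same \<open>Y\<close>.\<close>

definition supported_in :: "'b::euclidean_space set \<Rightarrow> 'b measure \<Rightarrow> bool" where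
  "supported_in Y \<nu> \<longleftrightarrow> sets \<nu> = sets borel \<and> prob_space \<nu> \<and> finite Y \<and> Y \<subseteq> cball 0 1 \<and> (AE y in \<nu>. y \<in> Y)"

definition finite_fourth_moment :: "'a::euclidean_space measure \<Rightarrow> bool" where
  "finite_fourth_moment \<mu> \<longleftrightarrow> sets \<mu> = sets borel \<and> prob_space \<mu> \<and> integrable \<mu> (\<lambda>x. norm x ^ 4)"

lemma finite_fourth_momentD:
  assumes "finite_fourth_moment \<mu>"
  shows "prob_space \<mu>" and "sets \<mu> = sets borel" and "integrable \<mu> (\<lambda>x. norm x ^ 4)"
    and "integrable \<mu> (\<lambda>x. (norm x)\<^sup>2)" and "integrable \<mu> norm" and "integrable \<mu> (\<lambda>x. x)"
proof -
  show p: "prob_space \<mu>" and s[measurable_cong]: "sets \<mu> = sets borel" and i: "integrable \<mu> (\<lambda>x. norm x ^ 4)"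
    using assms by (auto simp: finite_fourth_moment_def)
  interpret prob_space \<mu> by (rule p)
  show a: "integrable \<mu> (\<lambda>x. (norm x)\<^sup>2)"
  proof (rule Bochner_Integration.integrable_bound[of _ "\<lambda>x. 1 + norm x ^ 4"])
    show "AE x in \<mu>. norm ((norm x)\<^sup>2) \<le> norm (1 + norm x ^ 4)"
      using norm_le_1_plus_sq[of "(norm x)\<^sup>2" for x :: 'a] by (intro AE_I2) simp
  qed (use i in auto)
  show b: "integrable \<mu> norm"
    by (rule Bochner_Integration.integrable_bound[of _ "\<lambda>x. 1 + (norm x)\<^sup>2"])
       (use a in \<open>auto intro!: AE_I2 norm_le_1_plus_sq\<close>)
  show "integrable \<mu> (\<lambda>x. x)"
    by (rule Bochner_Integration.integrable_bound[OF b]) auto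
qed

lemma emeasure_supported_in:
  assumes "supported_in Y \<nu>" "B \<in> sets borel"
  shows "emeasure \<nu> B = (\<Sum>v\<in>Y. ennreal (measure \<nu> {v}) * indicator B v)"
proof -
  from assms interpret prob_space \<nu> by (simp add: supported_in_def)
  have [simp]: "sets \<nu> = sets borel" and Y: "finite Y" and AE: "AE y in \<nu>. y \<in> Y"
    using assms by (auto simp: supported_in_def)
  have "emeasure \<nu> B = emeasure \<nu> (B \<inter> Y)"
    using AE assms Y by (intro emeasure_eq_AE) (auto intro!: sets.Int borel_closed finite_imp_closed)
  also have "\<dots> = (\<Sum>v\<in>B \<inter> Y. emeasure \<nu> {v})"
    using Y by (intro emeasure_eq_sum_singleton) auto
  also have "\<dots> = (\<Sum>v\<in>Y. ennreal (measure \<nu> {v}) * indicator B v)"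
    using Y by (intro sum.mono_neutral_cong_left) (auto simp: emeasure_eq_measure indicator_def split: if_splits)
  finally show ?thesis .
qed

lemma integral_supported_in:
  fixes f :: "'b::euclidean_space \<Rightarrow> 'c::{banach, second_countable_topology}"
  assumes "supported_in Y \<nu>" and f: "f \<in> borel_measurable borel"
  shows "integral\<^sup>L \<nu> f = (\<Sum>v\<in>Y. measure \<nu> {v} *\<^sub>R f v)" and "integrable \<nu> f"
proof -
  from assms interpret prob_space \<nu> by (simp add: supported_in_def)
  have S[simp, measurable_cong]: "sets \<nu> = sets borel" and Y: "finite Y" and AE: "AE y in \<nu>. y \<in> Y"
    using assms by (auto simp: supported_in_def)
  note [measurable] = f
  let ?g = "\<lambda>y. \<Sum>v\<in>Y. indicator {v} y *\<^sub>R f v"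
  have eq: "AE y in \<nu>. f y = ?g y"
    using AE
  proof eventually_elim
    case (elim y)
    have "?g y = (\<Sum>v\<in>Y. if v = y then f y else 0)" by (intro sum.cong) auto
    then show ?case using elim Y by simp
  qed
  have ig: "integrable \<nu> (\<lambda>y. indicator {v} y *\<^sub>R f v)" for v
    by (intro integrable_scaleR_left integrable_real_indicator) (auto simp: emeasure_eq_measure)
  have "integral\<^sup>L \<nu> f = integral\<^sup>L \<nu> ?g"
    using eq by (intro integral_cong_AE) auto
  also have "\<dots> = (\<Sum>v\<in>Y. measure \<nu> {v} *\<^sub>R f v)"
  proof (subst Bochner_Integration.integral_sum)
    have "(\<integral>y. indicator {v} y *\<^sub>R f v \<partial>\<nu>) = measure \<nu> {v} *\<^sub>R f v" for v
      by (subst integral_scaleR_left) (auto simp: emeasure_eq_measure)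
    then show "(\<Sum>v\<in>Y. \<integral>y. indicator {v} y *\<^sub>R f v \<partial>\<nu>) = (\<Sum>v\<in>Y. measure \<nu> {v} *\<^sub>R f v)" by simp
  qed (rule ig)
  finally show "integral\<^sup>L \<nu> f = (\<Sum>v\<in>Y. measure \<nu> {v} *\<^sub>R f v)" .
  have "integrable \<nu> ?g" using ig by auto
  then show "integrable \<nu> f"
    using eq by (subst integrable_cong_AE) auto
qed

lemma sum_measure_supported_in:
  assumes "supported_in Y \<nu>"
  shows "(\<Sum>v\<in>Y. measure \<nu> {v}) = 1"
proof -
  from assms interpret prob_space \<nu> by (simp add: supported_in_def)
  show ?thesis using integral_supported_in(1)[OF assms, of "\<lambda>_. 1 :: real"] by (simp add: prob_space)
qed

section \<open>Couplings with a finitely supported marginal\<close>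

lemma coupling_integral:
  fixes f :: "'a::euclidean_space \<Rightarrow> 'c::{banach, second_countable_topology}"
    and g :: "'b::euclidean_space \<Rightarrow> 'd::{banach, second_countable_topology}"
  assumes "\<pi> \<in> couplings \<mu> \<nu>"
  shows "f \<in> borel_measurable borel \<Longrightarrow> (\<integral>z. f (fst z) \<partial>\<pi>) = integral\<^sup>L \<mu> f"
    and "f \<in> borel_measurable borel \<Longrightarrow> integrable \<pi> (\<lambda>z. f (fst z)) \<longleftrightarrow> integrable \<mu> f"
    and "g \<in> borel_measurable borel \<Longrightarrow> (\<integral>z. g (snd z) \<partial>\<pi>) = integral\<^sup>L \<nu> g"
    and "g \<in> borel_measurable borel \<Longrightarrow> integrable \<pi> (\<lambda>z. g (snd z)) \<longleftrightarrow> integrable \<nu> g"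
proof -
  have \<pi>: "sets \<pi> = sets (borel :: ('a \<times> 'b) measure)" "\<mu> = distr \<pi> borel fst" "\<nu> = distr \<pi> borel snd"
    using assms by (auto simp: couplings_def)
  have m: "fst \<in> \<pi> \<rightarrow>\<^sub>M borel" "snd \<in> \<pi> \<rightarrow>\<^sub>M borel"
    unfolding measurable_cong_sets[OF \<pi>(1) refl]
    by (auto intro!: borel_measurable_continuous_onI continuous_intros)
  show "f \<in> borel_measurable borel \<Longrightarrow> (\<integral>z. f (fst z) \<partial>\<pi>) = integral\<^sup>L \<mu> f"
    and "f \<in> borel_measurable borel \<Longrightarrow> integrable \<pi> (\<lambda>z. f (fst z)) \<longleftrightarrow> integrable \<mu> f"
    unfolding \<pi>(2) using m by (auto simp: integral_distr integrable_distr_eq)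
  show "g \<in> borel_measurable borel \<Longrightarrow> (\<integral>z. g (snd z) \<partial>\<pi>) = integral\<^sup>L \<nu> g"
    and "g \<in> borel_measurable borel \<Longrightarrow> integrable \<pi> (\<lambda>z. g (snd z)) \<longleftrightarrow> integrable \<nu> g"
    unfolding \<pi>(3) using m by (auto simp: integral_distr integrable_distr_eq)
qed

lemma coupling_AE_snd:
  fixes \<mu> :: "'a::euclidean_space measure"
  assumes "\<pi> \<in> couplings \<mu> \<nu>" "supported_in Y \<nu>"
  shows "AE z in \<pi>. snd z \<in> Y"
proof -
  have \<pi>: "sets \<pi> = sets (borel :: ('a \<times> 'b) measure)" "\<nu> = distr \<pi> borel snd"
    using assms by (auto simp: couplings_def)
  have m: "snd \<in> \<pi> \<rightarrow>\<^sub>M borel"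
    unfolding measurable_cong_sets[OF \<pi>(1) refl]
    by (auto intro!: borel_measurable_continuous_onI continuous_intros)
  have "AE y in distr \<pi> borel snd. y \<in> Y" "finite Y"
    using assms \<pi>(2) by (auto simp: supported_in_def)
  then show ?thesis using AE_distrD[OF m] by blast
qed

lemma unit_ball_couplingI:
  assumes "\<pi> \<in> couplings \<mu> \<nu>" "finite_fourth_moment \<mu>" "supported_in Y \<nu>"
  shows "unit_ball_coupling \<pi>"
proof -
  have "prob_space \<pi>" "sets \<pi> = sets borel" using assms by (auto simp: couplings_def)
  moreover have "AE z in \<pi>. norm (snd z) \<le> 1"
    using coupling_AE_snd[OF assms(1,3)] by eventually_elim (use assms in \<open>auto simp: supported_in_def\<close>)
  moreover have "integrable \<pi> (\<lambda>z. norm (fst z) ^ 4)"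
    using coupling_integral(2)[OF assms(1), of "\<lambda>x. norm x ^ 4"] assms(2) by (auto simp: finite_fourth_moment_def)
  ultimately show ?thesis by (simp add: unit_ball_coupling_def unit_ball_coupling_axioms_def)
qed

lemma pair_measure_in_couplings:
  fixes \<mu> :: "'a::euclidean_space measure" and \<nu> :: "'b::euclidean_space measure"
  assumes "prob_space \<mu>" "sets \<mu> = sets borel" "prob_space \<nu>" "sets \<nu> = sets borel"
  shows "\<mu> \<Otimes>\<^sub>M \<nu> \<in> couplings \<mu> \<nu>"
proof -
  interpret M: prob_space \<mu> by fact
  interpret N: prob_space \<nu> by fact
  interpret P: pair_prob_space \<mu> \<nu> by standard
  have s: "sets (\<mu> \<Otimes>\<^sub>M \<nu>) = sets (borel :: ('a \<times> 'b) measure)"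
    using sets_pair_measure_cong[OF assms(2,4)] by (simp only: borel_prod)
  have "distr (\<mu> \<Otimes>\<^sub>M \<nu>) borel fst = distr (\<mu> \<Otimes>\<^sub>M \<nu>) \<mu> fst"
    using assms by (intro distr_cong) auto
  also have "\<dots> = \<mu>" by (rule N.distr_pair_fst)
  finally have 1: "distr (\<mu> \<Otimes>\<^sub>M \<nu>) borel fst = \<mu>" .
  have "distr (\<mu> \<Otimes>\<^sub>M \<nu>) borel snd = \<nu>"
  proof (rule measure_eqI)
    fix B assume "B \<in> sets (distr (\<mu> \<Otimes>\<^sub>M \<nu>) borel snd)"
    then have B: "B \<in> sets \<nu>" using assms by simp
    have "emeasure (distr (\<mu> \<Otimes>\<^sub>M \<nu>) borel snd) B = emeasure (\<mu> \<Otimes>\<^sub>M \<nu>) (space \<mu> \<times> B)"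
    proof (subst emeasure_distr)
      show "snd \<in> \<mu> \<Otimes>\<^sub>M \<nu> \<rightarrow>\<^sub>M borel" using assms by (simp add: measurable_cong_sets[OF refl assms(4)[symmetric]])
      show "emeasure (\<mu> \<Otimes>\<^sub>M \<nu>) (snd -` B \<inter> space (\<mu> \<Otimes>\<^sub>M \<nu>)) = emeasure (\<mu> \<Otimes>\<^sub>M \<nu>) (space \<mu> \<times> B)"
        using sets.sets_into_space[OF B] by (auto simp: space_pair_measure intro!: arg_cong[where f="emeasure _"])
    qed (use B assms in auto)
    also have "\<dots> = emeasure \<nu> B"
      using B by (simp add: N.emeasure_pair_measure_Times M.emeasure_space_1)
    finally show "emeasure (distr (\<mu> \<Otimes>\<^sub>M \<nu>) borel snd) B = emeasure \<nu> B" .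
  qed (use assms in simp)
  with 1 s show ?thesis by (simp add: couplings_def P.prob_space_axioms)
qed

text \<open>The energies depend on the marginals only, so minimising the cost is maximising the
  alignment. A coupling within \<open>e\<close> of the infimum is enough and avoids compactness of
  the set of couplings.\<close>

lemma GW_sq_alignment:
  assumes "finite_fourth_moment \<mu>" "supported_in Y \<nu>"
  shows "\<pi> \<in> couplings \<mu> \<nu> \<Longrightarrow> GW_sq \<mu> \<nu> \<le> fourth_power_energy \<mu> + fourth_power_energy \<nu> - 2 * alignment \<pi>"
    and "0 < e \<Longrightarrow> \<exists>\<pi>\<in>couplings \<mu> \<nu>. fourth_power_energy \<mu> + fourth_power_energy \<nu> - 2 * alignment \<pi> \<le> GW_sq \<mu> \<nu> + e"
proof -
  define c where "c \<pi> = fourth_power_energy \<mu> + fourth_power_energy \<nu> - 2 * alignment \<pi>" for \<pi> :: "('a \<times> 'b) measure"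
  have cost: "GW_cost \<pi> = ennreal (c \<pi>)" "0 \<le> c \<pi>" if \<pi>: "\<pi> \<in> couplings \<mu> \<nu>" for \<pi>
  proof -
    interpret unit_ball_coupling \<pi> by (rule unit_ball_couplingI[OF \<pi> assms])
    have meas: "(\<lambda>x. norm (z - x) ^ 4) \<in> borel_measurable borel" for z :: "'c::euclidean_space"
      by measurable
    have S: "sets \<mu> = sets borel" "sets \<nu> = sets borel" "prob_space \<mu>" "prob_space \<nu>"
      using assms by (auto simp: finite_fourth_moment_def supported_in_def)
    interpret M: prob_space \<mu> by fact
    interpret N: prob_space \<nu> by fact
    note [measurable_cong] = S(1,2)
    have m: "(\<lambda>z. \<integral>x. norm (z - x) ^ 4 \<partial>\<mu>) \<in> borel_measurable borel"
      "(\<lambda>z. \<integral>x. norm (z - x) ^ 4 \<partial>\<nu>) \<in> borel_measurable borel"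
      by measurable
    have "(\<integral>z. \<integral>z'. norm (fst z - fst z') ^ 4 \<partial>\<pi> \<partial>\<pi>) = fourth_power_energy \<mu>"
      unfolding fourth_power_energy_def
      by (simp only: coupling_integral(1)[OF \<pi> meas] coupling_integral(1)[OF \<pi> m(1)])
    moreover have "(\<integral>z. \<integral>z'. norm (snd z - snd z') ^ 4 \<partial>\<pi> \<partial>\<pi>) = fourth_power_energy \<nu>"
      unfolding fourth_power_energy_def
      by (simp only: coupling_integral(3)[OF \<pi> meas] coupling_integral(3)[OF \<pi> m(2)])
    ultimately show "GW_cost \<pi> = ennreal (c \<pi>)" "0 \<le> c \<pi>"
      using GW_cost_eq(1,2) by (auto simp: c_def)
  qed
  define I where "I = (INF \<pi>\<in>couplings \<mu> \<nu>. GW_cost \<pi>)"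
  have GW: "GW_sq \<mu> \<nu> = enn2real I" by (simp add: GW_sq_def I_def)
  have I_le: "I \<le> ennreal (c \<pi>)" if "\<pi> \<in> couplings \<mu> \<nu>" for \<pi>
    unfolding I_def cost(1)[OF that, symmetric] using that by (rule INF_lower)
  show "GW_sq \<mu> \<nu> \<le> c \<pi>" if "\<pi> \<in> couplings \<mu> \<nu>" for \<pi>
    unfolding GW using enn2real_mono[OF I_le[OF that]] cost(2)[OF that] by simp
  \<comment> \<open>The product coupling has finite cost, so \<open>enn2real\<close> does not alter
    the infimum.\<close>
  have "\<mu> \<Otimes>\<^sub>M \<nu> \<in> couplings \<mu> \<nu>"
    using assms by (intro pair_measure_in_couplings) (auto simp: finite_fourth_moment_def supported_in_def)
  then have fin: "I < \<top>" using I_le by (metis ennreal_less_top le_less_trans)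
  show "\<exists>\<pi>\<in>couplings \<mu> \<nu>. c \<pi> \<le> GW_sq \<mu> \<nu> + e" if "0 < e"
  proof -
    have "I = ennreal (enn2real I)" using fin by simp
    also have "\<dots> < ennreal (enn2real I + e)" using that by (intro ennreal_lessI add_nonneg_pos) auto
    finally have "I < ennreal (enn2real I + e)" .
    then obtain \<pi> where \<pi>: "\<pi> \<in> couplings \<mu> \<nu>" "GW_cost \<pi> < ennreal (enn2real I + e)"
      unfolding I_def INF_less_iff by auto
    then have "c \<pi> < enn2real I + e"
      using cost[OF \<pi>(1)] by (simp add: ennreal_less_iff)
    then show ?thesis using \<pi>(1) GW by (intro bexI[of _ \<pi>]) auto
  qed
qed

text \<open>From the disintegration back to a measure: \<open>p\<close> is a density with respect to
  counting measure on \<open>Y\<close> times \<mu>, pushed forward by swapping the coordinates. With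
  the discrete factor first, measurability is checked atom by atom and the outer integral is a
  finite sum.\<close>

lemma selection_coupling:
  fixes \<mu> :: "'a::euclidean_space measure" and \<nu> :: "'b::euclidean_space measure"
  assumes \<mu>: "prob_space \<mu>" "sets \<mu> = sets borel" and \<nu>: "supported_in Y \<nu>"
    and p: "p \<in> simplex_selections \<mu> Y" and marg: "\<And>v. v \<in> Y \<Longrightarrow> (\<integral>x. p v x \<partial>\<mu>) = measure \<nu> {v}"
  obtains \<pi> where "\<pi> \<in> couplings \<mu> \<nu>"
    "\<And>h :: 'a \<times> 'b \<Rightarrow> real. h \<in> borel_measurable borel \<Longrightarrow> integrable \<pi> h \<Longrightarrow>
      integral\<^sup>L \<pi> h = (\<Sum>v\<in>Y. \<integral>x. p v x * h (x, v) \<partial>\<mu>)"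
proof
  interpret M: prob_space \<mu> by fact
  have Y: "finite Y" using \<nu> by (simp add: supported_in_def)
  note [measurable_cong] = \<mu>(2)
  interpret C: sigma_finite_measure "count_space Y" using Y by (rule sigma_finite_measure_count_space_finite)
  interpret P: pair_sigma_finite "count_space Y" \<mu> by standard
  define q where "q w = p (fst w) (snd w)" for w :: "'b \<times> 'a"
  define s where "s w = (snd w, fst w)" for w :: "'b \<times> 'a"
  define D where "D = density (count_space Y \<Otimes>\<^sub>M \<mu>) (\<lambda>w. ennreal (q w))"
  define \<pi> where "\<pi> = distr D borel s"
  have p_meas[measurable]: "p v \<in> borel_measurable \<mu>" and p0: "0 \<le> p v x" if "v \<in> Y" for v x
    using p that by (auto simp: simplex_selections_def)
  have q_meas[measurable]: "q \<in> borel_measurable (count_space Y \<Otimes>\<^sub>M \<mu>)"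
    using Y by (intro measurable_pair_measure_countable1) (auto simp: q_def intro: countable_finite)
  have s_meas[measurable]: "s \<in> count_space Y \<Otimes>\<^sub>M \<mu> \<rightarrow>\<^sub>M borel"
  proof -
    have "(\<lambda>w. (snd w, fst w)) \<in> count_space Y \<Otimes>\<^sub>M \<mu> \<rightarrow>\<^sub>M (borel :: 'a measure) \<Otimes>\<^sub>M (borel :: 'b measure)"
    proof (rule measurable_Pair)
      show "snd \<in> count_space Y \<Otimes>\<^sub>M \<mu> \<rightarrow>\<^sub>M (borel :: 'a measure)"
        using measurable_snd[of "count_space Y" \<mu>] by (simp only: measurable_cong_sets[OF refl \<mu>(2)])
      show "fst \<in> count_space Y \<Otimes>\<^sub>M \<mu> \<rightarrow>\<^sub>M (borel :: 'b measure)"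
        by (rule measurable_compose[OF measurable_fst]) simp
    qed
    then show ?thesis by (simp only: borel_prod s_def[abs_def])
  qed
  have q0: "AE w in count_space Y \<Otimes>\<^sub>M \<mu>. 0 \<le> q w"
    using p0 by (intro AE_I2) (auto simp: q_def space_pair_measure)
  have sD: "s \<in> D \<rightarrow>\<^sub>M borel" unfolding D_def by simp
  have nn: "(\<integral>\<^sup>+z. F z \<partial>\<pi>) = (\<Sum>v\<in>Y. \<integral>\<^sup>+x. ennreal (p v x) * F (x, v) \<partial>\<mu>)"
    if [measurable]: "F \<in> borel_measurable borel" for F
  proof -
    have "(\<integral>\<^sup>+z. F z \<partial>\<pi>) = (\<integral>\<^sup>+w. F (s w) \<partial>D)"
      unfolding \<pi>_def using sD by (intro nn_integral_distr) auto
    also have "\<dots> = (\<integral>\<^sup>+w. ennreal (q w) * F (s w) \<partial>(count_space Y \<Otimes>\<^sub>M \<mu>))"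
      unfolding D_def by (intro nn_integral_density) auto
    also have "\<dots> = (\<integral>\<^sup>+v. \<integral>\<^sup>+x. ennreal (q (v, x)) * F (s (v, x)) \<partial>\<mu> \<partial>count_space Y)"
      by (intro M.nn_integral_fst[symmetric]) auto
    also have "\<dots> = (\<Sum>v\<in>Y. \<integral>\<^sup>+x. ennreal (p v x) * F (x, v) \<partial>\<mu>)"
      using Y by (simp add: nn_integral_count_space_finite q_def s_def)
    finally show ?thesis .
  qed
  have sets: "sets \<pi> = sets borel" by (simp add: \<pi>_def)
  have em_fst: "emeasure \<pi> (A \<times> UNIV) = emeasure \<mu> A" if [measurable]: "A \<in> sets borel" for A
  proof -
    have [measurable]: "A \<times> (UNIV :: 'b set) \<in> sets borel" by (intro borel_Times) auto
    have "emeasure \<pi> (A \<times> UNIV) = (\<integral>\<^sup>+z. indicator (A \<times> UNIV) z \<partial>\<pi>)" by (simp add: sets)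
    also have "\<dots> = (\<Sum>v\<in>Y. \<integral>\<^sup>+x. ennreal (p v x) * indicator (A \<times> UNIV) (x, v) \<partial>\<mu>)" by (rule nn) auto
    also have "\<dots> = (\<integral>\<^sup>+x. (\<Sum>v\<in>Y. ennreal (p v x) * indicator A x) \<partial>\<mu>)"
      by (subst nn_integral_sum) (auto simp: indicator_def intro!: sum.cong)
    also have "\<dots> = (\<integral>\<^sup>+x. indicator A x \<partial>\<mu>)"
    proof (intro nn_integral_cong)
      fix x
      have "(\<Sum>v\<in>Y. ennreal (p v x) * indicator A x) = (\<Sum>v\<in>Y. ennreal (p v x)) * indicator A x"
        by (simp only: sum_distrib_right)
      also have "(\<Sum>v\<in>Y. ennreal (p v x)) = ennreal (\<Sum>v\<in>Y. p v x)" using p0 by (subst sum_ennreal) auto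
      also have "(\<Sum>v\<in>Y. p v x) = 1" using p by (simp add: simplex_selections_def)
      finally show "(\<Sum>v\<in>Y. ennreal (p v x) * indicator A x) = indicator A x" by simp
    qed
    also have "\<dots> = emeasure \<mu> A" by (simp add: \<mu>)
    finally show ?thesis .
  qed
  have em_snd: "emeasure \<pi> (UNIV \<times> B) = emeasure \<nu> B" if B[measurable]: "B \<in> sets borel" for B
  proof -
    have [measurable]: "(UNIV :: 'a set) \<times> B \<in> sets borel" by (intro borel_Times) auto
    have "emeasure \<pi> (UNIV \<times> B) = (\<integral>\<^sup>+z. indicator (UNIV \<times> B) z \<partial>\<pi>)" by (simp add: sets)
    also have "\<dots> = (\<Sum>v\<in>Y. \<integral>\<^sup>+x. ennreal (p v x) * indicator (UNIV \<times> B) (x, v) \<partial>\<mu>)" by (rule nn) auto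
    also have "\<dots> = (\<Sum>v\<in>Y. ennreal (measure \<nu> {v}) * indicator B v)"
    proof (rule sum.cong[OF refl])
      fix v assume v: "v \<in> Y"
      have "(\<integral>\<^sup>+x. ennreal (p v x) * indicator (UNIV \<times> B) (x, v) \<partial>\<mu>) = (\<integral>\<^sup>+x. ennreal (p v x) * indicator B v \<partial>\<mu>)"
        by (intro nn_integral_cong) (auto simp: indicator_def)
      also have "\<dots> = (\<integral>\<^sup>+x. ennreal (p v x) \<partial>\<mu>) * indicator B v"
        using v by (intro nn_integral_multc) auto
      also have "(\<integral>\<^sup>+x. ennreal (p v x) \<partial>\<mu>) = ennreal (\<integral>x. p v x \<partial>\<mu>)"
        using integrable_simplex_selection[OF \<mu>(1) p Y v] p0[OF v] by (intro nn_integral_eq_integral) auto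
      finally show "(\<integral>\<^sup>+x. ennreal (p v x) * indicator (UNIV \<times> B) (x, v) \<partial>\<mu>) = ennreal (measure \<nu> {v}) * indicator B v"
        by (simp add: marg[OF v])
    qed
    also have "\<dots> = emeasure \<nu> B" by (rule emeasure_supported_in[OF \<nu> B, symmetric])
    finally show ?thesis .
  qed
  have m: "fst \<in> \<pi> \<rightarrow>\<^sub>M borel" "snd \<in> \<pi> \<rightarrow>\<^sub>M borel"
    unfolding measurable_cong_sets[OF sets refl]
    by (auto intro!: borel_measurable_continuous_onI continuous_intros)
  have sp: "space \<pi> = UNIV" by (simp add: \<pi>_def)
  have "space \<mu> = UNIV" using \<mu>(2) sets_eq_imp_space_eq[of \<mu> borel] by simp
  then have "prob_space \<pi>"
    using em_fst[of UNIV] M.emeasure_space_1 by (intro prob_spaceI) (simp add: sp)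
  moreover have "distr \<pi> borel fst = \<mu>"
  proof (rule measure_eqI)
    fix A assume "A \<in> sets (distr \<pi> borel fst)"
    moreover have "fst -` A = A \<times> (UNIV :: 'b set)" by auto
    ultimately show "emeasure (distr \<pi> borel fst) A = emeasure \<mu> A"
      using em_fst[of A] m by (simp add: emeasure_distr sp)
  qed (use \<mu> in simp)
  moreover have "distr \<pi> borel snd = \<nu>"
  proof (rule measure_eqI)
    fix B assume "B \<in> sets (distr \<pi> borel snd)"
    moreover have "snd -` B = (UNIV :: 'a set) \<times> B" by auto
    ultimately show "emeasure (distr \<pi> borel snd) B = emeasure \<nu> B"
      using em_snd[of B] m by (simp add: emeasure_distr sp)
  qed (use \<nu> in \<open>simp add: supported_in_def\<close>)
  ultimately show "\<pi> \<in> couplings \<mu> \<nu>" using sets by (simp add: couplings_def)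
  fix h :: "'a \<times> 'b \<Rightarrow> real" assume h[measurable]: "h \<in> borel_measurable borel" and int: "integrable \<pi> h"
  have hs: "(\<lambda>w. h (s w)) \<in> borel_measurable (count_space Y \<Otimes>\<^sub>M \<mu>)" by measurable
  have "integrable D (\<lambda>w. h (s w))"
    using int sD unfolding \<pi>_def by (subst (asm) integrable_distr_eq) auto
  then have i: "integrable (count_space Y \<Otimes>\<^sub>M \<mu>) (\<lambda>w. q w *\<^sub>R h (s w))"
    unfolding D_def using integrable_density[OF hs q_meas q0] by simp
  have "integral\<^sup>L \<pi> h = (\<integral>w. h (s w) \<partial>D)"
    unfolding \<pi>_def using sD by (intro integral_distr) auto
  also have "\<dots> = (\<integral>w. q w *\<^sub>R h (s w) \<partial>(count_space Y \<Otimes>\<^sub>M \<mu>))"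
    unfolding D_def by (rule integral_density[OF hs q_meas q0])
  also have "\<dots> = (\<integral>v. \<integral>x. q (v, x) *\<^sub>R h (s (v, x)) \<partial>\<mu> \<partial>count_space Y)"
    by (rule P.integral_fst'[OF i, symmetric])
  also have "\<dots> = (\<Sum>v\<in>Y. \<integral>x. p v x * h (x, v) \<partial>\<mu>)"
    using Y by (simp add: lebesgue_integral_count_space_finite q_def s_def)
  finally show "integral\<^sup>L \<pi> h = (\<Sum>v\<in>Y. \<integral>x. p v x * h (x, v) \<partial>\<mu>)" .
qed

section \<open>Stability in the marginals\<close>

context unit_ball_coupling
begin

text \<open>The Frobenius pairing of the cross moment matrix with the matrix with columns
  \<open>c k\<close>. Taking for \<open>c\<close> the map \<open>L\<close> of the same or of another
  coupling expresses the quadratic parts as sums of inner products.\<close>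

lemma integral_bilinear:
  "(\<integral>z. fst z \<bullet> (\<Sum>k\<in>Basis. (snd z \<bullet> k) *\<^sub>R c k) \<partial>\<pi>) = (\<Sum>k\<in>Basis. L k \<bullet> c k)"
  "integrable \<pi> (\<lambda>z. fst z \<bullet> (\<Sum>k\<in>Basis. (snd z \<bullet> k) *\<^sub>R c k))"
proof -
  have eq: "fst z \<bullet> (\<Sum>k\<in>Basis. (snd z \<bullet> k) *\<^sub>R c k) = (\<Sum>k\<in>Basis. ((k \<bullet> snd z) *\<^sub>R fst z) \<bullet> c k)" for z :: "'a \<times> 'b"
    by (simp add: inner_sum_right inner_commute)
  have i: "integrable \<pi> (\<lambda>z. ((k \<bullet> snd z) *\<^sub>R fst z) \<bullet> c k)" for k
    using ixy by (intro integrable_inner_left)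
  show "(\<integral>z. fst z \<bullet> (\<Sum>k\<in>Basis. (snd z \<bullet> k) *\<^sub>R c k) \<partial>\<pi>) = (\<Sum>k\<in>Basis. L k \<bullet> c k)"
    unfolding eq L_def by (subst Bochner_Integration.integral_sum[OF i]) (intro sum.cong refl integral_inner_left ixy)
  show "integrable \<pi> (\<lambda>z. fst z \<bullet> (\<Sum>k\<in>Basis. (snd z \<bullet> k) *\<^sub>R c k))"
    unfolding eq by (intro Bochner_Integration.integrable_sum i)
qed

lemma moment_bounds:
  shows norm_Eay: "norm Eay \<le> Ea" and norm_Ebx: "norm Ebx \<le> (\<integral>z. norm (fst z) \<partial>\<pi>)"
    and norm_mean_x: "norm mean_x \<le> (\<integral>z. norm (fst z) \<partial>\<pi>)" and norm_mean_y: "norm mean_y \<le> 1"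
    and Ea_nonneg: "0 \<le> Ea" and Eb_nonneg: "0 \<le> Eb" and Eb_le: "Eb \<le> 1"
proof -
  have sq: "norm y \<le> 1 \<Longrightarrow> (norm y)\<^sup>2 \<le> 1" for y :: 'b by (simp add: power_le_one)
  show "norm Eay \<le> Ea"
    unfolding Eay_def Ea_def
  proof (rule order_trans[OF integral_norm_bound], rule integral_mono_AE)
    show "AE z in \<pi>. norm ((norm (fst z))\<^sup>2 *\<^sub>R snd z) \<le> (norm (fst z))\<^sup>2"
      using snd_le by eventually_elim (simp add: mult_left_le)
  qed (intro integrable_norm iay ia)+
  show "norm Ebx \<le> (\<integral>z. norm (fst z) \<partial>\<pi>)"
    unfolding Ebx_def
  proof (rule order_trans[OF integral_norm_bound], rule integral_mono_AE)
    show "AE z in \<pi>. norm ((norm (snd z))\<^sup>2 *\<^sub>R fst z) \<le> norm (fst z)"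
      using snd_le by eventually_elim (simp add: mult_left_le_one_le sq)
  qed (intro integrable_norm ibx ix)+
  show "norm mean_x \<le> (\<integral>z. norm (fst z) \<partial>\<pi>)"
    unfolding mean_x_def by (rule integral_norm_bound)
  have "norm mean_y \<le> (\<integral>z. norm (snd z) \<partial>\<pi>)"
    unfolding mean_y_def by (rule integral_norm_bound)
  also have "\<dots> \<le> (\<integral>z. 1 \<partial>\<pi>)"
    using snd_le iy by (intro integral_mono_AE) auto
  finally show "norm mean_y \<le> 1" by (simp add: prob_space)
  have "Eb \<le> (\<integral>z. 1 \<partial>\<pi>)"
    unfolding Eb_def using snd_le ib by (intro integral_mono_AE) (auto simp: sq elim!: eventually_mono)
  then show "Eb \<le> 1" by (simp add: prob_space)
qed (auto simp: Ea_def Eb_def)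

end

text \<open>For fixed marginals \<open>alignment\<close> is convex in the coupling, the quadratic part being
  \<open>\<parallel>\<integral> x y\<^sup>T \<partial>\<pi>\<parallel>\<^sup>2\<close>; \<open>alignment_slope \<pi>\<close> is its linearisation at \<open>\<pi>\<close>.\<close>

definition alignment_slope :: "('a::euclidean_space \<times> 'b::euclidean_space) measure \<Rightarrow> 'b \<Rightarrow> 'a \<Rightarrow> real" where
  "alignment_slope \<pi> v x = (norm x)\<^sup>2 * (2 * (norm v)\<^sup>2 - 4 * (v \<bullet> unit_ball_coupling.mean_y \<pi>))
     + x \<bullet> (8 *\<^sub>R unit_ball_coupling.L \<pi> v - (4 * (norm v)\<^sup>2) *\<^sub>R unit_ball_coupling.mean_x \<pi>)"

lemma alignment_diff_le:
  fixes \<pi>1 \<pi>2 :: "('a::euclidean_space \<times> 'b::euclidean_space) measure"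
  assumes "unit_ball_coupling \<pi>1" "unit_ball_coupling \<pi>2"
  defines "h \<equiv> \<lambda>z. alignment_slope \<pi>1 (snd z) (fst z)"
  shows "alignment \<pi>1 - alignment \<pi>2 \<le> (\<integral>z. h z \<partial>\<pi>1) - (\<integral>z. h z \<partial>\<pi>2)
      + 2 * (unit_ball_coupling.Ea \<pi>1 * unit_ball_coupling.Eb \<pi>1 - unit_ball_coupling.Ea \<pi>2 * unit_ball_coupling.Eb \<pi>2)
      + 4 * (unit_ball_coupling.Ea \<pi>2 * norm (unit_ball_coupling.mean_y \<pi>2 - unit_ball_coupling.mean_y \<pi>1))
      + 4 * ((\<integral>z. norm (fst z) \<partial>\<pi>2) * norm (unit_ball_coupling.mean_x \<pi>2 - unit_ball_coupling.mean_x \<pi>1))"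
    and "integrable \<pi>1 h" and "integrable \<pi>2 h"
proof -
  interpret A: unit_ball_coupling \<pi>1 by fact
  interpret B: unit_ball_coupling \<pi>2 by fact
  have L: "A.L y = (\<Sum>k\<in>Basis. (y \<bullet> k) *\<^sub>R A.L k)" for y by (rule A.L_eq)
  have hz: "h z = 2 * ((norm (fst z))\<^sup>2 * (norm (snd z))\<^sup>2) - 4 * (((norm (fst z))\<^sup>2 *\<^sub>R snd z) \<bullet> A.mean_y)
      + 8 * (fst z \<bullet> A.L (snd z)) - 4 * (((norm (snd z))\<^sup>2 *\<^sub>R fst z) \<bullet> A.mean_x)" for z
    by (simp add: h_def alignment_slope_def inner_diff_right algebra_simps)
  have iL1: "integrable \<pi>1 (\<lambda>z. fst z \<bullet> A.L (snd z))" and iL2: "integrable \<pi>2 (\<lambda>z. fst z \<bullet> A.L (snd z))"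
    using A.integral_bilinear(2)[of A.L] B.integral_bilinear(2)[of A.L] by (simp_all add: L[symmetric])
  have Q11: "(\<integral>z. fst z \<bullet> A.L (snd z) \<partial>\<pi>1) = (\<Sum>k\<in>Basis. A.L k \<bullet> A.L k)"
    using A.integral_bilinear(1)[of A.L] by (simp add: L[symmetric])
  have Q21: "(\<integral>z. fst z \<bullet> A.L (snd z) \<partial>\<pi>2) = (\<Sum>k\<in>Basis. B.L k \<bullet> A.L k)"
    using B.integral_bilinear(1)[of A.L] by (simp add: L[symmetric])
  have Q22: "(\<integral>z. fst z \<bullet> B.L (snd z) \<partial>\<pi>2) = (\<Sum>k\<in>Basis. B.L k \<bullet> B.L k)"
    using B.integral_bilinear(1)[of B.L] by (simp add: B.L_eq[symmetric])
  \<comment> \<open>Nonnegativity of the squared norm of the difference of the two cross moment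
    matrices; this is where convexity enters.\<close>
  have psd: "2 * (\<Sum>k\<in>Basis. B.L k \<bullet> A.L k) \<le> (\<Sum>k\<in>Basis. A.L k \<bullet> A.L k) + (\<Sum>k\<in>Basis. B.L k \<bullet> B.L k)"
  proof -
    have "0 \<le> (\<Sum>k\<in>(Basis :: 'b set). (B.L k - A.L k) \<bullet> (B.L k - A.L k))" by (intro sum_nonneg) auto
    also have "\<dots> = (\<Sum>k\<in>(Basis :: 'b set). A.L k \<bullet> A.L k + B.L k \<bullet> B.L k - 2 * (B.L k \<bullet> A.L k))"
      by (intro sum.cong refl) (simp add: inner_diff inner_commute)
    also have "\<dots> = (\<Sum>k\<in>Basis. A.L k \<bullet> A.L k) + (\<Sum>k\<in>Basis. B.L k \<bullet> B.L k) - 2 * (\<Sum>k\<in>Basis. B.L k \<bullet> A.L k)"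
      by (simp add: sum.distrib sum_subtractf sum_distrib_left)
    finally show ?thesis by simp
  qed
  show i1: "integrable \<pi>1 h" unfolding hz[abs_def]
    by (intro Bochner_Integration.integrable_add Bochner_Integration.integrable_diff integrable_mult_right
        integrable_inner_left A.iab A.iay A.ibx iL1)
  show i2: "integrable \<pi>2 h" unfolding hz[abs_def]
    by (intro Bochner_Integration.integrable_add Bochner_Integration.integrable_diff integrable_mult_right
        integrable_inner_left B.iab B.iay B.ibx iL2)
  have h1: "(\<integral>z. h z \<partial>\<pi>1) = 2 * A.Eab - 4 * (A.Eay \<bullet> A.mean_y) + 8 * (\<Sum>k\<in>Basis. A.L k \<bullet> A.L k) - 4 * (A.Ebx \<bullet> A.mean_x)"
    unfolding hz[abs_def] A.Eab_def A.Eay_def A.Ebx_def Q11[symmetric]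
    using A.iab A.iay A.ibx iL1 by (simp del: inner_scaleR_left)
  have h2: "(\<integral>z. h z \<partial>\<pi>2) = 2 * B.Eab - 4 * (B.Eay \<bullet> A.mean_y) + 8 * (\<Sum>k\<in>Basis. B.L k \<bullet> A.L k) - 4 * (B.Ebx \<bullet> A.mean_x)"
    unfolding hz[abs_def] B.Eab_def B.Eay_def B.Ebx_def Q21[symmetric]
    using B.iab B.iay B.ibx iL2 by (simp del: inner_scaleR_left)
  have y: "B.Eay \<bullet> B.mean_y - B.Eay \<bullet> A.mean_y \<le> B.Ea * norm (B.mean_y - A.mean_y)"
    unfolding inner_diff_right[symmetric]
    by (intro order_trans[OF norm_cauchy_schwarz] mult_right_mono B.norm_Eay) auto
  have x: "B.Ebx \<bullet> B.mean_x - B.Ebx \<bullet> A.mean_x \<le> (\<integral>z. norm (fst z) \<partial>\<pi>2) * norm (B.mean_x - A.mean_x)"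
    unfolding inner_diff_right[symmetric]
    by (intro order_trans[OF norm_cauchy_schwarz] mult_right_mono B.norm_Ebx) auto
  show "alignment \<pi>1 - alignment \<pi>2 \<le> (\<integral>z. h z \<partial>\<pi>1) - (\<integral>z. h z \<partial>\<pi>2)
      + 2 * (A.Ea * A.Eb - B.Ea * B.Eb) + 4 * (B.Ea * norm (B.mean_y - A.mean_y))
      + 4 * ((\<integral>z. norm (fst z) \<partial>\<pi>2) * norm (B.mean_x - A.mean_x))"
    unfolding h1 h2 A.alignment_eq B.alignment_eq Q11 Q22 using psd x y by (simp add: algebra_simps)
qed

text \<open>Coordinates in which \<open>alignment_slope \<pi> v x - z v\<close> is linear in its
  coefficients; the last entry carries the potential. The squared norm is
  \<open>norm x ^ 4 + (norm x)\<^sup>2 + 1\<close>, so a fourth moment of \<open>x\<close> is a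
  second moment here.\<close>

definition feature :: "'a::euclidean_space \<Rightarrow> real \<times> 'a \<times> real" where
  "feature x = ((norm x)\<^sup>2, x, 1)"

text \<open>The dual problem for the second pair, with the slope at \<open>\<pi>1\<close> as
  objective, yields both the coupling \<open>\<pi>2\<close> and potentials that dominate the slope
  under \<open>\<pi>1\<close>. What remains are differences of marginals. The radius
  \<open>R\<close> collects the bounds 6, 24 and 108 for the three blocks of coefficients, in
  multiples of \<open>K\<^sup>2 / \<eta>\<close>; they sum to 138.\<close>

lemma alignment_compare:
  fixes \<mu>1 \<mu>2 :: "'a::euclidean_space measure" and \<nu>1 \<nu>2 :: "'b::euclidean_space measure"
    and K \<eta> R D e :: real
  assumes M1: "finite_fourth_moment \<mu>1" and M2: "finite_fourth_moment \<mu>2"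
    and N1: "supported_in Y \<nu>1" and N2: "supported_in Y \<nu>2" and Y0: "Y \<noteq> {}"
    and K1: "(\<integral>x. (norm x)\<^sup>2 \<partial>\<mu>1) \<le> K" and K2: "(\<integral>x. (norm x)\<^sup>2 \<partial>\<mu>2) \<le> K" and K: "1 \<le> K"
    and \<eta>: "0 < \<eta>" "\<And>v. v \<in> Y \<Longrightarrow> \<eta> \<le> measure \<nu>2 {v}"
    and R: "R = 138 * K\<^sup>2 / \<eta>"
    and D: "\<And>\<theta>. (\<And>v. v \<in> Y \<Longrightarrow> norm (\<theta> v) \<le> R) \<Longrightarrow>
      (\<integral>x. (MAX v\<in>Y. \<theta> v \<bullet> feature x) \<partial>\<mu>1) - (\<integral>x. (MAX v\<in>Y. \<theta> v \<bullet> feature x) \<partial>\<mu>2) \<le> D"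
    and \<pi>1: "\<pi>1 \<in> couplings \<mu>1 \<nu>1" and e: "0 < e"
  shows "\<exists>\<pi>2\<in>couplings \<mu>2 \<nu>2. alignment \<pi>1 \<le> alignment \<pi>2
    + R * (D + (\<Sum>v\<in>Y. \<bar>measure \<nu>1 {v} - measure \<nu>2 {v}\<bar>)) + e"
proof -
  define t where "t = (\<Sum>v\<in>Y. \<bar>measure \<nu>1 {v} - measure \<nu>2 {v}\<bar>)"
  have t0: "0 \<le> t" by (simp add: t_def sum_nonneg)
  have Y: "finite Y" "\<And>v. v \<in> Y \<Longrightarrow> norm v \<le> 1" using N1 by (auto simp: supported_in_def)
  note F1 = finite_fourth_momentD[OF M1] and F2 = finite_fourth_momentD[OF M2]
  interpret P1: prob_space \<mu>1 by (rule F1)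
  interpret P2: prob_space \<mu>2 by (rule F2)
  note [measurable_cong] = F1(2) F2(2)
  interpret A: unit_ball_coupling \<pi>1 by (rule unit_ball_couplingI[OF \<pi>1 M1 N1])
  have \<eta>1: "\<eta> \<le> 1"
  proof -
    obtain v where v: "v \<in> Y" using Y0 by blast
    have "measure \<nu>2 {v} \<le> (\<Sum>v\<in>Y. measure \<nu>2 {v})" using Y v by (intro member_le_sum) auto
    with \<eta>(2)[OF v] sum_measure_supported_in[OF N2] show ?thesis by simp
  qed
  have KK: "1 \<le> K\<^sup>2" "K \<le> K\<^sup>2" using K self_le_power[of K 2] by auto
  have K2\<eta>: "K\<^sup>2 \<le> K\<^sup>2 / \<eta>" using \<eta>(1) \<eta>1 by (simp add: field_simps mult_left_le_one_le)
  have R1: "138 * K\<^sup>2 \<le> R" "11 * K \<le> R" "1 \<le> R"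
    using K2\<eta> KK K unfolding R by auto
  have n_le: "(\<integral>x. norm x \<partial>\<mu>) \<le> 2 * K"
    if "finite_fourth_moment \<mu>" "(\<integral>x. (norm x)\<^sup>2 \<partial>\<mu>) \<le> K" for \<mu> :: "'a measure"
  proof -
    interpret prob_space \<mu> by (rule finite_fourth_momentD[OF that(1)])
    have "(\<integral>x. norm x \<partial>\<mu>) \<le> (\<integral>x. 1 + (norm x)\<^sup>2 \<partial>\<mu>)"
      using finite_fourth_momentD[OF that(1)] by (intro integral_mono norm_le_1_plus_sq) auto
    also have "\<dots> = 1 + (\<integral>x. (norm x)\<^sup>2 \<partial>\<mu>)"
      using finite_fourth_momentD[OF that(1)] by (simp add: prob_space)
    finally show ?thesis using that K by simp
  qed
  have n1: "(\<integral>z. norm (fst z) \<partial>\<pi>1) \<le> 2 * K"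
    using coupling_integral(1)[OF \<pi>1, of norm] n_le[OF M1 K1] by simp
  define c where "c v = 2 * (norm v)\<^sup>2 - 4 * (v \<bullet> A.mean_y)" for v
  define d where "d v = 8 *\<^sub>R A.L v - (4 * (norm v)\<^sup>2) *\<^sub>R A.mean_x" for v
  define h where "h = alignment_slope \<pi>1"
  have h_eq: "h v x = (norm x)\<^sup>2 * c v + x \<bullet> d v" for v x
    by (simp add: h_def alignment_slope_def c_def d_def)
  have c_le: "\<bar>c v\<bar> \<le> 6" if "v \<in> Y" for v
  proof -
    have "(norm v)\<^sup>2 \<le> 1" using Y(2)[OF that] by (simp add: power_le_one)
    moreover have "\<bar>v \<bullet> A.mean_y\<bar> \<le> 1"
      using Cauchy_Schwarz_ineq2[of v A.mean_y] mult_le_one[OF Y(2)[OF that] _ A.norm_mean_y] by simp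
    moreover have "0 \<le> (norm v)\<^sup>2" by simp
    ultimately show ?thesis unfolding c_def abs_le_iff by linarith
  qed
  have d_le: "norm (d v) \<le> 24 * K" if "v \<in> Y" for v
  proof -
    have v1: "(norm v)\<^sup>2 \<le> 1" using Y(2)[OF that] by (simp add: power_le_one)
    have "norm (d v) \<le> 8 * norm (A.L v) + 4 * ((norm v)\<^sup>2 * norm A.mean_x)"
      unfolding d_def by (rule order_trans[OF norm_triangle_ineq4]) simp
    also have "(norm v)\<^sup>2 * norm A.mean_x \<le> 1 * norm A.mean_x"
      using v1 by (intro mult_right_mono) auto
    finally show ?thesis using A.norm_L_le[OF Y(2)[OF that]] A.norm_mean_x n1 by simp
  qed
  define b where "b x = 6 * (norm x)\<^sup>2 + 24 * K * norm x" for x :: 'a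
  have b0: "0 \<le> b x" for x using K by (simp add: b_def)
  have h_le: "\<bar>h v x\<bar> \<le> b x" if "v \<in> Y" for v x
  proof -
    have "\<bar>x \<bullet> d v\<bar> \<le> norm x * norm (d v)" by (rule Cauchy_Schwarz_ineq2)
    also have "\<dots> \<le> norm x * (24 * K)" by (intro mult_left_mono d_le that) auto
    finally have "\<bar>x \<bullet> d v\<bar> \<le> 24 * K * norm x" by (simp add: mult.commute)
    moreover have "\<bar>(norm x)\<^sup>2 * c v\<bar> \<le> 6 * (norm x)\<^sup>2"
      using mult_left_mono[OF c_le[OF that], of "(norm x)\<^sup>2"] by (simp add: abs_mult mult.commute)
    ultimately show ?thesis unfolding h_eq b_def by linarith
  qed
  have h_meas[measurable]: "h v \<in> borel_measurable borel" for v
    unfolding h_eq[abs_def] by measurable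
  have b_int: "integrable \<mu> b" if "finite_fourth_moment \<mu>" for \<mu> :: "'a measure"
    unfolding b_def[abs_def] using finite_fourth_momentD[OF that]
    by (intro Bochner_Integration.integrable_add integrable_mult_right) auto
  \<comment> \<open>The value 54 is \<open>6 + 24 * 2\<close>; twice it is the 108 in the bound on
    the potentials.\<close>
  have bH: "(\<integral>x. b x \<partial>\<mu>2) \<le> 54 * K\<^sup>2"
  proof -
    have "(\<integral>x. b x \<partial>\<mu>2) = 6 * (\<integral>x. (norm x)\<^sup>2 \<partial>\<mu>2) + 24 * K * (\<integral>x. norm x \<partial>\<mu>2)"
      unfolding b_def using F2 by simp
    also have "\<dots> \<le> 6 * K + 24 * K * (2 * K)"
      using K2 K n_le[OF M2 K2] by (intro add_mono mult_left_mono) auto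
    also have "\<dots> \<le> 54 * K\<^sup>2" using KK by (simp add: power2_eq_square)
    finally show ?thesis .
  qed
  have "\<exists>p z. p \<in> simplex_selections \<mu>2 Y \<and> (\<forall>v\<in>Y. (\<integral>x. p v x \<partial>\<mu>2) = measure \<nu>2 {v}) \<and>
    (\<forall>v\<in>Y. \<bar>z v\<bar> \<le> 2 * (54 * K\<^sup>2) / \<eta>) \<and>
    (\<integral>x. (MAX v\<in>Y. h v x - z v) \<partial>\<mu>2) + (\<Sum>v\<in>Y. measure \<nu>2 {v} * z v) \<le> (\<Sum>v\<in>Y. \<integral>x. p v x * h v x \<partial>\<mu>2) + e"
    by (rule semidiscrete_duality_bounded[OF F2(1) Y(1) Y0 \<eta>(2,1) sum_measure_supported_in[OF N2] _ h_le b_int[OF M2] bH e])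
       (auto simp: measurable_cong_sets[OF F2(2) refl])
  then obtain p z where p: "p \<in> simplex_selections \<mu>2 Y" "\<And>v. v \<in> Y \<Longrightarrow> (\<integral>x. p v x \<partial>\<mu>2) = measure \<nu>2 {v}"
    and z: "\<And>v. v \<in> Y \<Longrightarrow> \<bar>z v\<bar> \<le> 108 * K\<^sup>2 / \<eta>"
    and dual: "(\<integral>x. (MAX v\<in>Y. h v x - z v) \<partial>\<mu>2) + (\<Sum>v\<in>Y. measure \<nu>2 {v} * z v) \<le> (\<Sum>v\<in>Y. \<integral>x. p v x * h v x \<partial>\<mu>2) + e"
    by auto
  obtain \<pi>2 where \<pi>2: "\<pi>2 \<in> couplings \<mu>2 \<nu>2"
    "\<And>h :: 'a \<times> 'b \<Rightarrow> real. h \<in> borel_measurable borel \<Longrightarrow> integrable \<pi>2 h \<Longrightarrow>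
      integral\<^sup>L \<pi>2 h = (\<Sum>v\<in>Y. \<integral>x. p v x * h (x, v) \<partial>\<mu>2)"
    using selection_coupling[OF F2(1,2) N2 p] by blast
  interpret B: unit_ball_coupling \<pi>2 by (rule unit_ball_couplingI[OF \<pi>2(1) M2 N2])
  have diff: "alignment \<pi>1 - alignment \<pi>2 \<le> (\<integral>z. h (snd z) (fst z) \<partial>\<pi>1) - (\<integral>z. h (snd z) (fst z) \<partial>\<pi>2)
      + 2 * (A.Ea * A.Eb - B.Ea * B.Eb) + 4 * (B.Ea * norm (B.mean_y - A.mean_y))
      + 4 * ((\<integral>z. norm (fst z) \<partial>\<pi>2) * norm (B.mean_x - A.mean_x))"
    and hi: "integrable \<pi>1 (\<lambda>z. h (snd z) (fst z))" "integrable \<pi>2 (\<lambda>z. h (snd z) (fst z))"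
    using alignment_diff_le[OF A.unit_ball_coupling_axioms B.unit_ball_coupling_axioms] unfolding h_def by auto
  have h2: "(\<integral>z. h (snd z) (fst z) \<partial>\<pi>2) = (\<Sum>v\<in>Y. \<integral>x. p v x * h v x \<partial>\<mu>2)"
  proof -
    have "(\<lambda>z. h (snd z) (fst z)) \<in> borel_measurable borel"
      unfolding h_eq c_def d_def by (intro borel_measurable_continuous_onI continuous_intros)
    then show ?thesis using \<pi>2(2) hi(2) by simp
  qed
  define m where "m x = (MAX v\<in>Y. h v x - z v)" for x
  have m_meas[measurable]: "m \<in> borel_measurable borel"
    unfolding m_def using Y by (intro borel_measurable_Max) auto
  have m_int: "integrable \<mu>1 m"
  proof (rule Bochner_Integration.integrable_bound[of _ "\<lambda>x. b x + 108 * K\<^sup>2 / \<eta>"])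
    have "\<bar>m x\<bar> \<le> b x + 108 * K\<^sup>2 / \<eta>" for x
      unfolding m_def
    proof (rule abs_Max_le[OF Y(1) Y0])
      fix v assume "v \<in> Y"
      then show "\<bar>h v x - z v\<bar> \<le> b x + 108 * K\<^sup>2 / \<eta>" using h_le[of v x] z[of v] by linarith
    qed
    then show "AE x in \<mu>1. norm (m x) \<le> norm (b x + 108 * K\<^sup>2 / \<eta>)"
      by (intro AE_I2) (auto intro: order_trans[OF _ abs_ge_self])
  qed (use b_int[OF M1] in auto)
  \<comment> \<open>The potential extended by 0 to a Borel function, so that its integral under
    \<open>\<pi>1\<close> can be read off from \<open>\<nu>1\<close>.\<close>
  define zz where "zz y = (\<Sum>v\<in>Y. z v * indicator {v} y)" for y
  have zz_meas[measurable]: "zz \<in> borel_measurable borel" unfolding zz_def by measurable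
  have zz: "zz v = z v" if "v \<in> Y" for v
  proof -
    have "zz v = (\<Sum>u\<in>Y. if u = v then z v else 0)" unfolding zz_def by (intro sum.cong) auto
    then show ?thesis using that Y by simp
  qed
  \<comment> \<open>Weak duality: the potentials were found for the second pair, but
    \<open>h v x \<le> m x + z v\<close> holds pointwise and integrates against any coupling on
    \<open>Y\<close>.\<close>
  have h1: "(\<integral>z. h (snd z) (fst z) \<partial>\<pi>1) \<le> (\<integral>x. m x \<partial>\<mu>1) + (\<Sum>v\<in>Y. measure \<nu>1 {v} * z v)"
  proof -
    have im: "integrable \<pi>1 (\<lambda>z. m (fst z))"
      unfolding coupling_integral(2)[OF \<pi>1 m_meas] by (rule m_int)
    have iz: "integrable \<pi>1 (\<lambda>w. zz (snd w))"
      unfolding coupling_integral(4)[OF \<pi>1 zz_meas] by (rule integral_supported_in(2)[OF N1 zz_meas])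
    have "(\<integral>w. h (snd w) (fst w) \<partial>\<pi>1) \<le> (\<integral>w. m (fst w) + zz (snd w) \<partial>\<pi>1)"
    proof (rule integral_mono_AE[OF hi(1)])
      show "AE w in \<pi>1. h (snd w) (fst w) \<le> m (fst w) + zz (snd w)"
        using coupling_AE_snd[OF \<pi>1 N1]
      proof eventually_elim
        case (elim w)
        have "h (snd w) (fst w) - z (snd w) \<le> m (fst w)"
          unfolding m_def using elim Y by (intro Max_ge) auto
        then show ?case using zz[OF elim] by simp
      qed
    qed (use im iz in auto)
    also have "\<dots> = (\<integral>w. m (fst w) \<partial>\<pi>1) + (\<integral>w. zz (snd w) \<partial>\<pi>1)" using im iz by simp
    also have "(\<integral>w. m (fst w) \<partial>\<pi>1) = (\<integral>x. m x \<partial>\<mu>1)" by (rule coupling_integral(1)[OF \<pi>1]) simp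
    also have "(\<integral>w. zz (snd w) \<partial>\<pi>1) = integral\<^sup>L \<nu>1 zz" by (rule coupling_integral(3)[OF \<pi>1]) simp
    also have "\<dots> = (\<Sum>v\<in>Y. measure \<nu>1 {v} * z v)"
      unfolding integral_supported_in(1)[OF N1 zz_meas] using zz by (intro sum.cong) auto
    finally show ?thesis .
  qed
  have mD: "(\<integral>x. m x \<partial>\<mu>1) - (\<integral>x. m x \<partial>\<mu>2) \<le> D"
  proof -
    have "(\<integral>x. (MAX v\<in>Y. (c v, d v, - z v) \<bullet> feature x) \<partial>\<mu>1) - (\<integral>x. (MAX v\<in>Y. (c v, d v, - z v) \<bullet> feature x) \<partial>\<mu>2) \<le> D"
    proof (rule D)
      fix v assume v: "v \<in> Y"
      have "norm (c v, d v, - z v) \<le> norm (c v) + (norm (d v) + norm (- z v))"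
        by (intro order_trans[OF norm_Pair_le] add_left_mono norm_Pair_le)
      also have "\<dots> \<le> 6 * (K\<^sup>2 / \<eta>) + (24 * (K\<^sup>2 / \<eta>) + 108 * (K\<^sup>2 / \<eta>))"
        using c_le[OF v] d_le[OF v] z[OF v] KK K2\<eta> by (intro add_mono) auto
      finally show "norm (c v, d v, - z v) \<le> R" by (simp add: R)
    qed
    moreover have "(c v, d v, - z v) \<bullet> feature x = h v x - z v" for v x
      by (simp add: feature_def h_eq inner_commute mult.commute)
    ultimately show ?thesis by (simp add: m_def)
  qed
  \<comment> \<open>Parameters that do not depend on \<open>v\<close> make the maximum disappear. So
    \<open>D\<close> also controls marginal quantities: the parameter 0 gives its sign, the first
    unit vector the second moments, and a unit vector in the middle block the means.\<close>
  have D0: "0 \<le> D"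
  proof -
    have "(\<integral>x. (MAX v\<in>Y. (0 :: real \<times> 'a \<times> real) \<bullet> feature x) \<partial>\<mu>1) - (\<integral>x. (MAX v\<in>Y. (0 :: real \<times> 'a \<times> real) \<bullet> feature x) \<partial>\<mu>2) \<le> D"
      by (rule D) (use R1 in auto)
    then show ?thesis by (simp add: P1.prob_space P2.prob_space)
  qed
  have EaA: "A.Ea = (\<integral>x. (norm x)\<^sup>2 \<partial>\<mu>1)" and EaB: "B.Ea = (\<integral>x. (norm x)\<^sup>2 \<partial>\<mu>2)"
    unfolding A.Ea_def B.Ea_def by (rule coupling_integral(1)[OF \<pi>1], simp, rule coupling_integral(1)[OF \<pi>2(1)], simp)
  have EaD: "A.Ea - B.Ea \<le> D"
  proof -
    have "(\<integral>x. (MAX v\<in>Y. (1 :: real, 0 :: 'a, 0 :: real) \<bullet> feature x) \<partial>\<mu>1)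
        - (\<integral>x. (MAX v\<in>Y. (1 :: real, 0 :: 'a, 0 :: real) \<bullet> feature x) \<partial>\<mu>2) \<le> D"
      by (rule D) (use R1 in \<open>simp add: norm_Pair\<close>)
    then show ?thesis using Y0 by (simp add: EaA EaB feature_def image_constant_conv)
  qed
  have mxD: "norm (B.mean_x - A.mean_x) \<le> D"
  proof -
    have mA: "A.mean_x = (\<integral>x. x \<partial>\<mu>1)" and mB: "B.mean_x = (\<integral>x. x \<partial>\<mu>2)"
      unfolding A.mean_x_def B.mean_x_def
      by (rule coupling_integral(1)[OF \<pi>1], simp, rule coupling_integral(1)[OF \<pi>2(1)], simp)
    define s where "s = sgn (A.mean_x - B.mean_x)"
    have "(\<integral>x. (MAX v\<in>Y. (0 :: real, s, 0 :: real) \<bullet> feature x) \<partial>\<mu>1)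
        - (\<integral>x. (MAX v\<in>Y. (0 :: real, s, 0 :: real) \<bullet> feature x) \<partial>\<mu>2) \<le> D"
      by (rule D) (use R1 in \<open>simp add: norm_Pair s_def norm_sgn\<close>)
    then have "s \<bullet> A.mean_x - s \<bullet> B.mean_x \<le> D"
      using Y0 F1 F2 by (simp add: feature_def mA mB image_constant_conv)
    moreover have "s \<bullet> A.mean_x - s \<bullet> B.mean_x = norm (A.mean_x - B.mean_x)"
      unfolding inner_diff_right[symmetric] s_def sgn_div_norm
      by (cases "A.mean_x = B.mean_x") (simp_all add: power2_norm_eq_inner[symmetric] power2_eq_square)
    ultimately show ?thesis by (simp add: norm_minus_commute)
  qed
  have nu_le: "norm ((\<Sum>v\<in>Y. measure \<nu>1 {v} *\<^sub>R f v) - (\<Sum>v\<in>Y. measure \<nu>2 {v} *\<^sub>R f v)) \<le> t * C"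
    if f: "\<And>v. v \<in> Y \<Longrightarrow> norm (f v) \<le> C" for f :: "'b \<Rightarrow> 'd::real_normed_vector" and C
  proof -
    have "norm ((\<Sum>v\<in>Y. measure \<nu>1 {v} *\<^sub>R f v) - (\<Sum>v\<in>Y. measure \<nu>2 {v} *\<^sub>R f v))
        = norm (\<Sum>v\<in>Y. (measure \<nu>1 {v} - measure \<nu>2 {v}) *\<^sub>R f v)"
      by (simp add: scaleR_left_diff_distrib sum_subtractf)
    also have "\<dots> \<le> (\<Sum>v\<in>Y. \<bar>measure \<nu>1 {v} - measure \<nu>2 {v}\<bar> * C)"
      using f by (intro order_trans[OF norm_sum] sum_mono) (auto intro!: mult_left_mono)
    finally show ?thesis by (simp add: t_def sum_distrib_right)
  qed
  have myt: "norm (B.mean_y - A.mean_y) \<le> t"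
  proof -
    have "A.mean_y = (\<Sum>v\<in>Y. measure \<nu>1 {v} *\<^sub>R v)" "B.mean_y = (\<Sum>v\<in>Y. measure \<nu>2 {v} *\<^sub>R v)"
      unfolding A.mean_y_def B.mean_y_def
      using coupling_integral(3)[OF \<pi>1, of "\<lambda>y. y"] coupling_integral(3)[OF \<pi>2(1), of "\<lambda>y. y"]
        integral_supported_in(1)[OF N1, of "\<lambda>y. y"] integral_supported_in(1)[OF N2, of "\<lambda>y. y"] by auto
    then show ?thesis using nu_le[of "\<lambda>v. v" 1] Y(2) by (simp add: norm_minus_commute)
  qed
  have Ebt: "A.Eb - B.Eb \<le> t"
  proof -
    have "A.Eb = (\<Sum>v\<in>Y. measure \<nu>1 {v} *\<^sub>R (norm v)\<^sup>2)" "B.Eb = (\<Sum>v\<in>Y. measure \<nu>2 {v} *\<^sub>R (norm v)\<^sup>2)"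
      unfolding A.Eb_def B.Eb_def
      using coupling_integral(3)[OF \<pi>1, of "\<lambda>y. (norm y)\<^sup>2"] coupling_integral(3)[OF \<pi>2(1), of "\<lambda>y. (norm y)\<^sup>2"]
        integral_supported_in(1)[OF N1, of "\<lambda>y. (norm y)\<^sup>2"] integral_supported_in(1)[OF N2, of "\<lambda>y. (norm y)\<^sup>2"] by auto
    then have "\<bar>A.Eb - B.Eb\<bar> \<le> t * 1"
      using nu_le[of "\<lambda>v. (norm v)\<^sup>2" 1] Y(2) by (simp add: power_le_one)
    then show ?thesis by simp
  qed
  have zt: "(\<Sum>v\<in>Y. measure \<nu>1 {v} * z v) - (\<Sum>v\<in>Y. measure \<nu>2 {v} * z v) \<le> t * (108 * K\<^sup>2 / \<eta>)"
    using nu_le[of z "108 * K\<^sup>2 / \<eta>"] z by simp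
  have "A.Ea * A.Eb - B.Ea * B.Eb = (A.Ea - B.Ea) * A.Eb + B.Ea * (A.Eb - B.Eb)"
    by (simp add: algebra_simps)
  also have "\<dots> \<le> D * 1 + K * t"
  proof (rule add_mono)
    have "(A.Ea - B.Ea) * A.Eb \<le> D * A.Eb" using EaD A.Eb_nonneg by (intro mult_right_mono) auto
    also have "\<dots> \<le> D * 1" using D0 A.Eb_le by (intro mult_left_mono) auto
    finally show "(A.Ea - B.Ea) * A.Eb \<le> D * 1" .
    have "B.Ea * (A.Eb - B.Eb) \<le> B.Ea * t" using Ebt B.Ea_nonneg by (intro mult_left_mono) auto
    also have "\<dots> \<le> K * t" using K2 t0 by (intro mult_right_mono) (auto simp: EaB)
    finally show "B.Ea * (A.Eb - B.Eb) \<le> K * t" .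
  qed
  finally have q1: "A.Ea * A.Eb - B.Ea * B.Eb \<le> D + K * t" by simp
  have q2: "B.Ea * norm (B.mean_y - A.mean_y) \<le> K * t"
    using K2 myt K by (intro mult_mono) (auto simp: EaB)
  have q3: "(\<integral>z. norm (fst z) \<partial>\<pi>2) * norm (B.mean_x - A.mean_x) \<le> 2 * K * D"
    using coupling_integral(1)[OF \<pi>2(1), of norm] n_le[OF M2 K2] mxD K by (intro mult_mono) auto
  have "alignment \<pi>1 - alignment \<pi>2 \<le> D + t * (108 * K\<^sup>2 / \<eta>) + e + 2 * (D + K * t) + 4 * (K * t) + 4 * (2 * K * D)"
  proof -
    \<comment> \<open>The integrals are abstracted to real variables, leaving pure linear
      arithmetic.\<close>
    have "X \<le> D + T + e + 2 * a1 + 4 * a2 + 4 * a3"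
      if "X \<le> H1 - H2 + 2 * b1 + 4 * b2 + 4 * b3" "H1 \<le> m1 + s1" "H2 = S" "m2 + s2 \<le> S + e" "m1 - m2 \<le> D"
        "s1 - s2 \<le> T" "b1 \<le> a1" "b2 \<le> a2" "b3 \<le> a3"
      for X T a1 a2 a3 H1 H2 b1 b2 b3 m1 m2 s1 s2 S :: real
      using that by linarith
    from this[OF diff h1 h2 dual[folded m_def] mD zt q1 q2 q3] show ?thesis .
  qed
  also have "\<dots> = (3 + 8 * K) * D + (6 * K + 108 * (K\<^sup>2 / \<eta>)) * t + e"
    by (simp add: algebra_simps)
  \<comment> \<open>Here \<open>3 + 8 * K \<le> 11 * K\<close>, and \<open>6 * K\<close> fits into
    the gap between 108 and 138; one radius thus serves as factor of both deviations.\<close>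
  also have "\<dots> \<le> R * D + R * t + e"
    using R1 K KK K2\<eta> D0 t0 by (intro add_mono mult_right_mono) (auto simp: R)
  finally show ?thesis
    by (intro bexI[OF _ \<pi>2(1)]) (simp add: t_def algebra_simps)
qed

section \<open>From alignments to the distance\<close>

lemma fourth_power_energy_supported_in:
  assumes N1: "supported_in Y \<nu>1" and N2: "supported_in Y \<nu>2"
  shows "\<bar>fourth_power_energy \<nu>1 - fourth_power_energy \<nu>2\<bar>
    \<le> 32 * (\<Sum>v\<in>Y. \<bar>measure \<nu>1 {v} - measure \<nu>2 {v}\<bar>)"
proof -
  define t where "t = (\<Sum>v\<in>Y. \<bar>measure \<nu>1 {v} - measure \<nu>2 {v}\<bar>)"
  define G where "G \<nu> u = (\<Sum>v\<in>Y. measure \<nu> {v} * norm (u - v) ^ 4)" for \<nu> :: "'a measure" and u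
  have E: "fourth_power_energy \<nu> = (\<Sum>u\<in>Y. measure \<nu> {u} * G \<nu> u)" if N: "supported_in Y \<nu>" for \<nu>
  proof -
    have m: "(\<lambda>v. norm (u - v) ^ 4) \<in> borel_measurable borel" for u :: 'a by measurable
    have "(\<integral>v. norm (u - v) ^ 4 \<partial>\<nu>) = G \<nu> u" for u
      unfolding integral_supported_in(1)[OF N m] G_def by simp
    moreover have "G \<nu> \<in> borel_measurable borel" unfolding G_def by measurable
    ultimately show ?thesis
      unfolding fourth_power_energy_def using integral_supported_in(1)[OF N, of "G \<nu>"] by simp
  qed
  have k: "norm (u - v) ^ 4 \<le> 16" if "u \<in> Y" "v \<in> Y" for u v
  proof -
    have "norm (u - v) \<le> 2"
      using norm_triangle_ineq4[of u v] that N1 by (auto simp: supported_in_def subset_eq) (smt (verit))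
    then have "norm (u - v) ^ 4 \<le> 2 ^ 4" by (intro power_mono) auto
    then show ?thesis by simp
  qed
  have G_le: "\<bar>G \<nu>1 u\<bar> \<le> 16" if "u \<in> Y" for u
  proof -
    have "\<bar>G \<nu>1 u\<bar> = G \<nu>1 u" by (simp add: G_def sum_nonneg)
    also have "\<dots> \<le> (\<Sum>v\<in>Y. measure \<nu>1 {v} * 16)"
      unfolding G_def using k[OF that] by (intro sum_mono mult_left_mono) auto
    finally show ?thesis using sum_measure_supported_in[OF N1] by (simp add: sum_distrib_right[symmetric])
  qed
  have G_diff: "\<bar>G \<nu>1 u - G \<nu>2 u\<bar> \<le> 16 * t" if "u \<in> Y" for u
  proof -
    have "G \<nu>1 u - G \<nu>2 u = (\<Sum>v\<in>Y. (measure \<nu>1 {v} - measure \<nu>2 {v}) * norm (u - v) ^ 4)"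
      by (simp add: G_def sum_subtractf left_diff_distrib)
    also have "\<bar>\<dots>\<bar> \<le> (\<Sum>v\<in>Y. \<bar>measure \<nu>1 {v} - measure \<nu>2 {v}\<bar> * 16)"
      using k[OF that] by (intro order_trans[OF sum_abs] sum_mono) (auto simp: abs_mult intro!: mult_left_mono)
    finally show ?thesis by (simp add: t_def sum_distrib_left mult.commute)
  qed
  \<comment> \<open>One argument of the kernel is exchanged at a time; the kernel is at most
    \<open>2 ^ 4\<close> on the unit ball, so each exchange costs \<open>16 * t\<close>.\<close>
  have "fourth_power_energy \<nu>1 - fourth_power_energy \<nu>2
    = (\<Sum>u\<in>Y. (measure \<nu>1 {u} - measure \<nu>2 {u}) * G \<nu>1 u) + (\<Sum>u\<in>Y. measure \<nu>2 {u} * (G \<nu>1 u - G \<nu>2 u))"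
    unfolding E[OF N1] E[OF N2] sum.distrib[symmetric] sum_subtractf[symmetric]
    by (intro sum.cong refl) (simp add: algebra_simps)
  also have "\<bar>\<dots>\<bar> \<le> (\<Sum>u\<in>Y. \<bar>measure \<nu>1 {u} - measure \<nu>2 {u}\<bar> * 16) + (\<Sum>u\<in>Y. measure \<nu>2 {u} * (16 * t))"
    using G_le G_diff
    by (intro order_trans[OF abs_triangle_ineq] add_mono order_trans[OF sum_abs] sum_mono)
       (auto simp: abs_mult intro!: mult_left_mono)
  also have "\<dots> = 16 * t + 16 * t"
    using sum_measure_supported_in[OF N2] by (simp add: sum_distrib_right[symmetric] t_def)
  finally show ?thesis by (simp add: t_def)
qed

lemma GW_sq_diff_le_aux:
  assumes M1: "finite_fourth_moment \<mu>1" and M2: "finite_fourth_moment \<mu>2"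
    and N1: "supported_in Y \<nu>1" and N2: "supported_in Y \<nu>2"
    and al: "\<And>\<pi>1 e. \<pi>1 \<in> couplings \<mu>1 \<nu>1 \<Longrightarrow> 0 < e \<Longrightarrow> \<exists>\<pi>2\<in>couplings \<mu>2 \<nu>2. alignment \<pi>1 \<le> alignment \<pi>2 + B + e"
  shows "GW_sq \<mu>2 \<nu>2 - GW_sq \<mu>1 \<nu>1 \<le> \<bar>fourth_power_energy \<mu>2 - fourth_power_energy \<mu>1\<bar>
    + \<bar>fourth_power_energy \<nu>2 - fourth_power_energy \<nu>1\<bar> + 2 * B"
proof (rule field_le_epsilon)
  fix e :: real assume e: "0 < e"
  \<comment> \<open>The slack of the alignment counts twice in the cost, hence thirds of
    \<open>e\<close>.\<close>
  obtain \<pi>1 where \<pi>1: "\<pi>1 \<in> couplings \<mu>1 \<nu>1"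
    "fourth_power_energy \<mu>1 + fourth_power_energy \<nu>1 - 2 * alignment \<pi>1 \<le> GW_sq \<mu>1 \<nu>1 + e / 3"
    using GW_sq_alignment(2)[OF M1 N1, of "e / 3"] e by auto
  obtain \<pi>2 where \<pi>2: "\<pi>2 \<in> couplings \<mu>2 \<nu>2" "alignment \<pi>1 \<le> alignment \<pi>2 + B + e / 3"
    using al[OF \<pi>1(1), of "e / 3"] e by auto
  show "GW_sq \<mu>2 \<nu>2 - GW_sq \<mu>1 \<nu>1 \<le> \<bar>fourth_power_energy \<mu>2 - fourth_power_energy \<mu>1\<bar>
    + \<bar>fourth_power_energy \<nu>2 - fourth_power_energy \<nu>1\<bar> + 2 * B + e"
    using GW_sq_alignment(1)[OF M2 N2 \<pi>2(1)] \<pi>1(2) \<pi>2(2) by linarith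
qed

text \<open>Covers the samples for which \<open>alignment_compare\<close> is not available: a large empirical second moment or an
  atom of small empirical weight.\<close>

lemma alignment_compare_trivial:
  assumes M1: "finite_fourth_moment \<mu>1" and M2: "finite_fourth_moment \<mu>2"
    and N1: "supported_in Y \<nu>1" and N2: "supported_in Y \<nu>2"
    and B: "16 * (\<integral>x. (norm x)\<^sup>2 \<partial>\<mu>1) \<le> B" and \<pi>1: "\<pi>1 \<in> couplings \<mu>1 \<nu>1" and e: "0 < e"
  shows "\<exists>\<pi>2\<in>couplings \<mu>2 \<nu>2. alignment \<pi>1 \<le> alignment \<pi>2 + B + e"
proof
  show \<pi>2: "\<mu>2 \<Otimes>\<^sub>M \<nu>2 \<in> couplings \<mu>2 \<nu>2"
    using M2 N2 by (intro pair_measure_in_couplings) (auto simp: finite_fourth_moment_def supported_in_def)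
  interpret A: unit_ball_coupling \<pi>1 by (rule unit_ball_couplingI[OF \<pi>1 M1 N1])
  have "0 \<le> alignment (\<mu>2 \<Otimes>\<^sub>M \<nu>2)"
    by (rule unit_ball_coupling.GW_cost_eq(3)[OF unit_ball_couplingI[OF \<pi>2 M2 N2]])
  moreover have "A.Ea = (\<integral>x. (norm x)\<^sup>2 \<partial>\<mu>1)"
    unfolding A.Ea_def by (rule coupling_integral(1)[OF \<pi>1]) simp
  ultimately show "alignment \<pi>1 \<le> alignment (\<mu>2 \<Otimes>\<^sub>M \<nu>2) + B + e"
    using A.GW_cost_eq(4) B e by linarith
qed

text \<open>Here \<open>\<mu>'\<close> and \<open>\<nu>'\<close> play the sample, and moments and
  weights are assumed for the population only. A sample with a large second moment or a light atom
  makes \<open>D\<close> or the deviation of the weights large, so that \<open>R\<close> times their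
  sum dominates the crude bound on the alignment.\<close>

lemma GW_sq_diff_le:
  fixes \<mu> \<mu>' :: "'a::euclidean_space measure" and \<nu> \<nu>' :: "'b::euclidean_space measure" and K \<eta> R D :: real
  assumes M: "finite_fourth_moment \<mu>" and M': "finite_fourth_moment \<mu>'"
    and N: "supported_in Y \<nu>" and N': "supported_in Y \<nu>'" and Y0: "Y \<noteq> {}"
    and K: "(\<integral>x. (norm x)\<^sup>2 \<partial>\<mu>) + 1 \<le> K" and \<eta>: "0 < \<eta>" "\<And>v. v \<in> Y \<Longrightarrow> \<eta> \<le> measure \<nu> {v}"
    and R: "R = 276 * K\<^sup>2 / \<eta>"
    and D: "\<And>\<theta>. (\<And>v. v \<in> Y \<Longrightarrow> norm (\<theta> v) \<le> R) \<Longrightarrow>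
      \<bar>(\<integral>x. (MAX v\<in>Y. \<theta> v \<bullet> feature x) \<partial>\<mu>') - (\<integral>x. (MAX v\<in>Y. \<theta> v \<bullet> feature x) \<partial>\<mu>)\<bar> \<le> D"
  shows "\<bar>GW_sq \<mu>' \<nu>' - GW_sq \<mu> \<nu>\<bar> \<le> \<bar>fourth_power_energy \<mu>' - fourth_power_energy \<mu>\<bar>
    + 3 * R * (D + (\<Sum>v\<in>Y. \<bar>measure \<nu>' {v} - measure \<nu> {v}\<bar>))"
proof -
  define t where "t = (\<Sum>v\<in>Y. \<bar>measure \<nu>' {v} - measure \<nu> {v}\<bar>)"
  have t_sym: "t = (\<Sum>v\<in>Y. \<bar>measure \<nu> {v} - measure \<nu>' {v}\<bar>)"
    by (simp add: t_def abs_minus_commute)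
  have t0: "0 \<le> t" by (simp add: t_def sum_nonneg)
  let ?A = "\<integral>x. (norm x)\<^sup>2 \<partial>\<mu>" and ?A' = "\<integral>x. (norm x)\<^sup>2 \<partial>\<mu>'"
  have A0: "0 \<le> ?A" "0 \<le> ?A'" by auto
  have K1: "1 \<le> K" using K A0 by linarith
  have Y: "finite Y" using N by (simp add: supported_in_def)
  have \<eta>1: "\<eta> \<le> 1"
  proof -
    obtain v where v: "v \<in> Y" using Y0 by blast
    have "measure \<nu> {v} \<le> (\<Sum>v\<in>Y. measure \<nu> {v})" using Y v by (intro member_le_sum) auto
    with \<eta>(2)[OF v] sum_measure_supported_in[OF N] show ?thesis by simp
  qed
  have KK: "1 \<le> K\<^sup>2" "K \<le> K\<^sup>2" using K1 self_le_power[of K 2] by auto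
  have K2\<eta>: "K\<^sup>2 \<le> K\<^sup>2 / \<eta>" using \<eta>(1) \<eta>1 by (simp add: field_simps mult_left_le_one_le)
  have R1: "276 * K\<^sup>2 \<le> R" using K2\<eta> by (simp add: R)
  then have R2: "16 * K \<le> R" "32 \<le> R" "1 \<le> R" using KK by auto
  have R3: "32 * K / \<eta> \<le> R" unfolding R using KK \<eta> by (intro divide_right_mono) auto
  have D_A: "\<bar>?A' - ?A\<bar> \<le> D"
  proof -
    have "\<bar>(\<integral>x. (MAX v\<in>Y. (1 :: real, 0 :: 'a, 0 :: real) \<bullet> feature x) \<partial>\<mu>')
        - (\<integral>x. (MAX v\<in>Y. (1 :: real, 0 :: 'a, 0 :: real) \<bullet> feature x) \<partial>\<mu>)\<bar> \<le> D"
      by (rule D) (use R2 in \<open>simp add: norm_Pair\<close>)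
    then show ?thesis using Y0 by (simp add: feature_def image_constant_conv)
  qed
  then have D0: "0 \<le> D" by linarith
  have al: "\<exists>\<pi>2\<in>couplings \<mu>' \<nu>'. alignment \<pi>1 \<le> alignment \<pi>2 + R * (D + t) + e"
    if \<pi>1: "\<pi>1 \<in> couplings \<mu> \<nu>" and e: "0 < e" for \<pi>1 e
  \<comment> \<open>The sample is the dualised pair here, so its weights bound the potentials.
    Allowing half of \<eta> doubles 138 to 276.\<close>
  proof (cases "?A' \<le> K \<and> (\<forall>v\<in>Y. \<eta> / 2 \<le> measure \<nu>' {v})")
    case True
    show ?thesis
      unfolding t_sym
    proof (rule alignment_compare[OF M M' N N' Y0 _ _ K1 _ _ _ _ \<pi>1 e])
      show "R = 138 * K\<^sup>2 / (\<eta> / 2)" by (simp add: R)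
      show "(\<integral>x. (MAX v\<in>Y. \<theta> v \<bullet> feature x) \<partial>\<mu>) - (\<integral>x. (MAX v\<in>Y. \<theta> v \<bullet> feature x) \<partial>\<mu>') \<le> D"
        if "\<And>v. v \<in> Y \<Longrightarrow> norm (\<theta> v) \<le> R" for \<theta>
        using D[of \<theta>, OF that] by linarith
    qed (use True K \<eta> in auto)
  next
    case False
    have "16 * ?A \<le> R * (D + t)"
    proof (cases "?A' \<le> K")
      case False
      \<comment> \<open>\<open>K\<close> exceeds the second moment of \<mu> by at least 1, so a
        sample second moment above \<open>K\<close> deviates by at least 1.\<close>
      then have "1 \<le> D" using D_A K by linarith
      then have "K * 1 \<le> K * D" using K1 by (intro mult_left_mono) auto
      then have "16 * ?A \<le> 16 * K * D" using K by linarith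
      also have "\<dots> \<le> R * (D + t)" using R2 D0 t0 K1 by (intro mult_mono) auto
      finally show ?thesis .
    next
      case True
      \<comment> \<open>A sample weight below half of \<eta> is off by at least that much, so
        \<open>t / \<eta>\<close> is bounded below and can absorb constants.\<close>
      with False obtain v where v: "v \<in> Y" "measure \<nu>' {v} < \<eta> / 2" by force
      then have "\<eta> / 2 \<le> \<bar>measure \<nu>' {v} - measure \<nu> {v}\<bar>" using \<eta>(2)[OF v(1)] by linarith
      also have "\<dots> \<le> t" unfolding t_def using v Y by (intro member_le_sum) auto
      finally have t\<eta>: "\<eta> \<le> 2 * t" by simp
      have "16 * ?A * \<eta> \<le> 16 * K * (2 * t)"
      proof (rule mult_mono)
        show "0 \<le> 16 * K" using K1 by simp
      qed (use K \<eta> t\<eta> in auto)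
      then have "16 * ?A * \<eta> \<le> 32 * K * t" by simp
      then have "16 * ?A \<le> 32 * K / \<eta> * t" using \<eta> by (simp add: field_simps)
      also have "\<dots> \<le> R * (D + t)" using R3 R2 D0 t0 K1 \<eta> by (intro mult_mono) auto
      finally show ?thesis .
    qed
    then show ?thesis using \<pi>1 e by (intro alignment_compare_trivial[OF M M' N N'])
  qed
  \<comment> \<open>Now the population is dualised and light atoms of the sample do no harm, but the
    crude bound involves the second moment of the sample.\<close>
  have al': "\<exists>\<pi>2\<in>couplings \<mu> \<nu>. alignment \<pi>1 \<le> alignment \<pi>2 + R * (D + t) + e"
    if \<pi>1: "\<pi>1 \<in> couplings \<mu>' \<nu>'" and e: "0 < e" for \<pi>1 e
  proof (cases "?A' \<le> K")
    case True
    show ?thesis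
      unfolding t_def
    proof (rule alignment_compare[OF M' M N' N Y0 _ _ K1 _ _ _ _ \<pi>1 e])
      show "R = 138 * K\<^sup>2 / (\<eta> / 2)" by (simp add: R)
      show "\<eta> / 2 \<le> measure \<nu> {v}" if "v \<in> Y" for v using \<eta>(1) \<eta>(2)[OF that] by linarith
      show "(\<integral>x. (MAX v\<in>Y. \<theta> v \<bullet> feature x) \<partial>\<mu>') - (\<integral>x. (MAX v\<in>Y. \<theta> v \<bullet> feature x) \<partial>\<mu>) \<le> D"
        if "\<And>v. v \<in> Y \<Longrightarrow> norm (\<theta> v) \<le> R" for \<theta>
        using D[of \<theta>, OF that] by linarith
    qed (use True K \<eta> in auto)
  next
    case False
    then have D1: "1 \<le> D" using D_A K by linarith
    \<comment> \<open>The sample second moment is the population one plus a deviation; with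
      \<open>1 \<le> D\<close> this is at most \<open>K * D\<close>.\<close>
    have "?A' \<le> K - 1 + D" using D_A K by linarith
    also have "\<dots> \<le> (K - 1) * D + D" using K1 D1 by (simp add: mult_left_le mult_le_cancel_left1)
    also have "\<dots> = K * D" by (simp add: algebra_simps)
    finally have "16 * ?A' \<le> 16 * K * D" by simp
    also have "\<dots> \<le> R * (D + t)" using R2 D0 t0 K1 by (intro mult_mono) auto
    finally show ?thesis using \<pi>1 e by (intro alignment_compare_trivial[OF M' M N' N])
  qed
  have E: "\<bar>fourth_power_energy \<nu>' - fourth_power_energy \<nu>\<bar> \<le> R * (D + t)"
  proof -
    have "\<bar>fourth_power_energy \<nu>' - fourth_power_energy \<nu>\<bar> \<le> 32 * t"
      unfolding t_def by (rule fourth_power_energy_supported_in[OF N' N])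
    also have "\<dots> \<le> R * (D + t)" using R2 D0 t0 by (intro mult_mono) auto
    finally show ?thesis .
  qed
  have d1: "GW_sq \<mu>' \<nu>' - GW_sq \<mu> \<nu> \<le> \<bar>fourth_power_energy \<mu>' - fourth_power_energy \<mu>\<bar>
      + \<bar>fourth_power_energy \<nu>' - fourth_power_energy \<nu>\<bar> + 2 * (R * (D + t))"
    by (rule GW_sq_diff_le_aux[OF M M' N N' al])
  have d2: "GW_sq \<mu> \<nu> - GW_sq \<mu>' \<nu>' \<le> \<bar>fourth_power_energy \<mu> - fourth_power_energy \<mu>'\<bar>
      + \<bar>fourth_power_energy \<nu> - fourth_power_energy \<nu>'\<bar> + 2 * (R * (D + t))"
    by (rule GW_sq_diff_le_aux[OF M' M N' N al'])
  \<comment> \<open>The factor 3 is twice the alignment bound plus the energy of the discrete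
    marginal.\<close>
  show ?thesis
    unfolding t_def[symmetric] mult.assoc using d1 d2 E by linarith
qed

section \<open>Integrals of discrete and empirical measures\<close>

lemma discrete_measure_eq_distr:
  fixes z :: "nat \<Rightarrow> 'a::euclidean_space"
  shows "discrete_measure k w z = distr (density (count_space {1..k}) (\<lambda>j. ennreal (w j))) borel z"
proof (rule measure_eqI)
  fix A assume "A \<in> sets (discrete_measure k w z)"
  then have A: "A \<in> sets borel" by simp
  have "emeasure (distr (density (count_space {1..k}) (\<lambda>j. ennreal (w j))) borel z) A
    = (\<integral>\<^sup>+j. ennreal (w j) * indicator (z -` A \<inter> {1..k}) j \<partial>count_space {1..k})"
    using A by (subst emeasure_distr) (auto simp: emeasure_density)
  also have "\<dots> = (\<Sum>j = 1..k. ennreal (w j) * indicator A (z j))"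
    by (subst nn_integral_count_space_finite) (auto intro!: sum.cong simp: indicator_def)
  finally show "emeasure (discrete_measure k w z) A = emeasure (distr (density (count_space {1..k}) (\<lambda>j. ennreal (w j))) borel z) A"
    using emeasure_discrete_measure[OF A] by metis
qed simp

lemma integral_discrete_measure:
  fixes z :: "nat \<Rightarrow> 'a::euclidean_space" and f :: "'a \<Rightarrow> 'c::{banach, second_countable_topology}"
  assumes w: "\<And>j. j \<in> {1..k} \<Longrightarrow> 0 \<le> w j" and f: "f \<in> borel_measurable borel"
  shows "integral\<^sup>L (discrete_measure k w z) f = (\<Sum>j = 1..k. w j *\<^sub>R f (z j))"
    and "integrable (discrete_measure k w z) f"
proof -
  let ?C = "count_space {1..k}"
  have w0: "AE j in ?C. 0 \<le> w j" using w by (simp add: AE_count_space)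
  have z: "z \<in> density ?C (\<lambda>j. ennreal (w j)) \<rightarrow>\<^sub>M borel" by simp
  have "integral\<^sup>L (discrete_measure k w z) f = (\<integral>j. f (z j) \<partial>density ?C (\<lambda>j. ennreal (w j)))"
    unfolding discrete_measure_eq_distr by (rule integral_distr[OF z f])
  also have "\<dots> = (\<integral>j. w j *\<^sub>R f (z j) \<partial>?C)"
    by (rule integral_density) (use w0 in auto)
  also have "\<dots> = (\<Sum>j = 1..k. w j *\<^sub>R f (z j))"
    by (simp add: lebesgue_integral_count_space_finite)
  finally show "integral\<^sup>L (discrete_measure k w z) f = (\<Sum>j = 1..k. w j *\<^sub>R f (z j))" .
  have "integrable (density ?C (\<lambda>j. ennreal (w j))) (\<lambda>j. f (z j))"
    by (subst integrable_density) (use w0 in \<open>auto simp: integrable_count_space\<close>)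
  then show "integrable (discrete_measure k w z) f"
    unfolding discrete_measure_eq_distr by (subst integrable_distr_eq[OF z f])
qed

lemma measure_discrete_measure:
  assumes "\<And>j. j \<in> {1..k} \<Longrightarrow> 0 \<le> w j"
  shows "measure (discrete_measure k w z) {v} = (\<Sum>j = 1..k. w j * indicator {v} (z j))"
proof -
  have "measure (discrete_measure k w z) {v} = integral\<^sup>L (discrete_measure k w z) (indicator {v})" by simp
  also have "\<dots> = (\<Sum>j = 1..k. w j * indicator {v} (z j))"
    by (subst integral_discrete_measure(1)) (use assms in auto)
  finally show ?thesis .
qed

lemma supported_in_discrete_measure:
  assumes w: "\<And>j. j \<in> {1..k} \<Longrightarrow> 0 \<le> w j" "(\<Sum>j = 1..k. w j) = 1"
    and z: "\<And>j. j \<in> {1..k} \<Longrightarrow> z j \<in> Y" and Y: "finite Y" "Y \<subseteq> cball 0 1"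
  shows "supported_in Y (discrete_measure k w z)"
proof -
  have "AE y in discrete_measure k w z. y \<in> Y"
  proof (rule AE_I')
    have "emeasure (discrete_measure k w z) (- Y) = 0"
      using Y z by (subst emeasure_discrete_measure) (auto intro!: borel_open simp: finite_imp_closed open_Compl)
    then show "- Y \<in> null_sets (discrete_measure k w z)"
      using Y by (auto simp: null_sets_def intro!: borel_open finite_imp_closed open_Compl)
  qed auto
  then show ?thesis
    using prob_space_discrete_measure[OF w] Y by (simp add: supported_in_def)
qed

lemma finite_fourth_moment_empirical: "1 \<le> n \<Longrightarrow> finite_fourth_moment (empirical n x)"
  unfolding finite_fourth_moment_def empirical_def
  by (auto intro!: prob_space_discrete_measure integral_discrete_measure(2))

lemma integral_empirical:
  "f \<in> borel_measurable borel \<Longrightarrow> integral\<^sup>L (empirical n x) f = (\<Sum>i = 1..n. f (x i)) / real n"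
  for f :: "_ \<Rightarrow> real"
  unfolding empirical_def by (subst integral_discrete_measure(1)) (auto simp: sum_divide_distrib)

lemma fourth_power_energy_empirical:
  "fourth_power_energy (empirical n x) = (\<Sum>i = 1..n. \<Sum>j = 1..n. norm (x i - x j) ^ 4) / (real n)\<^sup>2"
proof -
  have m: "(\<lambda>v. norm (u - v) ^ 4) \<in> borel_measurable borel" for u :: 'a by measurable
  have "(\<integral>v. norm (u - v) ^ 4 \<partial>empirical n x) = (\<Sum>j = 1..n. norm (u - x j) ^ 4) / real n" for u
    by (rule integral_empirical[OF m])
  then have "fourth_power_energy (empirical n x) = (\<integral>u. (\<Sum>j = 1..n. norm (u - x j) ^ 4) / real n \<partial>empirical n x)"
    by (simp add: fourth_power_energy_def)
  also have "\<dots> = (\<Sum>i = 1..n. (\<Sum>j = 1..n. norm (x i - x j) ^ 4) / real n) / real n"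
    by (rule integral_empirical) measurable
  finally show ?thesis by (simp add: sum_divide_distrib power2_eq_square)
qed

section \<open>Convergence rate of the plug-in estimator\<close>

text \<open>A countable parameter set keeps the suprema measurable. The zero parameter is added by
  hand to serve as the base point of the contraction, and functions are restricted to the finite
  \<open>Y\<close> to stay countable.\<close>

lemma countable_dense_parameters:
  fixes R :: real and Y :: "'b set"
  assumes "finite Y" "0 < R"
  obtains T :: "('b \<Rightarrow> 'e::euclidean_space) set" and o' where "countable T"
    "\<And>t v. t \<in> T \<Longrightarrow> v \<in> Y \<Longrightarrow> norm (t v) \<le> R"
    "o' \<in> T" "\<And>v. v \<in> Y \<Longrightarrow> o' v = 0"
    "\<And>\<theta> \<epsilon>. (\<And>v. v \<in> Y \<Longrightarrow> norm (\<theta> v) \<le> R) \<Longrightarrow> 0 < \<epsilon> \<Longrightarrow> \<exists>t\<in>T. \<forall>v\<in>Y. norm (\<theta> v - t v) \<le> \<epsilon>"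
proof -
  obtain D :: "'e set" where D: "countable D" "\<And>X. open X \<Longrightarrow> X \<noteq> {} \<Longrightarrow> \<exists>d\<in>D. d \<in> X"
    using countable_dense_exists[where 'a='e] by auto
  define S where "S = insert 0 (D \<inter> ball 0 R)"
  define T where "T = (\<Pi>\<^sub>E v\<in>Y. S)"
  show ?thesis
  proof
    show "countable T" unfolding T_def S_def using assms D by (intro countable_PiE) auto
    show "norm (t v) \<le> R" if "t \<in> T" "v \<in> Y" for t v
      using that assms by (auto simp: T_def S_def PiE_def Pi_def)
    show "(\<lambda>v\<in>Y. 0) \<in> T" by (auto simp: T_def S_def)
    show "(\<lambda>v\<in>Y. 0) v = (0 :: 'e)" if "v \<in> Y" for v using that by simp
    fix \<theta> :: "'b \<Rightarrow> 'e" and \<epsilon> :: real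
    assume \<theta>: "\<And>v. v \<in> Y \<Longrightarrow> norm (\<theta> v) \<le> R" and \<epsilon>: "0 < \<epsilon>"
    have "\<exists>d\<in>S. norm (\<theta> v - d) \<le> \<epsilon>" if v: "v \<in> Y" for v
    proof -
      \<comment> \<open>Points on the sphere are approximated from inside, so the elements of
        \<open>T\<close> respect the bound \<open>R\<close>.\<close>
      have "\<theta> v \<in> closure (ball 0 R)" using \<theta>[OF v] assms by simp
      then have "ball (\<theta> v) \<epsilon> \<inter> ball 0 R \<noteq> {}"
        using \<epsilon> by (simp add: closure_iff_nhds_not_empty) (metis Int_commute centre_in_ball open_ball order_refl)
      then obtain d where "d \<in> D" "d \<in> ball (\<theta> v) \<epsilon> \<inter> ball 0 R"
        using D(2)[of "ball (\<theta> v) \<epsilon> \<inter> ball 0 R"] by blast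
      then show ?thesis by (intro bexI[of _ d]) (auto simp: S_def dist_norm)
    qed
    then obtain d where d: "\<And>v. v \<in> Y \<Longrightarrow> d v \<in> S" "\<And>v. v \<in> Y \<Longrightarrow> norm (\<theta> v - d v) \<le> \<epsilon>"
      by metis
    then show "\<exists>t\<in>T. \<forall>v\<in>Y. norm (\<theta> v - t v) \<le> \<epsilon>"
      by (intro bexI[of _ "restrict d Y"]) (auto simp: T_def)
  qed
qed

lemma abs_Max_inner_diff_le:
  fixes \<theta> t :: "'b \<Rightarrow> 'e::real_inner"
  assumes Y: "finite Y" "Y \<noteq> {}" and le: "\<And>v. v \<in> Y \<Longrightarrow> norm (\<theta> v - t v) \<le> \<epsilon>"
  shows "\<bar>(MAX v\<in>Y. \<theta> v \<bullet> x) - (MAX v\<in>Y. t v \<bullet> x)\<bar> \<le> \<epsilon> * norm x"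
proof -
  have *: "(MAX v\<in>Y. a v \<bullet> x) \<le> (MAX v\<in>Y. b v \<bullet> x) + \<epsilon> * norm x"
    if ab: "\<And>v. v \<in> Y \<Longrightarrow> norm (a v - b v) \<le> \<epsilon>" for a b :: "'b \<Rightarrow> 'e"
  proof -
    have "(MAX v\<in>Y. a v \<bullet> x) \<in> (\<lambda>v. a v \<bullet> x) ` Y" using Y by (intro Max_in) auto
    then obtain k where k: "k \<in> Y" "(MAX v\<in>Y. a v \<bullet> x) = a k \<bullet> x" by auto
    have "a k \<bullet> x = b k \<bullet> x + (a k - b k) \<bullet> x" by (simp add: inner_diff_left)
    also have "(a k - b k) \<bullet> x \<le> \<epsilon> * norm x"
      by (intro order_trans[OF norm_cauchy_schwarz] mult_right_mono ab k) auto
    also have "b k \<bullet> x \<le> (MAX v\<in>Y. b v \<bullet> x)" using Y k by (intro Max_ge) auto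
    finally show ?thesis using k by simp
  qed
  show ?thesis
    using *[of \<theta> t, OF le] *[of t \<theta>] le by (simp add: norm_minus_commute abs_le_iff)
qed

text \<open>For a fixed sample the centred sum is Lipschitz in the parameter. Its Lipschitz constant
  \<open>C\<close> depends on the sample, but the approximation may be chosen after it.\<close>

lemma centered_sum_le_SUP:
  fixes \<phi> :: "'a \<Rightarrow> 'e::euclidean_space" and s :: real and x :: "'i \<Rightarrow> 'a"
  assumes \<mu>: "prob_space \<mu>" and \<phi>: "integrable \<mu> \<phi>" and Y: "finite Y" "Y \<noteq> {}" and fin: "finite I"
    and dense: "\<And>\<epsilon>. 0 < \<epsilon> \<Longrightarrow> \<exists>t\<in>T. \<forall>v\<in>Y. norm (\<theta> v - t v) \<le> \<epsilon>"
    and s: "\<bar>s\<bar> \<le> 1"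
  defines "S \<equiv> \<lambda>t. s * (\<Sum>i\<in>I. (MAX v\<in>Y. t v \<bullet> \<phi> (x i)) - (\<integral>y. (MAX v\<in>Y. t v \<bullet> \<phi> y) \<partial>\<mu>))"
  shows "ennreal (S \<theta>) \<le> (SUP t\<in>T. ennreal (S t))"
proof (cases "(SUP t\<in>T. ennreal (S t)) = \<top>")
  case False
  interpret prob_space \<mu> by fact
  define r where "r = enn2real (SUP t\<in>T. ennreal (S t))"
  have r: "(SUP t\<in>T. ennreal (S t)) = ennreal r" 
  proof -
    have "(SUP t\<in>T. ennreal (S t)) < \<top>" using False top.not_eq_extremum by blast
    then show ?thesis by (simp only: r_def ennreal_enn2real)
  qed
  have r0: "0 \<le> r" by (simp add: r_def)
  have le_r: "S t \<le> r" if "t \<in> T" for t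
    using SUP_upper[OF that, of "\<lambda>t. ennreal (S t)"] r0 unfolding r by (simp add: ennreal_le_iff)
  define F where "F t y = (MAX v\<in>Y. t v \<bullet> \<phi> y)" for t y
  define C where "C = (\<Sum>i\<in>I. norm (\<phi> (x i)) + (\<integral>y. norm (\<phi> y) \<partial>\<mu>))"
  have C0: "0 \<le> C" unfolding C_def by (intro sum_nonneg add_nonneg_nonneg) auto
  have [measurable]: "\<phi> \<in> borel_measurable \<mu>" using \<phi> by auto
  have F_int: "integrable \<mu> (F t)" for t
  proof (rule Bochner_Integration.integrable_bound[of _ "\<lambda>y. (\<Sum>v\<in>Y. norm (t v)) * norm (\<phi> y)"])
    have "\<bar>F t y\<bar> \<le> (\<Sum>v\<in>Y. norm (t v)) * norm (\<phi> y)" for y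
      unfolding F_def
    proof (rule abs_Max_le[OF Y])
      fix v assume "v \<in> Y"
      then show "\<bar>t v \<bullet> \<phi> y\<bar> \<le> (\<Sum>v\<in>Y. norm (t v)) * norm (\<phi> y)"
        using Y by (intro order_trans[OF Cauchy_Schwarz_ineq2] mult_right_mono member_le_sum) auto
    qed
    then show "AE y in \<mu>. norm (F t y) \<le> norm ((\<Sum>v\<in>Y. norm (t v)) * norm (\<phi> y))"
      by (intro AE_I2) (auto intro: order_trans[OF _ abs_ge_self])
    show "F t \<in> borel_measurable \<mu>" unfolding F_def using Y by (intro borel_measurable_Max) auto
  qed (use \<phi> in auto)
  have "S \<theta> \<le> r"
  proof (rule field_le_epsilon)
    fix e :: real assume e: "0 < e"
    \<comment> \<open>The \<open>+ 1\<close> covers \<open>C = 0\<close>.\<close>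
    define \<epsilon> where "\<epsilon> = e / (C + 1)"
    have \<epsilon>: "0 < \<epsilon>" "\<epsilon> * C \<le> e" using e C0 by (auto simp: \<epsilon>_def field_simps)
    obtain t where t: "t \<in> T" "\<And>v. v \<in> Y \<Longrightarrow> norm (\<theta> v - t v) \<le> \<epsilon>" using dense[OF \<epsilon>(1)] by blast
    have Fd: "\<bar>F \<theta> y - F t y\<bar> \<le> \<epsilon> * norm (\<phi> y)" for y
      unfolding F_def by (rule abs_Max_inner_diff_le[OF Y t(2)])
    have Id: "\<bar>(\<integral>y. F \<theta> y \<partial>\<mu>) - (\<integral>y. F t y \<partial>\<mu>)\<bar> \<le> \<epsilon> * (\<integral>y. norm (\<phi> y) \<partial>\<mu>)"
    proof -
      have "\<bar>(\<integral>y. F \<theta> y \<partial>\<mu>) - (\<integral>y. F t y \<partial>\<mu>)\<bar> = \<bar>\<integral>y. F \<theta> y - F t y \<partial>\<mu>\<bar>"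
        using F_int by simp
      also have "\<dots> \<le> (\<integral>y. \<bar>F \<theta> y - F t y\<bar> \<partial>\<mu>)" by (rule integral_abs_bound)
      also have "\<dots> \<le> (\<integral>y. \<epsilon> * norm (\<phi> y) \<partial>\<mu>)"
        using F_int \<phi> Fd by (intro integral_mono) auto
      finally show ?thesis by simp
    qed
    have "S \<theta> - S t = s * (\<Sum>i\<in>I. (F \<theta> (x i) - F t (x i)) - ((\<integral>y. F \<theta> y \<partial>\<mu>) - (\<integral>y. F t y \<partial>\<mu>)))"
      unfolding S_def F_def[symmetric] right_diff_distrib[symmetric] sum_subtractf[symmetric]
      by (simp add: algebra_simps)
    also have "\<dots> \<le> \<bar>s\<bar> * \<bar>\<Sum>i\<in>I. (F \<theta> (x i) - F t (x i)) - ((\<integral>y. F \<theta> y \<partial>\<mu>) - (\<integral>y. F t y \<partial>\<mu>))\<bar>"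
      unfolding abs_mult[symmetric] by (rule abs_ge_self)
    also have "\<dots> \<le> 1 * (\<Sum>i\<in>I. \<epsilon> * norm (\<phi> (x i)) + \<epsilon> * (\<integral>y. norm (\<phi> y) \<partial>\<mu>))"
    proof (intro mult_mono s order_trans[OF sum_abs] sum_mono)
      fix i
      show "\<bar>(F \<theta> (x i) - F t (x i)) - ((\<integral>y. F \<theta> y \<partial>\<mu>) - (\<integral>y. F t y \<partial>\<mu>))\<bar>
          \<le> \<epsilon> * norm (\<phi> (x i)) + \<epsilon> * (\<integral>y. norm (\<phi> y) \<partial>\<mu>)"
        by (intro order_trans[OF abs_triangle_ineq4] add_mono Fd Id)
    qed auto
    also have "\<dots> = \<epsilon> * C" by (simp add: C_def sum_distrib_left distrib_left)
    finally show "S \<theta> \<le> r + e" using le_r[OF t(1)] \<epsilon>(2) by linarith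
  qed
  then show ?thesis unfolding r by (rule ennreal_leI)
next
  case True
  then show ?thesis by (simp only: top_greatest)
qed

text \<open>The stability bound separates into a function of the first sample and one of the second,
  so the expectation over the product space splits and each part is handled by its own deviation
  bound.\<close>

lemma expected_error_le:
  fixes \<mu> :: "'a::euclidean_space measure" and \<nu> :: "'b::euclidean_space measure" and p L \<eta> R :: real
  assumes M: "finite_fourth_moment \<mu>" and N: "supported_in Y \<nu>" and Y0: "Y \<noteq> {}"
    and \<eta>: "0 < \<eta>" "\<And>v. v \<in> Y \<Longrightarrow> \<eta> \<le> measure \<nu> {v}"
    and p: "1 < p" "p \<le> 2" and L: "1 \<le> L" "(\<integral>x. (norm x)\<^sup>2 \<partial>\<mu>) \<le> L" "(\<integral>x. norm x ^ 4 \<partial>\<mu>) \<le> L"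
      "(\<integral>\<^sup>+x. ennreal ((norm x ^ 4) powr p) \<partial>\<mu>) \<le> ennreal L"
    and R: "R = 276 * (L + 1)\<^sup>2 / \<eta>" and nm: "1 \<le> n" "1 \<le> m"
  shows "expected_error n m \<mu> \<nu> \<le> ennreal (51 * (64 * L + 1)\<^sup>2 * real n powr (1 / p - 1)
    + 6 * R\<^sup>2 * card Y * sqrt (4 * (2 * L + 1)) * real n powr (- 1 / 2)
    + 12 * R * card Y * real m powr (- 1 / 2))"
proof -
  note One_nat_def[simp del]
  note F = finite_fourth_momentD[OF M]
  interpret M: prob_space \<mu> by (rule F)
  have N': "sets \<nu> = sets borel" "prob_space \<nu>" "finite Y" "Y \<subseteq> cball 0 1" "AE y in \<nu>. y \<in> Y"
    using N by (auto simp: supported_in_def)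
  interpret N: prob_space \<nu> by (rule N')
  note [measurable_cong] = F(2) N'(1)
  interpret PN: prob_space "PiM {1..m} (\<lambda>_. \<nu>)" by (rule prob_space_PiM) (rule N')
  interpret PM: prob_space "PiM {1..n} (\<lambda>_. \<mu>)" by (rule prob_space_PiM) (rule F)
  have R0: "0 < R" using \<eta> L by (simp add: R)
  have n0: "0 < real n" "0 < real m" using nm by auto
  obtain T :: "('b \<Rightarrow> real \<times> 'a \<times> real) set" and o' where T: "countable T"
    "\<And>t v. t \<in> T \<Longrightarrow> v \<in> Y \<Longrightarrow> norm (t v) \<le> R"
    "o' \<in> T" "\<And>v. v \<in> Y \<Longrightarrow> o' v = 0"
    "\<And>\<theta> \<epsilon>. (\<And>v. v \<in> Y \<Longrightarrow> norm (\<theta> v) \<le> R) \<Longrightarrow> 0 < \<epsilon> \<Longrightarrow> \<exists>t\<in>T. \<forall>v\<in>Y. norm (\<theta> v - t v) \<le> \<epsilon>"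
    using countable_dense_parameters[OF N'(3) R0, where 'e="real \<times> 'a \<times> real"] by blast
  define S where "S t x = (\<Sum>i = 1..n. (MAX v\<in>Y. t v \<bullet> feature (x i)) - (\<integral>y. (MAX v\<in>Y. t v \<bullet> feature y) \<partial>\<mu>))"
    for t and x :: "nat \<Rightarrow> 'a"
  \<comment> \<open>One supremum for each sign, as the empirical process bound treats a fixed sign;
    their sum controls the modulus.\<close>
  define D where "D s x = (SUP t\<in>T. ennreal (s * S t x))" for s :: real and x
  have feature_meas[measurable]: "feature \<in> borel_measurable borel"
    unfolding feature_def by (intro borel_measurable_continuous_onI continuous_intros)
  have feature_sq: "(norm (feature x))\<^sup>2 = norm x ^ 4 + (norm x)\<^sup>2 + 1" for x :: 'a
    by (simp add: feature_def norm_Pair power_mult[symmetric])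
  have V: "(\<integral>\<^sup>+x. ennreal ((norm (feature x))\<^sup>2) \<partial>\<mu>) \<le> ennreal (2 * L + 1)"
  proof -
    have "(\<integral>\<^sup>+x. ennreal ((norm (feature x))\<^sup>2) \<partial>\<mu>) = ennreal (\<integral>x. norm x ^ 4 + (norm x)\<^sup>2 + 1 \<partial>\<mu>)"
      unfolding feature_sq using F by (intro nn_integral_eq_integral) auto
    also have "(\<integral>x. norm x ^ 4 + (norm x)\<^sup>2 + 1 \<partial>\<mu>) = (\<integral>x. norm x ^ 4 \<partial>\<mu>) + (\<integral>x. (norm x)\<^sup>2 \<partial>\<mu>) + 1"
      using F by (simp add: M.prob_space)
    also have "ennreal \<dots> \<le> ennreal (2 * L + 1)" using L by (intro ennreal_leI) linarith
    finally show ?thesis .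
  qed
  have feature_int: "integrable \<mu> feature"
  proof (rule Bochner_Integration.integrable_bound[of _ "\<lambda>x. (norm x)\<^sup>2 + (norm x + 1)"])
    have "norm (feature x) \<le> (norm x)\<^sup>2 + (norm x + 1)" for x :: 'a
      unfolding feature_def
      using norm_Pair_le[of "(norm x)\<^sup>2" "(x, 1 :: real)"] norm_Pair_le[of x "1 :: real"] by simp
    then show "AE x in \<mu>. norm (feature x) \<le> norm ((norm x)\<^sup>2 + (norm x + 1))"
      by (intro AE_I2) (auto intro: order_trans[OF _ abs_ge_self])
  qed (use F in auto)
  have D_meas[measurable]: "D s \<in> borel_measurable (PiM {1..n} (\<lambda>_. \<mu>))" for s
    unfolding D_def S_def using T(1) N'(3)
    by (intro borel_measurable_SUP) (auto intro!: borel_measurable_sum borel_measurable_times borel_measurable_diff borel_measurable_Max)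
  have D_int: "(\<integral>\<^sup>+x. D s x \<partial>PiM {1..n} (\<lambda>_. \<mu>)) \<le> ennreal (R * (card Y * sqrt (4 * n * (2 * L + 1))))"
    if "s = 1 \<or> s = - 1" for s
  proof -
    have "(\<integral>\<^sup>+x. (SUP t\<in>T. ennreal ((\<Sum>v\<in>Y. t v \<bullet> 0) + s * S t x)) \<partial>PiM {1..n} (\<lambda>_. \<mu>))
        \<le> ennreal (R * (\<Sum>v\<in>Y. sqrt ((norm (0 :: real \<times> 'a \<times> real))\<^sup>2 + 4 * card {1..n} * (2 * L + 1))))"
      unfolding S_def
      by (rule empirical_process_bound[where o'=o']) (use F(1) V N'(3) Y0 T(1-4) that R0 L in auto)
    then show ?thesis by (simp add: D_def)
  qed
  define E where "E x = ennreal \<bar>fourth_power_energy (empirical n x) - fourth_power_energy \<mu>\<bar>" for x :: "nat \<Rightarrow> 'a"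
  have E_meas[measurable]: "E \<in> borel_measurable (PiM {1..n} (\<lambda>_. \<mu>))"
    unfolding E_def fourth_power_energy_empirical by measurable
  have E_int: "(\<integral>\<^sup>+x. E x \<partial>PiM {1..n} (\<lambda>_. \<mu>)) \<le> ennreal (51 * (64 * L + 1)\<^sup>2 * real n powr (1 / p - 1))"
    unfolding E_def fourth_power_energy_empirical unfolding fourth_power_energy_def
  proof (rule V_statistic_deviation[OF F(1), where b="\<lambda>x. 8 * norm x ^ 4"])
    show "(\<lambda>(x, y). norm (x - y) ^ 4) \<in> borel_measurable (\<mu> \<Otimes>\<^sub>M \<mu>)" by measurable
    show "norm (x - y) ^ 4 \<le> 8 * norm x ^ 4 + 8 * norm y ^ 4" for x y :: 'a by (rule norm_diff_pow4_le)
    \<comment> \<open>The dominating function is \<open>8 * norm x ^ 4\<close>, and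
      \<open>8 powr p \<le> 64\<close> since \<open>p \<le> 2\<close>.\<close>
    have "(\<integral>\<^sup>+x. ennreal ((8 * norm x ^ 4) powr p) \<partial>\<mu>) \<le> (\<integral>\<^sup>+x. ennreal 64 * ennreal ((norm x ^ 4) powr p) \<partial>\<mu>)"
    proof (rule nn_integral_mono)
      fix x :: 'a
      have "(8 * norm x ^ 4) powr p = 8 powr p * (norm x ^ 4) powr p" by (simp add: powr_mult)
      also have "\<dots> \<le> 8 powr 2 * (norm x ^ 4) powr p" using p by (intro mult_right_mono powr_mono) auto
      finally have "ennreal ((8 * norm x ^ 4) powr p) \<le> ennreal (64 * (norm x ^ 4) powr p)" by (intro ennreal_leI) simp
      then show "ennreal ((8 * norm x ^ 4) powr p) \<le> ennreal 64 * ennreal ((norm x ^ 4) powr p)"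
        by (subst (asm) ennreal_mult) auto
    qed
    also have "\<dots> = ennreal 64 * (\<integral>\<^sup>+x. ennreal ((norm x ^ 4) powr p) \<partial>\<mu>)" by (intro nn_integral_cmult) measurable
    also have "\<dots> \<le> ennreal 64 * ennreal L" using L by (intro mult_left_mono) auto
    also have "\<dots> = ennreal (64 * L)" using L by (subst ennreal_mult) auto
    finally show "(\<integral>\<^sup>+x. ennreal ((8 * norm x ^ 4) powr p) \<partial>\<mu>) \<le> ennreal (64 * L)" .
  qed (use p L nm in auto)
  define W where "W v y = ennreal \<bar>\<Sum>j = 1..m. indicator {v} (y j) - measure \<nu> {v}\<bar>" for v and y :: "nat \<Rightarrow> 'b"
  have W_meas[measurable]: "W v \<in> borel_measurable (PiM {1..m} (\<lambda>_. \<nu>))" for v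
    unfolding W_def by measurable
  \<comment> \<open>Indicators are bounded by 1, so the deviation bound with exponent 2 and
    \<open>K = 1\<close> gives the factor \<open>3 * 1 + 1\<close>.\<close>
  have W_int: "(\<integral>\<^sup>+y. W v y \<partial>PiM {1..m} (\<lambda>_. \<nu>)) \<le> ennreal (4 * real m powr (1 / 2))" for v
  proof -
    have "(\<integral>\<^sup>+y. W v y \<partial>PiM {1..m} (\<lambda>_. \<nu>)) \<le> ennreal ((3 * 1 + 1) * real m powr (1 / 2))"
    proof -
      have "(\<integral>x. indicator {v} x \<partial>\<nu>) = measure \<nu> {v}" by simp
      moreover have "(\<integral>\<^sup>+x. ennreal (indicator {v} x powr 2) \<partial>\<nu>) \<le> ennreal 1"
      proof -
        have "(\<integral>\<^sup>+x. ennreal (indicator {v} x powr 2) \<partial>\<nu>) \<le> (\<integral>\<^sup>+x. 1 \<partial>\<nu>)"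
          by (intro nn_integral_mono) (auto simp: indicator_def)
        then show ?thesis by (simp add: N.emeasure_space_1)
      qed
      ultimately show ?thesis
        using nn_integral_abs_sum_deviation_le[OF N'(2), of "indicator {v}" 2 1 "{1..m}" "real m"] nm
        by (simp add: W_def)
    qed
    then show ?thesis by simp
  qed
  define f where "f x = E x + ennreal (3 * R / n) * (D 1 x + D (- 1) x)" for x
  \<comment> \<open>The value \<top> on the null event that some \<open>y j\<close> misses
    \<open>Y\<close> makes \<open>f x + g y\<close> dominate the error everywhere.\<close>
  define g where "g y = (if \<forall>j\<in>{1..m}. y j \<in> Y then \<Sum>v\<in>Y. ennreal (3 * R / m) * W v y else \<top>)" for y :: "nat \<Rightarrow> 'b"
  have Y_sets[measurable]: "Y \<in> sets \<nu>" using N' by (auto intro!: borel_closed finite_imp_closed)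
  have f_meas[measurable]: "f \<in> borel_measurable (PiM {1..n} (\<lambda>_. \<mu>))"
    unfolding f_def by measurable
  have g_meas[measurable]: "g \<in> borel_measurable (PiM {1..m} (\<lambda>_. \<nu>))"
    unfolding g_def by measurable
  have pw: "ennreal \<bar>GW_sq (empirical n x) (empirical m y) - GW_sq \<mu> \<nu>\<bar> \<le> f x + g y" for x y
  proof (cases "D 1 x = \<top> \<or> D (- 1) x = \<top> \<or> \<not> (\<forall>j\<in>{1..m}. y j \<in> Y)")
    case True
    moreover have "ennreal (3 * R / n) \<noteq> 0" using R0 n0 by simp
    ultimately have "f x + g y = \<top>" by (auto simp: f_def g_def ennreal_mult_eq_top_iff)
    then show ?thesis by (simp only: top_greatest)
  next
    case False
    define d where "d s = enn2real (D s x)" for s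
    have d: "D 1 x = ennreal (d 1)" "D (- 1) x = ennreal (d (- 1))" and d0: "0 \<le> d s" for s
      using False by (auto simp: d_def less_top)
    have supp: "supported_in Y (empirical m y)"
      unfolding empirical_def using False N' nm by (intro supported_in_discrete_measure) auto
    have emp: "measure (empirical m y) {v} - measure \<nu> {v} = (\<Sum>j = 1..m. indicator {v} (y j) - measure \<nu> {v}) / real m" for v
      unfolding empirical_def using nm
      by (subst measure_discrete_measure) (auto simp: sum_subtractf sum_divide_distrib diff_divide_distrib)
    have "\<bar>GW_sq (empirical n x) (empirical m y) - GW_sq \<mu> \<nu>\<bar>
        \<le> \<bar>fourth_power_energy (empirical n x) - fourth_power_energy \<mu>\<bar>
          + 3 * R * ((d 1 + d (- 1)) / n + (\<Sum>v\<in>Y. \<bar>measure (empirical m y) {v} - measure \<nu> {v}\<bar>))"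
    proof (rule GW_sq_diff_le[OF M finite_fourth_moment_empirical[OF nm(1)] N supp Y0 _ \<eta> R])
      show "(\<integral>x. (norm x)\<^sup>2 \<partial>\<mu>) + 1 \<le> L + 1" using L by simp
      fix \<theta> :: "'b \<Rightarrow> real \<times> 'a \<times> real" assume \<theta>: "\<And>v. v \<in> Y \<Longrightarrow> norm (\<theta> v) \<le> R"
      have S_le: "s * S \<theta> x \<le> d s" if s: "s = 1 \<or> s = - 1" for s
      proof -
        have "ennreal (s * S \<theta> x) \<le> D s x"
          unfolding D_def S_def
          by (rule centered_sum_le_SUP[OF F(1) feature_int N'(3) Y0]) (use T(5)[of \<theta>, OF \<theta>] s in auto)
        also have "\<dots> = ennreal (d s)" using d s by auto
        finally show ?thesis using d0 by (simp add: ennreal_le_iff)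
      qed
      have "(\<lambda>x. MAX v\<in>Y. \<theta> v \<bullet> feature x) \<in> borel_measurable borel"
        using N'(3) by (intro borel_measurable_Max) auto
      from integral_empirical[OF this]
      have "(\<integral>x. (MAX v\<in>Y. \<theta> v \<bullet> feature x) \<partial>empirical n x) - (\<integral>x. (MAX v\<in>Y. \<theta> v \<bullet> feature x) \<partial>\<mu>) = S \<theta> x / n"
        using n0 by (simp add: S_def sum_subtractf diff_divide_distrib)
      moreover have "\<bar>S \<theta> x\<bar> \<le> d 1 + d (- 1)" using S_le[of 1] S_le[of "- 1"] d0[of 1] d0[of "- 1"] by auto
      ultimately show "\<bar>(\<integral>x. (MAX v\<in>Y. \<theta> v \<bullet> feature x) \<partial>empirical n x) - (\<integral>x. (MAX v\<in>Y. \<theta> v \<bullet> feature x) \<partial>\<mu>)\<bar>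
          \<le> (d 1 + d (- 1)) / n"
        by (simp add: divide_right_mono)
    qed
    also have "\<dots> = \<bar>fourth_power_energy (empirical n x) - fourth_power_energy \<mu>\<bar> + 3 * R / n * (d 1 + d (- 1))
        + (\<Sum>v\<in>Y. 3 * R / m * \<bar>\<Sum>j = 1..m. indicator {v} (y j) - measure \<nu> {v}\<bar>)"
      using n0 by (simp add: emp abs_divide distrib_left sum_distrib_left mult.assoc add_divide_distrib)
    finally have "ennreal \<bar>GW_sq (empirical n x) (empirical m y) - GW_sq \<mu> \<nu>\<bar> \<le> ennreal \<dots>"
      by (rule ennreal_leI)
    also have "\<dots> = f x + g y"
    proof -
      have "g y = ennreal (\<Sum>v\<in>Y. 3 * R / m * \<bar>\<Sum>j = 1..m. indicator {v} (y j) - measure \<nu> {v}\<bar>)"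
      proof -
        have "g y = (\<Sum>v\<in>Y. ennreal (3 * R / m) * ennreal \<bar>\<Sum>j = 1..m. indicator {v} (y j) - measure \<nu> {v}\<bar>)"
          using False by (simp add: g_def W_def)
        also have "\<dots> = (\<Sum>v\<in>Y. ennreal (3 * R / m * \<bar>\<Sum>j = 1..m. indicator {v} (y j) - measure \<nu> {v}\<bar>))"
          by (intro sum.cong refl ennreal_mult[symmetric]) (use R0 in auto)
        also have "\<dots> = ennreal (\<Sum>v\<in>Y. 3 * R / m * \<bar>\<Sum>j = 1..m. indicator {v} (y j) - measure \<nu> {v}\<bar>)"
          by (rule sum_ennreal) (use R0 in auto)
        finally show ?thesis .
      qed
      moreover have "f x = ennreal (\<bar>fourth_power_energy (empirical n x) - fourth_power_energy \<mu>\<bar> + 3 * R / n * (d 1 + d (- 1)))"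
      proof -
        have *: "ennreal (3 * R / n * (d 1 + d (- 1))) = ennreal (3 * R / n) * (ennreal (d 1) + ennreal (d (- 1)))"
          unfolding ennreal_plus[OF d0 d0, symmetric] by (rule ennreal_mult) (use R0 d0 in auto)
        show ?thesis
          unfolding f_def E_def d *[symmetric] by (rule ennreal_plus[symmetric]) (use R0 d0 in auto)
      qed
      ultimately show ?thesis
        using R0 d0 by (simp add: ennreal_plus[symmetric] sum_nonneg del: ennreal_plus)
    qed
    finally show ?thesis .
  qed
  \<comment> \<open>Only the majorant is shown to be measurable; monotonicity of the extended
    integral asks nothing of the error itself.\<close>
  have "expected_error n m \<mu> \<nu> \<le> (\<integral>\<^sup>+(x, y). f x + g y \<partial>(PiM {1..n} (\<lambda>_. \<mu>) \<Otimes>\<^sub>M PiM {1..m} (\<lambda>_. \<nu>)))"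
    unfolding expected_error_def using pw by (intro nn_integral_mono) (auto simp: split_beta')
  also have "\<dots> = (\<integral>\<^sup>+x. \<integral>\<^sup>+y. f x + g y \<partial>PiM {1..m} (\<lambda>_. \<nu>) \<partial>PiM {1..n} (\<lambda>_. \<mu>))"
  proof -
    have m: "(\<lambda>(x, y). f x + g y) \<in> borel_measurable (PiM {1..n} (\<lambda>_. \<mu>) \<Otimes>\<^sub>M PiM {1..m} (\<lambda>_. \<nu>))"
      by measurable
    show ?thesis by (simp only: PN.nn_integral_fst[OF m, symmetric] prod.case)
  qed
  also have "\<dots> = (\<integral>\<^sup>+x. f x \<partial>PiM {1..n} (\<lambda>_. \<mu>)) + (\<integral>\<^sup>+y. g y \<partial>PiM {1..m} (\<lambda>_. \<nu>))"
    by (simp add: nn_integral_add PN.emeasure_space_1 PM.emeasure_space_1)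
  also have "\<dots> \<le> ennreal (51 * (64 * L + 1)\<^sup>2 * real n powr (1 / p - 1)
        + 6 * R\<^sup>2 * card Y * sqrt (4 * (2 * L + 1)) * real n powr (- 1 / 2))
      + ennreal (12 * R * card Y * real m powr (- 1 / 2))"
  proof (rule add_mono)
    let ?d = "R * (card Y * sqrt (4 * n * (2 * L + 1)))"
    have "(\<integral>\<^sup>+x. f x \<partial>PiM {1..n} (\<lambda>_. \<mu>)) = (\<integral>\<^sup>+x. E x \<partial>PiM {1..n} (\<lambda>_. \<mu>))
        + ennreal (3 * R / n) * ((\<integral>\<^sup>+x. D 1 x \<partial>PiM {1..n} (\<lambda>_. \<mu>)) + (\<integral>\<^sup>+x. D (- 1) x \<partial>PiM {1..n} (\<lambda>_. \<mu>)))"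
      unfolding f_def by (simp add: nn_integral_add nn_integral_cmult)
    also have "\<dots> \<le> ennreal (51 * (64 * L + 1)\<^sup>2 * real n powr (1 / p - 1)) + ennreal (3 * R / n) * (ennreal ?d + ennreal ?d)"
      by (intro add_mono mult_left_mono E_int D_int) auto
    also have "\<dots> = ennreal (51 * (64 * L + 1)\<^sup>2 * real n powr (1 / p - 1) + 3 * R / n * (?d + ?d))"
    proof -
      have d: "0 \<le> ?d" using R0 L by simp
      have *: "ennreal (3 * R / n * (?d + ?d)) = ennreal (3 * R / n) * (ennreal ?d + ennreal ?d)"
        unfolding ennreal_plus[OF d d, symmetric] by (rule ennreal_mult) (use R0 d in auto)
      show ?thesis
        unfolding *[symmetric] by (rule ennreal_plus[symmetric]) (use R0 d in auto)
    qed
    also have "3 * R / n * (?d + ?d) = 6 * R\<^sup>2 * card Y * sqrt (4 * (2 * L + 1)) * real n powr (- 1 / 2)"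
    proof -
      have s1: "sqrt (4 * n * (2 * L + 1)) = sqrt n * sqrt (4 * (2 * L + 1))"
        unfolding real_sqrt_mult[symmetric] by (simp add: algebra_simps)
      have s2: "sqrt n / n = real n powr (- 1 / 2)"
        using n0 by (simp add: powr_minus powr_half_sqrt field_simps)
      have "3 * R / n * (?d + ?d) = 6 * R\<^sup>2 * card Y * sqrt (4 * (2 * L + 1)) * (sqrt n / n)"
        unfolding s1 by (simp add: power2_eq_square)
      then show ?thesis unfolding s2 .
    qed
    finally show "(\<integral>\<^sup>+x. f x \<partial>PiM {1..n} (\<lambda>_. \<mu>)) \<le> ennreal (51 * (64 * L + 1)\<^sup>2 * real n powr (1 / p - 1)
        + 6 * R\<^sup>2 * card Y * sqrt (4 * (2 * L + 1)) * real n powr (- 1 / 2))" .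
    have "AE y in PiM {1..m} (\<lambda>_. \<nu>). y j \<in> Y" if "j \<in> {1..m}" for j
      using that N' by (intro AE_PiM_component) auto
    then have "AE y in PiM {1..m} (\<lambda>_. \<nu>). \<forall>j\<in>{1..m}. y j \<in> Y" by (intro AE_finite_allI) auto
    then have "AE y in PiM {1..m} (\<lambda>_. \<nu>). g y = (\<Sum>v\<in>Y. ennreal (3 * R / m) * W v y)"
      by eventually_elim (simp add: g_def)
    then have "(\<integral>\<^sup>+y. g y \<partial>PiM {1..m} (\<lambda>_. \<nu>)) = (\<integral>\<^sup>+y. (\<Sum>v\<in>Y. ennreal (3 * R / m) * W v y) \<partial>PiM {1..m} (\<lambda>_. \<nu>))"
      by (rule nn_integral_cong_AE)
    also have "\<dots> = (\<Sum>v\<in>Y. ennreal (3 * R / m) * (\<integral>\<^sup>+y. W v y \<partial>PiM {1..m} (\<lambda>_. \<nu>)))"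
      by (simp add: nn_integral_sum nn_integral_cmult)
    also have "\<dots> \<le> (\<Sum>v\<in>Y. ennreal (3 * R / m) * ennreal (4 * real m powr (1 / 2)))"
      by (intro sum_mono mult_left_mono W_int) auto
    also have "\<dots> = ennreal (card Y * (3 * R / m * (4 * real m powr (1 / 2))))"
      using R0 by (simp add: ennreal_mult[symmetric] ennreal_of_nat_eq_real_of_nat)
    also have "card Y * (3 * R / m * (4 * real m powr (1 / 2))) = 12 * R * card Y * real m powr (- 1 / 2)"
    proof -
      have s: "real m powr (1 / 2) / m = real m powr (- 1 / 2)"
        using n0 powr_diff[of "real m" "1 / 2" 1] by simp
      have "card Y * (3 * R / m * (4 * real m powr (1 / 2))) = 12 * R * card Y * (real m powr (1 / 2) / m)"
        by simp
      then show ?thesis unfolding s .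
    qed
    finally show "(\<integral>\<^sup>+y. g y \<partial>PiM {1..m} (\<lambda>_. \<nu>)) \<le> ennreal (12 * R * card Y * real m powr (- 1 / 2))" .
  qed
  also have "\<dots> = ennreal (51 * (64 * L + 1)\<^sup>2 * real n powr (1 / p - 1)
    + 6 * R\<^sup>2 * card Y * sqrt (4 * (2 * L + 1)) * real n powr (- 1 / 2)
    + 12 * R * card Y * real m powr (- 1 / 2))"
    using R0 L by (intro ennreal_plus[symmetric]) auto
  finally show ?thesis .
qed

section \<open>Moments and the choice of constants\<close>

lemma moment_le:
  assumes \<mu>: "prob_space \<mu>" "sets \<mu> = sets borel" and M: "moment r \<mu> \<le> ennreal M" "0 \<le> M" and s: "0 \<le> s" "s \<le> r"
  shows "(\<integral>\<^sup>+x. ennreal (norm x powr s) \<partial>\<mu>) \<le> ennreal (1 + M)"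
proof -
  interpret prob_space \<mu> by fact
  note [measurable_cong] = \<mu>(2)
  have "(\<integral>\<^sup>+x. ennreal (norm x powr s) \<partial>\<mu>) \<le> (\<integral>\<^sup>+x. 1 + ennreal (norm x powr r) \<partial>\<mu>)"
  proof (rule nn_integral_mono)
    fix x :: 'a
    have "norm x powr s \<le> 1 + norm x powr r"
    proof (cases "norm x \<le> 1")
      case True
      then have "norm x powr s \<le> 1 powr s" using s by (intro powr_mono2) auto
      then show ?thesis by (simp add: add_increasing2)
    next
      case False
      then have "norm x powr s \<le> norm x powr r" using s by (intro powr_mono) auto
      then show ?thesis by simp
    qed
    then have "ennreal (norm x powr s) \<le> ennreal (1 + norm x powr r)" by (rule ennreal_leI)
    then show "ennreal (norm x powr s) \<le> 1 + ennreal (norm x powr r)" by (simp add: ennreal_plus)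
  qed
  also have "\<dots> = 1 + moment r \<mu>"
    unfolding moment_def by (subst nn_integral_add) (auto simp: emeasure_space_1)
  also have "\<dots> \<le> ennreal (1 + M)" using M by (simp add: ennreal_plus add_left_mono)
  finally show ?thesis .
qed

theorem proposition3p3:
  fixes q M \<eta> :: real and l :: nat
  assumes "2 < q" and "1 \<le> M"
  shows "\<exists>C>0. \<forall>(y :: nat \<Rightarrow> real ^ 'dy) (w :: nat \<Rightarrow> real).
    (MAX j\<in>{1..l}. norm (y j)) \<le> 1 \<and> (\<forall>j\<in>{1..l}. 0 < w j) \<and> (\<Sum>j = 1..l. w j) = 1 \<and>
    (MIN j\<in>{1..l}. w j) = \<eta> \<longrightarrow>
    (\<forall>n\<ge>2. \<forall>m\<ge>2.
      (SUP \<mu> \<in> {\<mu> :: (real ^ 'dx) measure. \<mu> \<in> prob_moment (2 * q) \<and> moment (2 * q) \<mu> \<le> ennreal M}.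
         expected_error n m \<mu> (discrete_measure l w y))
      \<le> ennreal (C * (real (min n m) powr (- 1 / 2) + real n powr ((2 - q) / q))))"
proof (cases "0 < \<eta>")
  \<comment> \<open>A minimum over finitely many weights is one of them, hence positive; otherwise
    the premises are contradictory and any constant serves.\<close>
  case False
  have "\<not> ((\<forall>j\<in>{1..l}. 0 < w j) \<and> (\<Sum>j = 1..l. w j) = 1 \<and> (MIN j\<in>{1..l}. w j) = \<eta>)" for w :: "nat \<Rightarrow> real"
  proof
    assume *: "(\<forall>j\<in>{1..l}. 0 < w j) \<and> (\<Sum>j = 1..l. w j) = 1 \<and> (MIN j\<in>{1..l}. w j) = \<eta>"
    then have "{1..l} \<noteq> {}" by (metis sum.empty zero_neq_one)
    then have "Min (w ` {1..l}) \<in> w ` {1..l}" by (intro Min_in) auto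
    with * False show False by auto
  qed
  then show ?thesis by (intro exI[of _ 1]) auto
next
  case True
  define L where "L = 1 + M"
  \<comment> \<open>The fourth-power kernel has a moment of order \<open>q / 2\<close>, and the
    deviation bounds reach order 2. For \<open>q > 4\<close> the cap yields the rate
    \<open>real n powr (- 1 / 2)\<close>, which the first term of the claim already
    contains.\<close>
  define p where "p = min (q / 2) 2"
  define R where "R = 276 * (L + 1)\<^sup>2 / \<eta>"
  define A where "A = 51 * (64 * L + 1)\<^sup>2"
  define B where "B = 6 * R\<^sup>2 * sqrt (4 * (2 * L + 1))"
  define C where "C = A + B * l + 12 * R * l"
  have L: "1 \<le> L" using assms by (simp add: L_def)
  have p: "1 < p" "p \<le> 2" "4 * p \<le> 2 * q" using assms by (auto simp: p_def min_def)
  have R0: "0 < R" using True L by (simp add: R_def)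
  have A0: "0 < A" and B0: "0 \<le> B" using L by (simp_all add: A_def B_def)
  have C0: "0 < C" using A0 B0 R0 by (auto simp: C_def intro!: add_pos_nonneg)
  show ?thesis
  proof (intro exI[of _ C] conjI allI impI C0 SUP_least)
    fix y :: "nat \<Rightarrow> real ^ 'dy" and w :: "nat \<Rightarrow> real" and n m :: nat and \<mu> :: "(real ^ 'dx) measure"
    assume asm: "(MAX j\<in>{1..l}. norm (y j)) \<le> 1 \<and> (\<forall>j\<in>{1..l}. 0 < w j) \<and> (\<Sum>j = 1..l. w j) = 1 \<and> (MIN j\<in>{1..l}. w j) = \<eta>"
      and nm: "2 \<le> n" "2 \<le> m"
      and "\<mu> \<in> {\<mu>. \<mu> \<in> prob_moment (2 * q) \<and> moment (2 * q) \<mu> \<le> ennreal M}"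
    then have \<mu>: "prob_space \<mu>" "sets \<mu> = sets borel" and mom: "moment (2 * q) \<mu> \<le> ennreal M"
      by (auto simp: prob_moment_def)
    note [measurable_cong] = \<mu>(2)
    \<comment> \<open>The points \<open>y j\<close> may coincide; merging them adds weights, so the
      lower bound \<eta> persists and \<open>card Y\<close> is at most \<open>l\<close>.\<close>
    define Y where "Y = y ` {1..l}"
    have Y: "finite Y" "card Y \<le> l" using card_image_le[of "{1..l}" y] by (auto simp: Y_def)
    have l: "{1..l} \<noteq> {}" using asm by (metis sum.empty zero_neq_one)
    then have Y0: "Y \<noteq> {}" by (simp add: Y_def)
    have y1: "norm (y j) \<le> 1" if "j \<in> {1..l}" for j
      using asm Max_ge[of "(\<lambda>j. norm (y j)) ` {1..l}" "norm (y j)"] that by auto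
    have w: "0 \<le> w j" "\<eta> \<le> w j" if "j \<in> {1..l}" for j
      using asm Min_le[of "w ` {1..l}" "w j"] that by (auto simp: less_imp_le)
    have N: "supported_in Y (discrete_measure l w y)"
      using w asm y1 Y by (intro supported_in_discrete_measure) (auto simp: Y_def)
    have \<eta>: "\<eta> \<le> measure (discrete_measure l w y) {v}" if v: "v \<in> Y" for v
    proof -
      obtain j where j: "j \<in> {1..l}" "v = y j" using v unfolding Y_def by blast
      have "\<eta> \<le> w j * indicator {v} (y j)" using w[OF j(1)] j by simp
      also have "\<dots> \<le> (\<Sum>j = 1..l. w j * indicator {v} (y j))"
        using j w by (intro member_le_sum) auto
      finally show ?thesis using measure_discrete_measure[of l w y v] w by simp
    qed
    have powr_le: "(\<integral>\<^sup>+x. ennreal (norm x powr s) \<partial>\<mu>) \<le> ennreal L" if "0 \<le> s" "s \<le> 2 * q" for s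
      unfolding L_def by (rule moment_le[OF \<mu> mom]) (use assms that in auto)
    have pow_le: "integrable \<mu> (\<lambda>x. norm x ^ k)" "(\<integral>x. norm x ^ k \<partial>\<mu>) \<le> L" if k: "k = 2 \<or> k = 4" for k
    proof -
      have "(\<integral>\<^sup>+x. ennreal (norm x ^ k) \<partial>\<mu>) = (\<integral>\<^sup>+x. ennreal (norm x powr real k) \<partial>\<mu>)"
        using k by (intro nn_integral_cong) auto
      also have "\<dots> \<le> ennreal L" using k assms by (intro powr_le) auto
      finally have le: "(\<integral>\<^sup>+x. ennreal (norm x ^ k) \<partial>\<mu>) \<le> ennreal L" .
      then show int: "integrable \<mu> (\<lambda>x. norm x ^ k)"
        by (intro integrableI_bounded) (auto intro: le_less_trans)
      show "(\<integral>x. norm x ^ k \<partial>\<mu>) \<le> L"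
        using le int L by (subst (asm) nn_integral_eq_integral) auto
    qed
    have M: "finite_fourth_moment \<mu>" using \<mu> pow_le(1)[of 4] by (simp add: finite_fourth_moment_def)
    have Lp: "(\<integral>\<^sup>+x. ennreal ((norm x ^ 4) powr p) \<partial>\<mu>) \<le> ennreal L"
    proof -
      have "(norm x ^ 4) powr p = norm x powr (4 * p)" for x :: "real ^ 'dx"
        using powr_powr[of "norm x" 4 p] by simp
      then show ?thesis using powr_le[of "4 * p"] p by simp
    qed
    let ?S = "real (min n m) powr (- 1 / 2) + real n powr ((2 - q) / q)"
    have n_le: "real n powr (- 1 / 2) \<le> ?S" and m_le: "real m powr (- 1 / 2) \<le> ?S"
      using nm by (auto intro!: add_increasing2 powr_mono2')
    have p_le: "real n powr (1 / p - 1) \<le> ?S"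
    proof (cases "q / 2 \<le> 2")
      case True
      then have "1 / p - 1 = (2 - q) / q" using assms by (simp add: p_def field_simps)
      then show ?thesis by simp
    next
      case False
      then have "1 / p - 1 = - 1 / 2" by (simp add: p_def min_def)
      then show ?thesis using n_le by simp
    qed
    have "expected_error n m \<mu> (discrete_measure l w y) \<le> ennreal (A * real n powr (1 / p - 1)
        + 6 * R\<^sup>2 * card Y * sqrt (4 * (2 * L + 1)) * real n powr (- 1 / 2) + 12 * R * card Y * real m powr (- 1 / 2))"
      unfolding A_def
      by (rule expected_error_le[OF M N Y0 True \<eta> p(1,2) L pow_le(2) pow_le(2) Lp R_def]) (use nm in auto)
    also have "\<dots> \<le> ennreal (C * ?S)"
    proof (rule ennreal_leI)
      have "6 * R\<^sup>2 * card Y * sqrt (4 * (2 * L + 1)) * real n powr (- 1 / 2) = B * card Y * real n powr (- 1 / 2)"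
        by (simp add: B_def)
      also have "\<dots> \<le> B * l * ?S"
        using B0 Y(2) n_le by (intro mult_mono) auto
      finally have b: "6 * R\<^sup>2 * card Y * sqrt (4 * (2 * L + 1)) * real n powr (- 1 / 2) \<le> B * l * ?S" .
      have c: "12 * R * card Y * real m powr (- 1 / 2) \<le> 12 * R * l * ?S"
        using R0 Y(2) m_le by (intro mult_mono) auto
      have a: "A * real n powr (1 / p - 1) \<le> A * ?S" using A0 p_le by (intro mult_left_mono) auto
      show "A * real n powr (1 / p - 1) + 6 * R\<^sup>2 * card Y * sqrt (4 * (2 * L + 1)) * real n powr (- 1 / 2)
          + 12 * R * card Y * real m powr (- 1 / 2) \<le> C * ?S"
        unfolding C_def distrib_right[of _ _ ?S] using a b c by (intro add_mono)
    qed
    finally show "expected_error n m \<mu> (discrete_measure l w y) \<le> ennreal (C * ?S)" .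
  qed
qed

end
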